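(* Let $r\ge1$ be a fixed integer and let $\Pi=(\Pi_1,\dots,\Pi_\ell)$ be an $[r]$-pattern with $\ell\ge 2$ in which every color of $[r]$ appears. Consider the randomly $[r]$-colored random graph process $G_0^r,G_1^r,\dots,G_N^r$ on $[n]$ with $\ell\mid n$. Let $$\tau_1=\min\{i: G_i \text{ has minimum degree at least } 1\},\qquad \tau_{\Pi-connected}=\min\{i: G_i^r \text{ is } \Pi\text{-connected}\}.$$ Then with high probability $\tau_{\Pi-connected}=\tau_1$.
   Context: The colored random graph process: let $N=\binom n2$. $G_0$ is the empty graph on $[n]$ and for $i\in[N]$, $G_i$ is obtained from $G_{i-1}$ by adding an edge $e_i$ chosen uniformly at random among the edges not in $G_{i-1}$; independently, $e_i$ receives a color chosen uniformly at random from $[r]$; $G_i^r$ is $G_i$ with these colors. An $[r]$-pattern is a finite sequence $\Pi=(\Pi_1,\dots,\Pi_\ell)$ with entries in $[r]$, indices taken cyclically ($\Pi_s=\Pi_j$ where $j\equiv s\pmod\ell$). A path with consecutive edges $f_1,\dots,f_k$ is $\Pi$-colored if there is $0\le l\le\ell-1$ such that $f_j$ has color $\Pi_{j+l}$ for all $j\in[k]$. A colored graph is $\Pi$-connected if every two vertices are joined by a $\Pi$-colored path. "With high probability" means with probability tending to $1$ as $n\to\infty$. *)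

theory Defs
  imports "HOL-Probability.Probability" "HOL-Library.Extended_Nat"
begin

text \<open>The vertex set is \<open>{1..n}\<close>, colors are the elements of \<open>{1..r}\<close>, and an edge is a
  two-element set of vertices. A colored graph is a set of pairs (edge, color).\<close>

type_synonym edge = "nat set"
type_synonym colored_graph = "(edge \<times> nat) set"

definition all_edges :: "nat \<Rightarrow> edge set" where
  "all_edges n = {e. e \<subseteq> {1..n} \<and> card e = 2}"

text \<open>The law of the first \<open>i\<close> steps of the process, recorded as the list of colored edges in
  their order of arrival. It is meaningful for \<open>i \<le> n choose 2\<close> only: beyond that there is no edge
  left to choose from, and \<open>pmf_of_set {}\<close> is unspecified.\<close>

primrec process :: "nat \<Rightarrow> nat \<Rightarrow> nat \<Rightarrow> (edge \<times> nat) list pmf" where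
  "process n r 0 = return_pmf []"
| "process n r (Suc i) =
     bind_pmf (process n r i) (\<lambda>\<omega>.
       bind_pmf (pmf_of_set (all_edges n - fst ` set \<omega>)) (\<lambda>e.
         bind_pmf (pmf_of_set {1..r}) (\<lambda>c. return_pmf (\<omega> @ [(e, c)]))))"

abbreviation full_process :: "nat \<Rightarrow> nat \<Rightarrow> (edge \<times> nat) list pmf" where
  "full_process n r \<equiv> process n r (n choose 2)"

definition graph_at :: "(edge \<times> nat) list \<Rightarrow> nat \<Rightarrow> colored_graph" where
  "graph_at \<omega> i = set (take i \<omega>)"

definition degree :: "colored_graph \<Rightarrow> nat \<Rightarrow> nat" where
  "degree G v = card {e \<in> fst ` G. v \<in> e}"

definition min_degree :: "nat \<Rightarrow> colored_graph \<Rightarrow> nat" where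
  "min_degree n G = Min (degree G ` {1..n})"

definition is_pattern :: "nat \<Rightarrow> nat list \<Rightarrow> bool" where
  "is_pattern r pat \<longleftrightarrow> set pat \<subseteq> {1..r}"

text \<open>The entry with cyclic index \<open>s \<ge> 1\<close>, where the pattern is indexed from 1 whereas lists are
  indexed from 0.\<close>

definition pattern_at :: "nat list \<Rightarrow> nat \<Rightarrow> nat" where
  "pattern_at pat s = pat ! ((s - 1) mod length pat)"

text \<open>A path is the list of its (distinct) vertices; its \<open>j\<close>-th edge, for
  \<open>1 \<le> j \<le> length p - 1\<close>, joins the list entries \<open>j - 1\<close> and \<open>j\<close>.\<close>

definition path_edge :: "nat list \<Rightarrow> nat \<Rightarrow> edge" where
  "path_edge p j = {p ! (j - 1), p ! j}"

definition is_path :: "nat \<Rightarrow> colored_graph \<Rightarrow> nat list \<Rightarrow> bool" where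
  "is_path n G p \<longleftrightarrow> p \<noteq> [] \<and> distinct p \<and> set p \<subseteq> {1..n} \<and>
     (\<forall>j\<in>{1..length p - 1}. path_edge p j \<in> fst ` G)"

definition pattern_colored :: "nat list \<Rightarrow> colored_graph \<Rightarrow> nat list \<Rightarrow> bool" where
  "pattern_colored pat G p \<longleftrightarrow>
     (\<exists>l<length pat. \<forall>j\<in>{1..length p - 1}. (path_edge p j, pattern_at pat (j + l)) \<in> G)"

text \<open>Two vertices are joined by a path if they are its two endpoints, in either order: being
  pattern-colored depends on the direction in which a path is traversed, being joined does not.\<close>

definition pattern_connected :: "nat list \<Rightarrow> nat \<Rightarrow> colored_graph \<Rightarrow> bool" where
  "pattern_connected pat n G \<longleftrightarrow>
     (\<forall>u\<in>{1..n}. \<forall>v\<in>{1..n}. u \<noteq> v \<longrightarrow>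
        (\<exists>p. is_path n G p \<and> {hd p, last p} = {u, v} \<and> pattern_colored pat G p))"

text \<open>The first time at which a property holds; it is \<open>\<infinity>\<close> if the property holds at no time up to
  \<open>n choose 2\<close>.\<close>

definition hitting_time :: "nat \<Rightarrow> (colored_graph \<Rightarrow> bool) \<Rightarrow> (edge \<times> nat) list \<Rightarrow> enat" where
  "hitting_time n Q \<omega> = Inf (enat ` {i. i \<le> n choose 2 \<and> Q (graph_at \<omega> i)})"

definition tau_1 :: "nat \<Rightarrow> (edge \<times> nat) list \<Rightarrow> enat" where
  "tau_1 n = hitting_time n (\<lambda>G. min_degree n G \<ge> 1)"

definition tau_connected :: "nat list \<Rightarrow> nat \<Rightarrow> (edge \<times> nat) list \<Rightarrow> enat" where
  "tau_connected pat n = hitting_time n (pattern_connected pat n)"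

end

theory Submission
  imports Defs "HOL-Real_Asymp.Real_Asymp"
begin

text \<open>Let \<open>m0\<close> and \<open>m1\<close> be slightly below and at twice the connectivity threshold \<open>n ln n / 2\<close>, so
  that \<open>\<tau>\<^sub>1\<close> lies between them with high probability (second moment for \<open>m0\<close>, first moment for
  \<open>m1\<close>). Call a vertex good if in \<open>G_m0\<close> it has at least \<open>d\<close> edges of each color, where \<open>d\<close> is a
  large constant. First moment bounds show that with high probability no vertex has many bad
  neighbors, that the neighbors of a vertex of degree below \<open>d\<close> in \<open>G_m0\<close> are good even in \<open>G_m1\<close>,
  and that two such vertices have no common neighbor. Hence, at time \<open>\<tau>\<^sub>1\<close>, any two nonadjacent
  vertices have distinct good neighbors.

  From these two neighbors one grows two disjoint trees along prescribed color sequences, doubling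
  the last layer in each step. While the layers have size at most \<open>n powr (1 - \<eta>)\<close> this works for
  good vertices because small sets span few edges; afterwards it works for all vertices because no
  color is missing between a large set and the complement of a set of eight times its size. Layers
  of linear size are joined by an edge of any desired color; before that, at most \<open>length pat\<close>
  additional layers adjust the length of the path so that its last color is the one required.\<close>

section \<open>The edge process\<close>

text \<open>Colors rather than degrees are the obstacle: around \<open>tau_1\<close> a vertex still
  lacks a given color with probability about \<open>n powr - (1 / r)\<close>, so for
  \<open>r > 1\<close> there are many vertices at which a prescribed color sequence cannot continue.
  They cannot be excluded, only kept from clustering. Since \<open>tau_1\<close> is random, nothing
  is estimated at that time: presence of edges is measured at \<open>m1\<close>, absence at
  \<open>m0\<close>, and both pass to every graph in between. Edges are drawn without replacement
  and hence are not independent; one supermartingale bound restores a product formula, with an edge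
  weight that is too large by a constant factor. The events that require present edges have a power
  of \<open>n\<close> to spare for this loss. The exponents fit as follows: with \<open>m0\<close> a
  fraction \<open>1 / (8 * r)\<close> below the threshold, degree below \<open>d\<close> costs about
  \<open>n powr - (1 - 1 / (8 * r))\<close> and lack of one color at most about
  \<open>n powr - (1 / (4 * r))\<close>. Up to logarithms, adjacent pairs of such vertices then
  number \<open>n powr - (1 / (8 * r))\<close> in expectation.\<close>

lemma finite_all_edges [simp]: "finite (all_edges n)"
  by (rule finite_subset[of _ "Pow {1..n}"]) (auto simp: all_edges_def)

lemma card_all_edges: "card (all_edges n) = n choose 2"
  using n_subsets[of "{1..n}" 2] by (simp add: all_edges_def)

lemma card_unused_edges:
  assumes "length \<omega> = i" "distinct (map fst \<omega>)" "set \<omega> \<subseteq> all_edges n \<times> C"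
  shows "card (all_edges n - fst ` set \<omega>) = (n choose 2) - i"
proof -
  have "card (fst ` set \<omega>) = i"
    using distinct_card[OF assms(2)] assms(1) by simp
  moreover have "fst ` set \<omega> \<subseteq> all_edges n" using assms(3) by auto
  ultimately show ?thesis by (simp add: card_Diff_subset card_all_edges)
qed

lemma process_support:
  assumes "r \<ge> 1" "i \<le> n choose 2" "\<omega> \<in> set_pmf (process n r i)"
  shows "length \<omega> = i \<and> distinct (map fst \<omega>) \<and> set \<omega> \<subseteq> all_edges n \<times> {1..r}"
  using assms(2,3)
proof (induction i arbitrary: \<omega>)
  case (Suc i)
  from Suc.prems obtain \<omega>' where w': "\<omega>' \<in> set_pmf (process n r i)"
    and w: "\<omega> \<in> set_pmf (pmf_of_set (all_edges n - fst ` set \<omega>') \<bind>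
         (\<lambda>e. pmf_of_set {1..r} \<bind> (\<lambda>c. return_pmf (\<omega>' @ [(e, c)]))))"
    by auto
  have IH: "length \<omega>' = i \<and> distinct (map fst \<omega>') \<and> set \<omega>' \<subseteq> all_edges n \<times> {1..r}"
    using Suc.IH[OF _ w'] Suc.prems by simp
  then have "card (all_edges n - fst ` set \<omega>') > 0"
    using card_unused_edges[of \<omega>' i n "{1..r}"] Suc.prems by simp
  then have "all_edges n - fst ` set \<omega>' \<noteq> {}" by fastforce
  then have "set_pmf (pmf_of_set (all_edges n - fst ` set \<omega>')) = all_edges n - fst ` set \<omega>'"
    by simp
  moreover have "set_pmf (pmf_of_set {1..r}) = {1..r}" using assms(1) by simp
  ultimately obtain e c where "e \<in> all_edges n - fst ` set \<omega>'" "c \<in> {1..r}" "\<omega> = \<omega>' @ [(e, c)]"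
    using w by (auto simp del: set_pmf_of_set)
  then show ?case using IH by (auto simp: image_iff)
qed simp

lemma finite_process_support:
  assumes "r \<ge> 1" "i \<le> n choose 2"
  shows "finite (set_pmf (process n r i))"
proof (rule finite_subset)
  show "set_pmf (process n r i) \<subseteq> {\<omega>. set \<omega> \<subseteq> all_edges n \<times> {1..r} \<and> length \<omega> = i}"
    using process_support[OF assms] by blast
qed (simp add: finite_lists_length_eq)

text \<open>Later steps only append to the list. Events about the graph at time \<open>m\<close>
  under \<open>full_process\<close> can therefore be evaluated with a potential that runs for
  \<open>m\<close> steps only.\<close>

lemma map_take_process:
  assumes "r \<ge> 1" "m \<le> M" "M \<le> n choose 2"
  shows "map_pmf (take m) (process n r M) = process n r m"
  using assms(2,3)
proof (induction M)
  case (Suc M)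
  show ?case
  proof (cases "m = Suc M")
    case True
    have "map_pmf (take m) (process n r (Suc M)) = map_pmf (\<lambda>x. x) (process n r (Suc M))"
      using process_support[OF assms(1) Suc.prems(2)] True
      by (intro map_pmf_cong) (auto simp del: process.simps)
    then show ?thesis using True by (simp only: map_pmf_ident)
  next
    case False
    then have mM: "m \<le> M" using Suc.prems by simp
    have "map_pmf (take m) (process n r (Suc M)) =
      bind_pmf (process n r M) (\<lambda>\<omega>. return_pmf (take m \<omega>))"
      unfolding process.simps map_bind_pmf
    proof (intro bind_pmf_cong refl)
      fix \<omega> assume "\<omega> \<in> set_pmf (process n r M)"
      then have "length \<omega> = M" using process_support[OF assms(1), of M n \<omega>] Suc.prems by simp
      then show "pmf_of_set (all_edges n - fst ` set \<omega>) \<bind>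
         (\<lambda>e. pmf_of_set {1..r} \<bind> (\<lambda>c. map_pmf (take m) (return_pmf (\<omega> @ [(e, c)])))) =
         return_pmf (take m \<omega>)" using mM by simp
    qed
    also have "\<dots> = process n r m"
      using Suc.IH[OF mM] Suc.prems by (simp add: map_pmf_def)
    finally show ?thesis .
  qed
qed simp

text \<open>The conditional expectation of \<open>h\<close> after one more arrival, given that the
  arrivals so far are \<open>\<omega>\<close>.\<close>

definition step_mean :: "nat \<Rightarrow> nat \<Rightarrow> ((edge \<times> nat) list \<Rightarrow> real) \<Rightarrow> (edge \<times> nat) list \<Rightarrow> real" where
  "step_mean n r h \<omega> = (\<Sum>e\<in>all_edges n - fst ` set \<omega>. (\<Sum>c\<in>{1..r}. h (\<omega> @ [(e, c)])) / r)
     / card (all_edges n - fst ` set \<omega>)"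

lemma expectation_process_Suc:
  assumes "r \<ge> 1" "i < n choose 2"
  shows "measure_pmf.expectation (process n r (Suc i)) h =
    measure_pmf.expectation (process n r i) (step_mean n r h)"
proof -
  let ?f = "\<lambda>\<omega>. pmf_of_set (all_edges n - fst ` set \<omega>) \<bind>
         (\<lambda>e. pmf_of_set {1..r} \<bind> (\<lambda>c. return_pmf (\<omega> @ [(e, c)])))"
  have ne: "all_edges n - fst ` set \<omega> \<noteq> {}" if "\<omega> \<in> set_pmf (process n r i)" for \<omega>
  proof -
    have "card (all_edges n - fst ` set \<omega>) > 0"
      using card_unused_edges[of \<omega> i n "{1..r}"] process_support[OF assms(1) _ that] assms(2) by simp
    then show ?thesis by fastforce
  qed
  have col: "set_pmf (pmf_of_set {1..r}) = {1..r}" using assms(1) by simp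
  have fin: "finite (set_pmf (process n r i))"
    using finite_process_support[OF assms(1)] assms(2) by simp
  have "measure_pmf.expectation (process n r (Suc i)) h =
    (\<Sum>\<omega>\<in>set_pmf (process n r i). pmf (process n r i) \<omega> *\<^sub>R measure_pmf.expectation (?f \<omega>) h)"
    unfolding process.simps using ne col fin
    by (intro pmf_expectation_bind) (auto simp del: set_pmf_of_set simp: set_pmf_of_set[OF ne])
  also have "\<dots> = (\<Sum>\<omega>\<in>set_pmf (process n r i). pmf (process n r i) \<omega> *\<^sub>R step_mean n r h \<omega>)"
  proof (intro sum.cong refl arg_cong2[where f=scaleR])
    fix \<omega> assume w: "\<omega> \<in> set_pmf (process n r i)"
    have "measure_pmf.expectation (?f \<omega>) h = (\<Sum>e\<in>all_edges n - fst ` set \<omega>.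
       measure_pmf.expectation (pmf_of_set {1..r} \<bind> (\<lambda>c. return_pmf (\<omega> @ [(e, c)]))) h
         /\<^sub>R real (card (all_edges n - fst ` set \<omega>)))"
      using ne[OF w] col by (intro pmf_expectation_bind_pmf_of_set) (auto simp del: set_pmf_of_set)
    also have "\<dots> = (\<Sum>e\<in>all_edges n - fst ` set \<omega>.
       ((\<Sum>c\<in>{1..r}. h (\<omega> @ [(e, c)])) / r) / real (card (all_edges n - fst ` set \<omega>)))"
    proof (intro sum.cong refl)
      fix e
      have "measure_pmf.expectation (pmf_of_set {1..r} \<bind> (\<lambda>c. return_pmf (\<omega> @ [(e, c)]))) h =
        (\<Sum>c\<in>{1..r}. measure_pmf.expectation (return_pmf (\<omega> @ [(e, c)])) h /\<^sub>R real (card {1..r}))"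
        using assms(1) by (intro pmf_expectation_bind_pmf_of_set) auto
      then show "measure_pmf.expectation (pmf_of_set {1..r} \<bind> (\<lambda>c. return_pmf (\<omega> @ [(e, c)]))) h
         /\<^sub>R real (card (all_edges n - fst ` set \<omega>)) =
        ((\<Sum>c\<in>{1..r}. h (\<omega> @ [(e, c)])) / r) / real (card (all_edges n - fst ` set \<omega>))"
        by (simp add: sum_distrib_left sum_divide_distrib field_simps)
    qed
    also have "\<dots> = step_mean n r h \<omega>"
      by (simp add: step_mean_def sum_divide_distrib)
    finally show "measure_pmf.expectation (?f \<omega>) h = step_mean n r h \<omega>" .
  qed
  also have "\<dots> = measure_pmf.expectation (process n r i) (step_mean n r h)"
    using fin by (subst integral_measure_pmf[of "set_pmf (process n r i)"]) auto
  finally show ?thesis .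
qed

text \<open>The supermartingale inequality. When \<open>V m\<close> is the indicator of an event, it
  bounds the probability of the event from above; when \<open>V m\<close> is minus an indicator,
  from below.\<close>

lemma expectation_process_le:
  assumes "r \<ge> 1" "m \<le> n choose 2"
    and step: "\<And>i \<omega>. i < m \<Longrightarrow> \<omega> \<in> set_pmf (process n r i) \<Longrightarrow> step_mean n r (V (Suc i)) \<omega> \<le> V i \<omega>"
  shows "measure_pmf.expectation (process n r m) (V m) \<le> V 0 []"
proof -
  have "i \<le> m \<Longrightarrow> measure_pmf.expectation (process n r i) (V i) \<le> V 0 []" for i
  proof (induction i)
    case (Suc i)
    have fin: "finite (set_pmf (process n r i))"
      using finite_process_support[OF assms(1)] assms(2) Suc.prems by simp
    have "measure_pmf.expectation (process n r (Suc i)) (V (Suc i)) =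
        measure_pmf.expectation (process n r i) (step_mean n r (V (Suc i)))"
      using expectation_process_Suc[OF assms(1)] assms(2) Suc.prems by simp
    also have "\<dots> \<le> measure_pmf.expectation (process n r i) (V i)"
      using step[of i] Suc.prems fin
      by (intro integral_mono_AE integrable_measure_pmf_finite) (auto simp: AE_measure_pmf_iff)
    finally show ?case using Suc by simp
  qed simp
  then show ?thesis by simp
qed

section \<open>Joint presence and absence of edges\<close>

text \<open>These are the first two terms of the binomial expansion. In the supermartingale step
  \<open>p\<close> is the weight of a missing edge after one more arrival and \<open>p + x\<close>
  its weight before; the second term pays for the chance that one of the \<open>k\<close> missing
  edges is the one that arrives.\<close>

lemma power_add_ge_first_order:
  fixes p x :: real
  assumes "p \<ge> 0" "x \<ge> 0"
  shows "p ^ k + real k * x * p ^ (k - 1) \<le> (p + x) ^ k"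
proof (induction k)
  case (Suc k)
  have "p ^ Suc k + real (Suc k) * x * p ^ (Suc k - 1) =
    (p + x) * p ^ k + real k * x * p ^ k" by (simp add: algebra_simps)
  also have "\<dots> \<le> (p + x) * p ^ k + (p + x) * (real k * x * p ^ (k - 1))"
  proof (cases k)
    case (Suc j)
    then show ?thesis using assms by (simp add: algebra_simps)
  qed simp
  also have "\<dots> = (p + x) * (p ^ k + real k * x * p ^ (k - 1))" by (simp add: algebra_simps)
  also have "\<dots> \<le> (p + x) * (p + x) ^ k" using Suc assms by (intro mult_left_mono) auto
  finally show ?case by simp
qed simp

text \<open>The probability is propagated backwards by a potential: an edge of
  \<open>A\<close> that is still missing with \<open>j\<close> steps to go counts \<open>4 j / N\<close>, and an unused edge \<open>e\<close> of \<open>Q\<close>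
  counts the probability of not receiving a forbidden color if it were to arrive within \<open>j\<close> draws
  with replacement. The potential is a supermartingale; the factor \<open>4\<close> absorbs the positive
  correlation between the presence of \<open>A\<close> and the absence of \<open>Q\<close>.\<close>

lemma prob_present_absent_le:
  assumes r: "r \<ge> 1" and A: "A \<subseteq> all_edges n" and Q: "Q \<subseteq> all_edges n" and AQ: "A \<inter> Q = {}"
    and Fc: "\<And>e. Fc e \<subseteq> {1..r}" and m: "m0 \<le> m1" "2 * m1 \<le> n choose 2"
    and cQ: "2 * card Q \<le> n choose 2" and N2: "n choose 2 \<ge> 2"
  shows "measure_pmf.prob (full_process n r)
      {\<omega>. A \<subseteq> fst ` graph_at \<omega> m1 \<and> (\<forall>e\<in>Q. \<forall>c\<in>Fc e. (e, c) \<notin> graph_at \<omega> m0)}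
    \<le> (4 * m1 / (n choose 2)) ^ card A *
       (\<Prod>e\<in>Q. 1 - card (Fc e) / r * (1 - (1 - 1 / (n choose 2)) ^ m0))"
proof -
  define N where "N = real (n choose 2)"
  define \<kappa> where "\<kappa> = 4 / N"
  define q where "q j = (1 - 1 / N) ^ j" for j :: nat
  define \<phi> where "\<phi> e = real (card (Fc e)) / r" for e
  define g where "g e x = 1 - \<phi> e * (1 - x)" for e x
  define avoid where "avoid \<omega> \<longleftrightarrow> (\<forall>e\<in>Q. \<forall>c\<in>Fc e. (e, c) \<notin> set (take m0 \<omega>))" for \<omega>
  define V where "V i \<omega> = (if avoid \<omega> then (\<kappa> * real (m1 - i)) ^ card (A - fst ` set \<omega>) *
      (\<Prod>e\<in>Q - fst ` set \<omega>. g e (q (m0 - i))) else 0)" for i \<omega>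
  have finA: "finite A" and finQ: "finite Q"
    using A Q by (auto intro: finite_subset[OF _ finite_all_edges])
  have N: "N \<ge> 2" using N2 unfolding N_def by linarith
  have \<kappa>: "\<kappa> \<ge> 0" using N by (simp add: \<kappa>_def)
  have q01: "0 < q j" "q j \<le> 1" for j using N by (auto simp: q_def intro: power_le_one)
  have \<phi>01: "0 \<le> \<phi> e" "\<phi> e \<le> 1" for e
    using card_mono[OF _ Fc[of e]] r by (auto simp: \<phi>_def divide_simps)
  have g0: "q j \<le> g e (q j)" "g e (q j) \<le> 1" for e j
  proof -
    have "\<phi> e * (1 - q j) \<le> 1 * (1 - q j)" using \<phi>01[of e] q01[of j] by (intro mult_right_mono) auto
    then show "q j \<le> g e (q j)" by (simp add: g_def)
    show "g e (q j) \<le> 1" using \<phi>01[of e] q01[of j] by (simp add: g_def)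
  qed
  have gpos: "g e (q j) > 0" for e j using g0(1)[of j e] q01[of j] by linarith
  have step: "step_mean n r (V (Suc i)) \<omega> \<le> V i \<omega>"
    if i: "i < m1" and w: "\<omega> \<in> set_pmf (process n r i)" for i \<omega>
  proof (cases "avoid \<omega>")
    case False
    then have "\<not> avoid (\<omega> @ x)" for x unfolding avoid_def by auto
    then have "V (Suc i) (\<omega> @ x) = 0" for x by (simp add: V_def)
    then show ?thesis using False by (simp add: step_mean_def V_def)
  next
    case True
    have sup: "length \<omega> = i" "distinct (map fst \<omega>)" "set \<omega> \<subseteq> all_edges n \<times> {1..r}"
      using process_support[OF r _ w] i m by auto
    define U where "U = fst ` set \<omega>"
    define R where "R = all_edges n - U"
    define M where "M = real (card R)"
    define p' where "p' = \<kappa> * real (m1 - Suc i)"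
    define q' where "q' = q (m0 - Suc i)"
    define P where "P = (\<Prod>e\<in>Q - U. g e q')"
    define P0 where "P0 = (\<Prod>e\<in>Q - U. g e (q (m0 - i)))"
    define k where "k = card (A - U)"
    \<comment> \<open>The relative change of the factor \<open>g e\<close> in one step is
      \<open>y e / N\<close>. From time \<open>m0\<close> on, the colors of new edges are free and
      nothing changes.\<close>
    define y where "y e = (if i < m0 then \<phi> e * q' / g e q' else 0)" for e
    have M: "N / 2 \<le> M" "M \<le> N"
      using card_unused_edges[OF sup] i m by (auto simp: M_def N_def R_def U_def)
    have p': "p' \<ge> 0" using \<kappa> by (simp add: p'_def)
    have y01: "0 \<le> y e" "y e \<le> 1" for e
    proof -
      show "0 \<le> y e" using \<phi>01[of e] q01 gpos[of e] by (auto simp: y_def q'_def less_imp_le)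
      have "\<phi> e * q' \<le> g e q'" using \<phi>01[of e] by (simp add: g_def algebra_simps)
      then show "y e \<le> 1" using gpos[of e] by (simp add: y_def q'_def)
    qed
    have P_nonneg: "P \<ge> 0" and P0_nonneg: "P0 \<ge> 0"
      unfolding P_def P0_def q'_def using gpos by (meson less_imp_le prod_nonneg)+
    have gstep: "g e (q (m0 - i)) = g e q' * (1 - y e / N)" for e
    proof (cases "i < m0")
      case True
      have "m0 - i = Suc (m0 - Suc i)" using True by simp
      then have "q (m0 - i) = q' * (1 - 1 / N)" by (simp add: q_def q'_def)
      then have 1: "g e (q (m0 - i)) = g e q' - \<phi> e * q' / N" by (simp add: g_def right_diff_distrib)
      have "g e q' > 0" using gpos by (simp add: q'_def)
      then have "g e q' * y e = \<phi> e * q'" using True by (simp add: y_def)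
      then show ?thesis by (simp add: 1 right_diff_distrib)
    next
      case False
      then show ?thesis by (simp add: y_def q'_def)
    qed
    have P0_eq: "P0 = P * (\<Prod>e\<in>Q - U. 1 - y e / N)"
      by (simp add: P0_def P_def gstep prod.distrib)
    have yN: "0 \<le> y e / N" "y e / N \<le> 1" for e using y01[of e] N by (auto simp: divide_simps)
    have weier: "1 - (\<Sum>e\<in>Q - U. y e) / N \<le> (\<Prod>e\<in>Q - U. 1 - y e / N)"
      using Weierstrass_prod_ineq[of "Q - U" "\<lambda>e. y e / N"] yN by (simp add: sum_divide_distrib)
    have sumy: "0 \<le> (\<Sum>e\<in>Q - U. y e)" "(\<Sum>e\<in>Q - U. y e) \<le> N / 2"
    proof -
      show "0 \<le> (\<Sum>e\<in>Q - U. y e)" using y01 by (simp add: sum_nonneg)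
      have "(\<Sum>e\<in>Q - U. y e) \<le> (\<Sum>e\<in>Q. y e)" using y01 finQ by (intro sum_mono2) auto
      also have "\<dots> \<le> real (card Q) * 1" using y01 by (intro sum_bounded_above) auto
      also have "\<dots> \<le> N / 2" using cQ unfolding N_def by linarith
      finally show "(\<Sum>e\<in>Q - U. y e) \<le> N / 2" .
    qed
    have P_le: "P \<le> 2 * P0"
    proof -
      have "1 / 2 \<le> 1 - (\<Sum>e\<in>Q - U. y e) / N" using sumy N by (simp add: field_simps)
      then have "P * (1 / 2) \<le> P * (\<Prod>e\<in>Q - U. 1 - y e / N)"
        using weier P_nonneg by (intro mult_left_mono) auto
      then show ?thesis by (simp add: P0_eq)
    qed
    \<comment> \<open>An arriving edge of \<open>A\<close> lowers the exponent, an edge of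
      \<open>Q\<close> before time \<open>m0\<close> survives only with a permitted color, and any
      other arrival yields at most \<open>p' ^ k * P\<close>.\<close>
    have arrival: "(\<Sum>c\<in>{1..r}. V (Suc i) (\<omega> @ [(e, c)])) / r \<le>
       (if e \<in> A then p' ^ (k - 1) * P else 0) + p' ^ k * P * (1 - (if e \<in> Q then y e else 0))"
      if e: "e \<in> R" for e
    proof -
      have eU: "e \<notin> U" using e by (simp add: R_def)
      have V_le: "V (Suc i) (\<omega> @ [(e, c)]) \<le> p' ^ card (A - insert e U) * (\<Prod>e\<in>Q - insert e U. g e q')" for c
      proof -
        have "0 \<le> p' ^ card (A - insert e U) * (\<Prod>e\<in>Q - insert e U. g e q')"
          unfolding q'_def using p' gpos by (meson less_imp_le prod_nonneg mult_nonneg_nonneg zero_le_power)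
        then show ?thesis by (simp add: V_def U_def p'_def q'_def)
      qed
      consider "e \<in> A" | "e \<in> Q" "i < m0" | "e \<in> Q" "i \<ge> m0" | "e \<notin> A" "e \<notin> Q" by linarith
      then show ?thesis
      proof cases
        case 1
        then have eQ: "e \<notin> Q" using AQ by auto
        have "A - insert e U = (A - U) - {e}" "e \<in> A - U" using 1 eU by auto
        then have "card (A - insert e U) = k - 1" using finA by (simp add: k_def)
        moreover have "Q - insert e U = Q - U" using eQ by auto
        ultimately have "V (Suc i) (\<omega> @ [(e, c)]) \<le> p' ^ (k - 1) * P" for c
          using V_le[of c] by (simp add: P_def)
        then have "(\<Sum>c\<in>{1..r}. V (Suc i) (\<omega> @ [(e, c)])) \<le> real (card {1..r}) * (p' ^ (k - 1) * P)"
          by (intro sum_bounded_above)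
        then have "(\<Sum>c\<in>{1..r}. V (Suc i) (\<omega> @ [(e, c)])) / r \<le> p' ^ (k - 1) * P"
          using r by (simp add: field_simps)
        moreover have "p' ^ k * P \<ge> 0" using p' P_nonneg by simp
        ultimately show ?thesis using 1 eQ by simp
      next
        case 2
        then have eA: "e \<notin> A" using AQ by auto
        then have AU: "A - insert e U = A - U" by auto
        have QU: "Q - insert e U = (Q - U) - {e}" "e \<in> Q - U" using 2 eU by auto
        have gp: "g e q' > 0" using gpos by (simp add: q'_def)
        have prodeq: "(\<Prod>e\<in>Q - insert e U. g e q') = P / g e q'"
          unfolding P_def QU(1) using QU(2) finQ gp by (simp add: prod_diff1)
        have "V (Suc i) (\<omega> @ [(e, c)]) \<le> (if c \<in> Fc e then 0 else p' ^ k * P / g e q')" for c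
        proof (cases "c \<in> Fc e")
          case True
          then have "\<not> avoid (\<omega> @ [(e, c)])" using 2 sup(1) by (auto simp: avoid_def)
          then show ?thesis using True by (simp add: V_def)
        next
          case False
          then show ?thesis using V_le[of c] by (simp add: AU k_def prodeq)
        qed
        then have "(\<Sum>c\<in>{1..r}. V (Suc i) (\<omega> @ [(e, c)]))
          \<le> (\<Sum>c\<in>{1..r}. if c \<in> Fc e then 0 else p' ^ k * P / g e q')" by (rule sum_mono)
        also have "\<dots> = real (card ({1..r} - Fc e)) * (p' ^ k * P / g e q')"
          by (simp add: sum.If_cases Diff_eq)
        also have "real (card ({1..r} - Fc e)) = r * (1 - \<phi> e)"
          using Fc[of e] card_mono[OF _ Fc[of e]] r finite_subset[OF Fc[of e]]
          by (simp add: card_Diff_subset of_nat_diff \<phi>_def field_simps)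
        finally have "(\<Sum>c\<in>{1..r}. V (Suc i) (\<omega> @ [(e, c)])) / r \<le> (1 - \<phi> e) * (p' ^ k * P / g e q')"
          using r by (simp add: field_simps)
        also have "\<dots> = p' ^ k * P * ((1 - \<phi> e) / g e q')" by simp
        also have "(1 - \<phi> e) / g e q' = 1 - y e"
        proof -
          have "1 - y e = (g e q' - \<phi> e * q') / g e q'" using 2 gp by (simp add: y_def diff_divide_distrib)
          then show ?thesis by (simp add: g_def algebra_simps)
        qed
        finally show ?thesis using eA 2 by simp
      next
        case 3
        then have eA: "e \<notin> A" using AQ by auto
        then have AU: "A - insert e U = A - U" by auto
        have "q' = 1" using 3 by (simp add: q'_def q_def)
        then have g1: "g x q' = 1" for x by (simp add: g_def)
        have "V (Suc i) (\<omega> @ [(e, c)]) \<le> p' ^ k * P" for c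
          using V_le[of c] by (simp add: AU k_def P_def g1)
        then have "(\<Sum>c\<in>{1..r}. V (Suc i) (\<omega> @ [(e, c)])) \<le> real (card {1..r}) * (p' ^ k * P)"
          by (intro sum_bounded_above)
        then show ?thesis using r eA 3 by (simp add: field_simps y_def)
      next
        case 4
        then have "A - insert e U = A - U" "Q - insert e U = Q - U" by auto
        then have "V (Suc i) (\<omega> @ [(e, c)]) \<le> p' ^ k * P" for c
          using V_le[of c] by (simp add: k_def P_def)
        then have "(\<Sum>c\<in>{1..r}. V (Suc i) (\<omega> @ [(e, c)])) \<le> real (card {1..r}) * (p' ^ k * P)"
          by (intro sum_bounded_above)
        then show ?thesis using r 4 by (simp add: field_simps)
      qed
    qed
    have finR: "finite R" by (simp add: R_def)
    have RA: "R \<inter> A = A - U" and RQ: "R \<inter> Q = Q - U" using A Q by (auto simp: R_def)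
    have "(\<Sum>e\<in>R. (\<Sum>c\<in>{1..r}. V (Suc i) (\<omega> @ [(e, c)])) / r) \<le>
      (\<Sum>e\<in>R. (if e \<in> A then p' ^ (k - 1) * P else 0) + p' ^ k * P * (1 - (if e \<in> Q then y e else 0)))"
      using arrival by (rule sum_mono)
    also have "\<dots> = real k * (p' ^ (k - 1) * P) + p' ^ k * P * (M - (\<Sum>e\<in>Q - U. y e))"
      by (simp add: sum.distrib sum_subtractf flip: sum_distrib_left)
         (simp add: sum.If_cases[OF finR] RA RQ k_def M_def)
    finally have "step_mean n r (V (Suc i)) \<omega> \<le>
       (real k * (p' ^ (k - 1) * P) + p' ^ k * P * (M - (\<Sum>e\<in>Q - U. y e))) / M"
      unfolding step_mean_def using M N by (simp add: R_def[unfolded U_def, symmetric] M_def[symmetric] divide_right_mono)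
    also have "\<dots> = real k / M * p' ^ (k - 1) * P + p' ^ k * (P * (1 - (\<Sum>e\<in>Q - U. y e) / M))"
      using M N by (simp add: field_simps)
    also have "\<dots> \<le> (real k * \<kappa> * p' ^ (k - 1)) * P0 + p' ^ k * P0"
    proof (intro add_mono mult_left_mono)
      have "real k / M \<le> real k / (N / 2)" using M N by (intro divide_left_mono) auto
      then have "real k / M * P \<le> (real k / (N / 2)) * (2 * P0)"
        using P_le P_nonneg N by (intro mult_mono) auto
      then have "(real k / M * P) * p' ^ (k - 1) \<le> ((real k / (N / 2)) * (2 * P0)) * p' ^ (k - 1)"
        using p' by (intro mult_right_mono) auto
      then show "real k / M * p' ^ (k - 1) * P \<le> (real k * \<kappa> * p' ^ (k - 1)) * P0"
        by (simp add: \<kappa>_def mult_ac)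
      have "(\<Sum>e\<in>Q - U. y e) / N \<le> (\<Sum>e\<in>Q - U. y e) / M"
        using M N sumy by (intro divide_left_mono) auto
      then have "P * (1 - (\<Sum>e\<in>Q - U. y e) / M) \<le> P * (\<Prod>e\<in>Q - U. 1 - y e / N)"
        using weier P_nonneg by (intro mult_left_mono) auto
      then show "P * (1 - (\<Sum>e\<in>Q - U. y e) / M) \<le> P0" by (simp add: P0_eq)
    qed (use p' in auto)
    also have "\<dots> = (p' ^ k + real k * \<kappa> * p' ^ (k - 1)) * P0" by (simp add: algebra_simps)
    also have "\<dots> \<le> (p' + \<kappa>) ^ k * P0"
      using power_add_ge_first_order[OF p' \<kappa>] P0_nonneg by (intro mult_right_mono) auto
    also have "p' + \<kappa> = \<kappa> * real (m1 - i)"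
      using i by (simp add: p'_def of_nat_diff algebra_simps Suc_diff_Suc[symmetric])
    also have "(\<kappa> * real (m1 - i)) ^ k * P0 = V i \<omega>"
      using True by (simp add: V_def k_def P0_def U_def)
    finally show ?thesis .
  qed
  have m1N: "m1 \<le> n choose 2" using m by simp
  have fin1: "finite (set_pmf (process n r m1))" using finite_process_support[OF r m1N] .
  let ?E = "{\<omega>. A \<subseteq> fst ` graph_at \<omega> m1 \<and> (\<forall>e\<in>Q. \<forall>c\<in>Fc e. (e, c) \<notin> graph_at \<omega> m0)}"
  let ?E' = "{\<omega>. A \<subseteq> fst ` set \<omega> \<and> avoid \<omega>}"
  have "measure_pmf.prob (full_process n r) ?E =
     measure_pmf.prob (map_pmf (take m1) (full_process n r)) ?E'"
    using m by (simp add: vimage_def graph_at_def avoid_def min_absorb1)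
  also have "map_pmf (take m1) (full_process n r) = process n r m1"
    using map_take_process[OF r m1N] by simp
  also have "measure_pmf.prob (process n r m1) ?E' =
     measure_pmf.expectation (process n r m1) (indicator ?E')" by simp
  \<comment> \<open>At the end the weight of a missing edge is \<open>0\<close>, so its power is the
    indicator that no edge of \<open>A\<close> is missing; likewise \<open>q 0 = 1\<close> turns all
    factors of \<open>Q\<close> into \<open>1\<close>.\<close>
  also have "\<dots> = measure_pmf.expectation (process n r m1) (V m1)"
  proof (intro arg_cong2[where f="lebesgue_integral"] refl ext)
    fix \<omega> :: "(edge \<times> nat) list"
    have "q (m0 - m1) = 1" using m by (simp add: q_def)
    then show "indicator ?E' \<omega> = V m1 \<omega>"
      using finA by (auto simp: V_def g_def indicator_def card_gt_0_iff power_0_left)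
  qed
  also have "\<dots> \<le> V 0 []" using step by (intro expectation_process_le[OF r m1N])
  also have "\<dots> = (4 * m1 / (n choose 2)) ^ card A *
       (\<Prod>e\<in>Q. 1 - card (Fc e) / r * (1 - (1 - 1 / (n choose 2)) ^ m0))"
    by (simp add: V_def avoid_def \<kappa>_def N_def g_def \<phi>_def q_def)
  finally show ?thesis by simp
qed

lemma doubleton_inj_on:
  assumes "I \<inter> W = {}"
  shows "inj_on (\<lambda>(w, x). {w, x}) (I \<times> W)"
  using assms by (fastforce simp: inj_on_def doubleton_eq_iff)

lemma edge_in_all_edges: "u \<in> {1..n} \<Longrightarrow> v \<in> {1..n} \<Longrightarrow> u \<noteq> v \<Longrightarrow> {u, v} \<in> all_edges n"
  by (simp add: all_edges_def)

text \<open>The sum runs over possible small neighborhoods. Since \<open>n * p \<ge> 1\<close>, each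
  of the \<open>d\<close> possible sizes costs at most the power \<open>d\<close> of
  \<open>n * p\<close>, a loss that will be polylogarithmic.\<close>

lemma sum_small_subsets_le:
  fixes p :: real
  assumes "finite W" "card W \<le> n" "p \<ge> 0" "n * p \<ge> 1"
  shows "(\<Sum>J | J \<subseteq> W \<and> card J < d. p ^ card J) \<le> d * (n * p) ^ d"
proof -
  have "(\<Sum>J | J \<subseteq> W \<and> card J < d. p ^ card J) =
      (\<Sum>j<d. \<Sum>J | J \<in> {J. J \<subseteq> W \<and> card J < d} \<and> card J = j. p ^ card J)"
    using assms(1) by (intro sum.group[symmetric]) auto
  also have "\<dots> = (\<Sum>j<d. real (card W choose j) * p ^ j)"
  proof (intro sum.cong refl)
    fix j assume j: "j \<in> {..<d}"
    have "{J \<in> {J. J \<subseteq> W \<and> card J < d}. card J = j} = {J. J \<subseteq> W \<and> card J = j}" using j by auto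
    then show "(\<Sum>J | J \<in> {J. J \<subseteq> W \<and> card J < d} \<and> card J = j. p ^ card J) = real (card W choose j) * p ^ j"
      using n_subsets[OF assms(1), of j] by simp
  qed
  also have "\<dots> \<le> (\<Sum>j<d. (n * p) ^ d)"
  proof (intro sum_mono)
    fix j assume j: "j \<in> {..<d}"
    have "card W choose j \<le> n ^ j"
    proof (cases "j \<le> card W")
      case True
      then have "card W choose j \<le> card W ^ j" by (rule binomial_le_pow)
      also have "\<dots> \<le> n ^ j" using assms(2) by (rule power_mono) simp
      finally show ?thesis .
    next
      case False
      then have "card W choose j = 0" by simp
      then show ?thesis by linarith
    qed
    then have "real (card W choose j) \<le> real n ^ j" by (metis of_nat_le_iff of_nat_power)
    then have "real (card W choose j) * p ^ j \<le> real n ^ j * p ^ j"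
      using assms(3) by (intro mult_right_mono) auto
    also have "\<dots> = (n * p) ^ j" by (simp add: power_mult_distrib)
    also have "\<dots> \<le> (n * p) ^ d" using j assms(4) by (intro power_increasing) auto
    finally show "real (card W choose j) * p ^ j \<le> (n * p) ^ d" .
  qed
  finally show ?thesis by simp
qed

section \<open>Union bounds for vertices with few edges of given colors\<close>

locale edge_times =
  fixes n r m0 m1 :: nat
  assumes r: "r \<ge> 1" and m01: "m0 \<le> m1" and m1_le: "2 * m1 \<le> n choose 2" and N2: "n choose 2 \<ge> 2"
begin

abbreviation pr :: "(edge \<times> nat) list set \<Rightarrow> real" where
  "pr \<equiv> measure_pmf.prob (full_process n r)"

text \<open>The factors of \<open>prob_present_absent_le\<close>: \<open>p\<close> is the price of
  one edge that must be present at \<open>m1\<close>, \<open>q\<close> is the probability that a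
  fixed edge is never hit in \<open>m0\<close> draws with replacement, and \<open>miss k\<close>
  that it has not received one of \<open>k\<close> forbidden colors by then.\<close>

definition p :: real where "p = 4 * m1 / (n choose 2)"

definition q :: real where "q = (1 - 1 / (n choose 2)) ^ m0"

definition miss :: "nat \<Rightarrow> real" where "miss k = 1 - k / r * (1 - q)"

lemma p_nonneg: "p \<ge> 0" by (simp add: p_def)

lemma q_01: "0 < q" "q \<le> 1"
proof -
  have "real (n choose 2) \<ge> 2" using N2 by linarith
  moreover have "0 < 1 - 1 / x \<and> 1 - 1 / x \<le> 1" if "x \<ge> 2" for x :: real
    using that by (simp add: field_simps)
  ultimately have "0 < 1 - 1 / real (n choose 2)" "1 - 1 / real (n choose 2) \<le> 1" by blast+
  then show "0 < q" "q \<le> 1" unfolding q_def by (auto intro: power_le_one)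
qed

lemma miss_01:
  assumes "k \<le> r"
  shows "0 \<le> miss k" "miss k \<le> 1"
proof -
  have "k / r * (1 - q) \<le> 1 * 1" using assms r q_01 by (intro mult_mono) (auto simp: divide_simps)
  then show "0 \<le> miss k" by (simp add: miss_def)
  show "miss k \<le> 1" using q_01 by (simp add: miss_def)
qed

lemma miss_r: "miss r = q" using r by (simp add: miss_def)

lemma graph_at_mono: "i \<le> j \<Longrightarrow> graph_at \<omega> i \<subseteq> graph_at \<omega> j"
  by (simp add: graph_at_def set_take_subset_set_take)

text \<open>Guess the set \<open>J w\<close> of fewer than \<open>d\<close> vertices outside
  \<open>X\<close> that are joined to \<open>w\<close> by a color in \<open>C w\<close>. The edges
  to \<open>J w\<close> are present, which is relaxed to time \<open>m1\<close>, while all other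
  edges from \<open>w\<close> to the outside of \<open>X\<close> avoid \<open>C w\<close>. As only
  edges leaving \<open>X\<close> are tested, the stars of different \<open>w\<close> and the set
  \<open>A\<close> are disjoint, so the product bound applies to each guess.\<close>

lemma prob_low_stars_le:
  assumes I: "I \<subseteq> X" and X: "X \<subseteq> {1..n}" and A: "A \<subseteq> all_edges n" "\<And>e. e \<in> A \<Longrightarrow> e \<subseteq> X"
    and C: "\<And>w. w \<in> I \<Longrightarrow> C w \<subseteq> {1..r}"
    and small: "2 * (card I * n) \<le> n choose 2" and np: "n * p \<ge> 1"
  shows "pr {\<omega>. A \<subseteq> fst ` graph_at \<omega> m1 \<and>
       (\<forall>w\<in>I. card {x \<in> {1..n} - X. \<exists>c\<in>C w. ({w, x}, c) \<in> graph_at \<omega> m0} < d)}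
     \<le> p ^ card A * (\<Prod>w\<in>I. d * (n * p) ^ d * miss (card (C w)) ^ (n - card X - d))"
proof -
  define W where "W = {1..n} - X"
  define S where "S = {J. J \<subseteq> W \<and> card J < d}"
  define ed where "ed = (\<lambda>(w::nat, x::nat). {w, x})"
  \<comment> \<open>The union has a single member on every edge between \<open>I\<close> and
    \<open>W\<close>, which has only one end in \<open>I\<close>.\<close>
  define Fc where "Fc e = \<Union>(C ` (e \<inter> I))" for e
  define B where "B J = A \<union> ed ` (SIGMA w:I. J w)" for J
  define Q where "Q J = ed ` (SIGMA w:I. W - J w)" for J
  define E where "E J = {\<omega>. B J \<subseteq> fst ` graph_at \<omega> m1 \<and> (\<forall>e\<in>Q J. \<forall>c\<in>Fc e. (e, c) \<notin> graph_at \<omega> m0)}" for J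
  have fin: "finite X" "finite I" "finite W" "finite S"
    using I X finite_subset by (auto simp: W_def S_def intro: finite_subset)
  have finA: "finite A" using A(1) finite_subset[OF _ finite_all_edges] by auto
  have cW: "card W = n - card X" unfolding W_def using X fin by (simp add: card_Diff_subset)
  have IW: "I \<inter> W = {}" using I by (auto simp: W_def)
  have inj: "inj_on ed (I \<times> W)" unfolding ed_def using doubleton_inj_on[OF IW] .
  have Fc_ed: "Fc {w, x} = C w" if "w \<in> I" "x \<in> W" for w x
  proof -
    have "{w, x} \<inter> I = {w}" using that IW by auto
    then show ?thesis by (simp add: Fc_def)
  qed
  have sub: "{\<omega>. A \<subseteq> fst ` graph_at \<omega> m1 \<and>
       (\<forall>w\<in>I. card {x \<in> {1..n} - X. \<exists>c\<in>C w. ({w, x}, c) \<in> graph_at \<omega> m0} < d)} \<subseteq> (\<Union>J\<in>PiE I (\<lambda>_. S). E J)"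
  proof
    fix \<omega> assume "\<omega> \<in> {\<omega>. A \<subseteq> fst ` graph_at \<omega> m1 \<and>
       (\<forall>w\<in>I. card {x \<in> {1..n} - X. \<exists>c\<in>C w. ({w, x}, c) \<in> graph_at \<omega> m0} < d)}"
    then have wA: "A \<subseteq> fst ` graph_at \<omega> m1"
      and wI: "\<And>w. w \<in> I \<Longrightarrow> card {x \<in> W. \<exists>c\<in>C w. ({w, x}, c) \<in> graph_at \<omega> m0} < d"
      by (auto simp: W_def)
    define J where "J = (\<lambda>w\<in>I. {x \<in> W. \<exists>c\<in>C w. ({w, x}, c) \<in> graph_at \<omega> m0})"
    have "J \<in> PiE I (\<lambda>_. S)" using wI by (auto simp: J_def S_def)
    moreover have "\<omega> \<in> E J"
    proof -
      have "ed ` (SIGMA w:I. J w) \<subseteq> fst ` graph_at \<omega> m1"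
        using graph_at_mono[OF m01, of \<omega>] by (force simp: ed_def J_def)
      moreover have "(e, c) \<notin> graph_at \<omega> m0" if e: "e \<in> Q J" and c: "c \<in> Fc e" for e c
      proof -
        obtain w x where "w \<in> I" "x \<in> W - J w" "e = {w, x}" using e by (auto simp: Q_def ed_def)
        then show ?thesis using c Fc_ed[of w x] by (auto simp: J_def)
      qed
      ultimately show ?thesis using wA by (auto simp: E_def B_def)
    qed
    ultimately show "\<omega> \<in> (\<Union>J\<in>PiE I (\<lambda>_. S). E J)" by blast
  qed
  have EJ: "pr (E J) \<le> p ^ card A * (\<Prod>w\<in>I. p ^ card (J w) * miss (card (C w)) ^ (n - card X - d))"
    if J: "J \<in> PiE I (\<lambda>_. S)" for J
  proof -
    have JW: "J w \<subseteq> W" "card (J w) < d" if "w \<in> I" for w using J that by (auto simp: S_def)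
    have finJ: "finite (J w)" if "w \<in> I" for w using JW[OF that] fin finite_subset by auto
    have s1: "(SIGMA w:I. J w) \<subseteq> I \<times> W" "(SIGMA w:I. W - J w) \<subseteq> I \<times> W" using JW by auto
    have ed_all: "ed ` (I \<times> W) \<subseteq> all_edges n"
      using I X by (auto simp: ed_def W_def intro!: edge_in_all_edges)
    have AW: "A \<inter> ed ` (I \<times> W) = {}" using A(2) by (fastforce simp: ed_def W_def)
    have disj: "ed ` (SIGMA w:I. J w) \<inter> ed ` (SIGMA w:I. W - J w) = {}"
      using inj_on_image_Int[OF inj s1] by auto
    have Bsub: "B J \<subseteq> all_edges n" unfolding B_def using A(1) ed_all s1(1) by blast
    have Qsub: "Q J \<subseteq> all_edges n" unfolding Q_def using ed_all s1(2) by blast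
    have BQ: "B J \<inter> Q J = {}" unfolding B_def Q_def using disj AW s1 by blast
    have cQ: "card (Q J) = (\<Sum>w\<in>I. card (W - J w))"
      unfolding Q_def using card_image[OF inj_on_subset[OF inj s1(2)]] fin by simp
    have "card (Q J) \<le> (\<Sum>w\<in>I. n)"
      unfolding cQ using fin cW by (intro sum_mono) (metis Diff_subset card_mono diff_le_self le_trans)
    then have cQ2: "2 * card (Q J) \<le> n choose 2" using small by simp
    have FcS: "Fc e \<subseteq> {1..r}" for e using C by (auto simp: Fc_def)
    have cB: "card (B J) = card A + (\<Sum>w\<in>I. card (J w))"
    proof -
      have "card (B J) = card A + card (ed ` (SIGMA w:I. J w))"
        unfolding B_def using finA fin AW s1 finJ by (intro card_Un_disjoint) auto
      also have "card (ed ` (SIGMA w:I. J w)) = (\<Sum>w\<in>I. card (J w))"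
        using card_image[OF inj_on_subset[OF inj s1(1)]] fin finJ by simp
      finally show ?thesis .
    qed
    have "pr (E J) \<le> p ^ card (B J) * (\<Prod>e\<in>Q J. miss (card (Fc e)))"
      using prob_present_absent_le[OF r Bsub Qsub BQ FcS m01 m1_le cQ2 N2]
      unfolding E_def p_def miss_def q_def by simp
    also have "(\<Prod>e\<in>Q J. miss (card (Fc e))) = (\<Prod>(w, x)\<in>(SIGMA w:I. W - J w). miss (card (Fc {w, x})))"
      unfolding Q_def using prod.reindex[OF inj_on_subset[OF inj s1(2)]]
      by (simp add: ed_def case_prod_unfold)
    also have "\<dots> = (\<Prod>w\<in>I. \<Prod>x\<in>W - J w. miss (card (Fc {w, x})))"
      using fin by (subst prod.Sigma) auto
    also have "\<dots> = (\<Prod>w\<in>I. miss (card (C w)) ^ card (W - J w))"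
      using Fc_ed by (intro prod.cong refl) simp
    also have "p ^ card (B J) * (\<Prod>w\<in>I. miss (card (C w)) ^ card (W - J w)) =
       p ^ card A * (\<Prod>w\<in>I. p ^ card (J w) * miss (card (C w)) ^ card (W - J w))"
      by (simp add: cB power_add power_sum prod.distrib)
    also have "\<dots> \<le> p ^ card A * (\<Prod>w\<in>I. p ^ card (J w) * miss (card (C w)) ^ (n - card X - d))"
    proof (intro mult_left_mono prod_mono conjI)
      fix w assume w: "w \<in> I"
      have cC: "card (C w) \<le> r" using card_mono[OF _ C[OF w]] by simp
      have "card (W - J w) = n - card X - card (J w)"
        using JW(1)[OF w] finJ[OF w] cW by (simp add: card_Diff_subset)
      then have "n - card X - d \<le> card (W - J w)" using JW(2)[OF w] by simp
      then show "miss (card (C w)) ^ card (W - J w) \<le> miss (card (C w)) ^ (n - card X - d)"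
        using miss_01[OF cC] by (intro power_decreasing) auto
      show "0 \<le> p ^ card (J w) * miss (card (C w)) ^ card (W - J w)"
        using miss_01[OF cC] p_nonneg by simp
    qed (use p_nonneg in auto)
    finally show ?thesis .
  qed
  have "pr {\<omega>. A \<subseteq> fst ` graph_at \<omega> m1 \<and>
       (\<forall>w\<in>I. card {x \<in> {1..n} - X. \<exists>c\<in>C w. ({w, x}, c) \<in> graph_at \<omega> m0} < d)} \<le> pr (\<Union>J\<in>PiE I (\<lambda>_. S). E J)"
    using sub by (intro measure_pmf.finite_measure_mono) auto
  also have "\<dots> \<le> (\<Sum>J\<in>PiE I (\<lambda>_. S). pr (E J))"
    using fin by (intro measure_pmf.finite_measure_subadditive_finite finite_PiE) auto
  also have "\<dots> \<le> (\<Sum>J\<in>PiE I (\<lambda>_. S). p ^ card A * (\<Prod>w\<in>I. p ^ card (J w) * miss (card (C w)) ^ (n - card X - d)))"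
    using EJ by (rule sum_mono)
  also have "\<dots> = p ^ card A * (\<Prod>w\<in>I. \<Sum>J\<in>S. p ^ card J * miss (card (C w)) ^ (n - card X - d))"
    using fin by (simp add: prod_sum_PiE sum_distrib_left)
  also have "\<dots> \<le> p ^ card A * (\<Prod>w\<in>I. d * (n * p) ^ d * miss (card (C w)) ^ (n - card X - d))"
  proof (intro mult_left_mono prod_mono conjI)
    fix w assume w: "w \<in> I"
    have cC: "card (C w) \<le> r" using card_mono[OF _ C[OF w]] by simp
    show "0 \<le> (\<Sum>J\<in>S. p ^ card J * miss (card (C w)) ^ (n - card X - d))"
      using miss_01[OF cC] p_nonneg by (simp add: sum_nonneg)
    have "(\<Sum>J\<in>S. p ^ card J) \<le> d * (n * p) ^ d"
      unfolding S_def using fin cW p_nonneg np by (intro sum_small_subsets_le) auto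
    then show "(\<Sum>J\<in>S. p ^ card J * miss (card (C w)) ^ (n - card X - d))
        \<le> d * (n * p) ^ d * miss (card (C w)) ^ (n - card X - d)"
      using miss_01[OF cC] unfolding sum_distrib_right[symmetric] by (intro mult_right_mono) auto
  qed (use p_nonneg in auto)
  finally show ?thesis .
qed

lemma prob_no_colored_edge_between_le:
  assumes "A \<subseteq> {1..n}" "B \<subseteq> {1..n}" "A \<inter> B = {}" "2 * (card A * card B) \<le> n choose 2" "c \<in> {1..r}"
  shows "pr {\<omega>. \<forall>a\<in>A. \<forall>b\<in>B. ({a, b}, c) \<notin> graph_at \<omega> m0} \<le> miss 1 ^ (card A * card B)"
proof -
  define Q where "Q = (\<lambda>(w, x). {w, x}) ` (A \<times> B)"
  have cQ: "card Q = card A * card B"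
    unfolding Q_def using card_image[OF doubleton_inj_on[OF assms(3)]] by (simp add: card_cartesian_product)
  have Qsub: "Q \<subseteq> all_edges n" unfolding Q_def using assms by (auto intro!: edge_in_all_edges)
  have "pr {\<omega>. {} \<subseteq> fst ` graph_at \<omega> m1 \<and> (\<forall>e\<in>Q. \<forall>c\<in>{c}. (e, c) \<notin> graph_at \<omega> m0)}
     \<le> (4 * m1 / (n choose 2)) ^ card ({} :: edge set) *
       (\<Prod>e\<in>Q. 1 - card {c} / r * (1 - (1 - 1 / (n choose 2)) ^ m0))"
    using assms cQ prob_present_absent_le[OF r _ Qsub _ _ m01 m1_le _ N2, of "{}" "\<lambda>_. {c}"] by simp
  also have "\<dots> = miss 1 ^ (card A * card B)" by (simp add: cQ miss_def q_def)
  finally show ?thesis by (simp add: Q_def)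
qed

lemma prob_present_le:
  assumes "Y \<subseteq> all_edges n"
  shows "pr {\<omega>. Y \<subseteq> fst ` graph_at \<omega> m1} \<le> p ^ card Y"
  using prob_present_absent_le[OF r assms, of "{}" "\<lambda>_. {}", OF _ _ _ m01 m1_le _ N2]
  by (simp add: p_def)

end

section \<open>Growing colored paths\<close>

definition nbrs :: "nat \<Rightarrow> colored_graph \<Rightarrow> nat set \<Rightarrow> nat \<Rightarrow> nat set" where
  "nbrs n H C v = {x \<in> {1..n}. \<exists>c\<in>C. ({v, x}, c) \<in> H}"

definition good :: "nat \<Rightarrow> nat \<Rightarrow> nat \<Rightarrow> colored_graph \<Rightarrow> nat \<Rightarrow> bool" where
  "good n r d H v \<longleftrightarrow> v \<in> {1..n} \<and> (\<forall>c\<in>{1..r}. d \<le> card (nbrs n H {c} v))"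

definition low :: "nat \<Rightarrow> nat \<Rightarrow> nat \<Rightarrow> colored_graph \<Rightarrow> nat \<Rightarrow> bool" where
  "low n r d H v \<longleftrightarrow> card (nbrs n H {1..r} v) < d"

lemma finite_nbrs [simp]: "finite (nbrs n H C v)"
  by (simp add: nbrs_def)

text \<open>The set \<open>S\<close> is the last layer of a tree with root \<open>u\<close> and
  depth \<open>k\<close>, and \<open>X\<close> contains all vertices of the tree. Of the tree itself
  only the paths from the root are recorded; disjointness of two sets \<open>X\<close> makes the
  paths of two trees disjoint.\<close>

definition reaches ::
    "nat \<Rightarrow> colored_graph \<Rightarrow> nat \<Rightarrow> (nat \<Rightarrow> nat) \<Rightarrow> nat \<Rightarrow> nat set \<Rightarrow> nat set \<Rightarrow> bool" where
  "reaches n G u col k S X \<longleftrightarrow> S \<subseteq> X \<and> X \<subseteq> {1..n} \<and>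
     (\<forall>s\<in>S. \<exists>p. length p = Suc k \<and> hd p = u \<and> last p = s \<and> distinct p \<and> set p \<subseteq> X \<and>
        (\<forall>i<k. ({p ! i, p ! Suc i}, col i) \<in> G))"

lemma reaches_extend:
  assumes "reaches n G u col k S X" "S' \<subseteq> {1..n} - X"
    and "\<And>x. x \<in> S' \<Longrightarrow> \<exists>s\<in>S. ({s, x}, col k) \<in> G"
  shows "reaches n G u col (Suc k) S' (X \<union> S')"
  unfolding reaches_def
proof (intro conjI ballI)
  fix x assume x: "x \<in> S'"
  then obtain s where s: "s \<in> S" "({s, x}, col k) \<in> G" using assms(3) by blast
  then obtain p where p: "length p = Suc k" "hd p = u" "last p = s" "distinct p" "set p \<subseteq> X"
    "\<forall>i<k. ({p ! i, p ! Suc i}, col i) \<in> G" using assms(1) by (auto simp: reaches_def)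
  have pk: "p ! k = s" using p(1,3) by (cases p rule: rev_cases) auto
  show "\<exists>p. length p = Suc (Suc k) \<and> hd p = u \<and> last p = x \<and> distinct p \<and> set p \<subseteq> X \<union> S' \<and>
        (\<forall>i<Suc k. ({p ! i, p ! Suc i}, col i) \<in> G)"
  proof (intro exI[of _ "p @ [x]"] conjI allI impI)
    show "hd (p @ [x]) = u" using p by (cases p) auto
    show "distinct (p @ [x])" using p x assms(2) by auto
    show "set (p @ [x]) \<subseteq> X \<union> S'" using p x by auto
    fix i assume "i < Suc k"
    then show "({(p @ [x]) ! i, (p @ [x]) ! Suc i}, col i) \<in> G"
      using p s pk by (cases "i = k") (auto simp: nth_append)
  qed (use p in auto)
qed (use assms in \<open>auto simp: reaches_def\<close>)

text \<open>In the application \<open>G\<close> is the graph at the time when the last isolated vertex disappears, and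
  \<open>H\<close> is the graph at a fixed time shortly before.\<close>

locale robust_graph =
  fixes n r K d T g :: nat and H G :: colored_graph
  assumes H_G: "H \<subseteq> G" and G_edges: "G \<subseteq> all_edges n \<times> {1..r}"
    and few_bad: "\<And>v. v \<in> {1..n} \<Longrightarrow> card {w \<in> nbrs n H {1..r} v. \<not> good n r d H w} < K"
    and low_good: "\<And>v w c. low n r d H v \<Longrightarrow> ({v, w}, c) \<in> G \<Longrightarrow> good n r d H w"
    and low_far: "\<And>u v w c c'. u \<noteq> v \<Longrightarrow> low n r d H u \<Longrightarrow> low n r d H v \<Longrightarrow>
       ({u, w}, c) \<in> G \<Longrightarrow> ({v, w}, c') \<notin> G"
    and no_isolated: "\<And>v. v \<in> {1..n} \<Longrightarrow> \<exists>w c. ({v, w}, c) \<in> G"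
    and sparse: "\<And>Z. Z \<subseteq> {1..n} \<Longrightarrow> Z \<noteq> {} \<Longrightarrow> card Z \<le> T \<Longrightarrow>
       card {e \<in> fst ` H. e \<subseteq> Z} < 2 * card Z"
    and expand: "\<And>c A C. c \<in> {1..r} \<Longrightarrow> A \<subseteq> C \<Longrightarrow> C \<subseteq> {1..n} \<Longrightarrow> card C = 8 * card A \<Longrightarrow>
       T < 8 * card A \<Longrightarrow> 16 * card A \<le> n \<Longrightarrow> \<exists>a\<in>A. \<exists>b\<in>{1..n} - C. ({a, b}, c) \<in> H"
    and mixing: "\<And>c A B. c \<in> {1..r} \<Longrightarrow> A \<subseteq> {1..n} \<Longrightarrow> B \<subseteq> {1..n} \<Longrightarrow> A \<inter> B = {} \<Longrightarrow>
       card A = g \<Longrightarrow> card B = g \<Longrightarrow> \<exists>a\<in>A. \<exists>b\<in>B. ({a, b}, c) \<in> H"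
    and dK: "K + 32 \<le> d" and g_pos: "g \<ge> 1"
begin

section \<open>Doubling the layers of two disjoint trees\<close>

lemma G_edge: "({v, w}, c) \<in> G \<Longrightarrow> v \<in> {1..n} \<and> w \<in> {1..n} \<and> v \<noteq> w \<and> c \<in> {1..r}"
  using G_edges by (fastforce simp: all_edges_def)

text \<open>If the set \<open>N'\<close> of admissible new vertices had fewer than
  \<open>2 * a\<close> members, \<open>Z\<close> would have fewer than \<open>6 * a + 2 * a\<close>.
  For small layers all good neighbors of \<open>S\<close> in color \<open>c\<close> lie in
  \<open>Z\<close>, which puts too many edges inside \<open>Z\<close> for sparsity. For large layers
  \<open>Z\<close> is enlarged to exactly \<open>8 * a\<close> vertices, and an edge from
  \<open>S\<close> that leaves the enlarged set ends in \<open>N'\<close> after all.\<close>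

lemma grow_step:
  assumes S: "S \<subseteq> W" "S \<noteq> {}" and W: "W \<subseteq> {1..n}" "card W \<le> 6 * card S" and n: "16 * card S \<le> n"
    and gd: "8 * card S \<le> T \<Longrightarrow> \<forall>s\<in>S. good n r d H s" and c: "c \<in> {1..r}"
  shows "\<exists>S'\<subseteq>{1..n} - W. card S' = 2 * card S \<and> (\<forall>x\<in>S'. \<exists>s\<in>S. ({s, x}, c) \<in> H) \<and>
      (8 * card S \<le> T \<longrightarrow> (\<forall>x\<in>S'. good n r d H x))"
proof -
  define a where "a = card S"
  define N' where "N' = {x \<in> {1..n} - W. (\<exists>s\<in>S. ({s, x}, c) \<in> H) \<and> (8 * a \<le> T \<longrightarrow> good n r d H x)}"
  have finW: "finite W" using W(1) finite_subset by auto
  have finS: "finite S" using S(1) finW finite_subset by auto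
  have a: "a \<ge> 1" using S(2) finS by (simp add: a_def Suc_le_eq card_gt_0_iff)
  have finN: "finite N'" by (simp add: N'_def)
  have "2 * a \<le> card N'"
  proof (rule ccontr)
    assume "\<not> 2 * a \<le> card N'"
    then have cZ: "card (W \<union> N') < 8 * a" using W(2) card_Un_le[of W N'] by (simp add: a_def)
    define Z where "Z = W \<union> N'"
    have Z: "Z \<subseteq> {1..n}" using W by (auto simp: Z_def N'_def)
    have SZ: "S \<subseteq> Z" using S by (auto simp: Z_def)
    have finZ: "finite Z" using finW finN by (simp add: Z_def)
    show False
    proof (cases "8 * a \<le> T")
      case True
      define E where "E = {e \<in> fst ` H. e \<subseteq> Z}"
      define nb where "nb s = nbrs n H {c} s \<inter> Z" for s
      have "E \<subseteq> Pow Z" by (auto simp: E_def)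
      then have finE: "finite E" using finZ by (simp add: finite_subset)
      \<comment> \<open>Here lies the origin of \<open>K + 32 \<le> d\<close>: the set
        \<open>E\<close> will have fewer than \<open>2 * card Z\<close> edges and \<open>Z\<close>
        has fewer than \<open>8 * a\<close> vertices, so the degrees in \<open>Z\<close> sum to less
        than \<open>32 * a\<close>, which 33 neighbors for each of \<open>a\<close> vertices
        contradict.\<close>
      have nb_ge: "33 \<le> card (nb s)" if s: "s \<in> S" for s
      proof -
        have gs: "good n r d H s" using gd s True by (simp add: a_def)
        let ?B = "{w \<in> nbrs n H {1..r} s. \<not> good n r d H w}"
        have "card ?B < K" using few_bad[of s] s S W by blast
        moreover have "d \<le> card (nbrs n H {c} s)" using gs c by (simp add: good_def)
        moreover have "nbrs n H {c} s \<subseteq> nb s \<union> ?B"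
          using s c True by (auto simp: nb_def nbrs_def Z_def N'_def)
        then have "card (nbrs n H {c} s) \<le> card (nb s \<union> ?B)" by (intro card_mono) (auto simp: nb_def)
        then have "card (nbrs n H {c} s) \<le> card (nb s) + card ?B" using card_Un_le le_trans by blast
        ultimately show ?thesis using dK by simp
      qed
      have fin_nb: "finite (nb s)" for s by (simp add: nb_def)
      have "33 * a \<le> (\<Sum>s\<in>S. card (nb s))"
        using sum_bounded_below[of S 33 "\<lambda>s. card (nb s)"] nb_ge by (simp add: a_def)
      also have "\<dots> = card (SIGMA s:S. nb s)" using finS fin_nb by simp
      \<comment> \<open>A pair is sent to its edge with the end \<open>s\<close> marked, which is
        injective even when both ends lie in \<open>S\<close>.\<close>
      also have "\<dots> \<le> card (SIGMA e:E. e)"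
      proof (rule card_inj_on_le)
        show "inj_on (\<lambda>(s, x). ({s, x}, s)) (SIGMA s:S. nb s)"
          by (auto simp: inj_on_def doubleton_eq_iff)
        show "(\<lambda>(s, x). ({s, x}, s)) ` (SIGMA s:S. nb s) \<subseteq> (SIGMA e:E. e)"
          using SZ by (force simp: E_def nb_def nbrs_def)
        show "finite (SIGMA e:E. e)"
          using finE finZ by (intro finite_SigmaI) (auto simp: E_def intro: finite_subset)
      qed
      also have "\<dots> = (\<Sum>e\<in>E. card e)"
        using finE finZ by (intro card_SigmaI) (auto simp: E_def intro: finite_subset)
      also have "\<dots> = (\<Sum>e\<in>E. 2)"
        using H_G G_edges by (intro sum.cong) (auto simp: E_def all_edges_def)
      also have "\<dots> = 2 * card E" by simp
      also have "card E < 2 * card Z"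
        unfolding E_def using sparse[OF Z] SZ S(2) cZ True by (auto simp: Z_def)
      finally show False using cZ by (simp add: Z_def)
    next
      case False
      have "8 * a \<le> card {1..n}" using n by (simp add: a_def)
      then obtain C where C: "Z \<subseteq> C" "C \<subseteq> {1..n}" "card C = 8 * a"
        using exists_subset_between[of Z "8 * a" "{1..n}"] cZ Z by (auto simp: Z_def)
      then obtain s b where "s \<in> S" "b \<in> {1..n} - C" "({s, b}, c) \<in> H"
        using expand[OF c, of S C] SZ False n unfolding a_def by (metis not_less subset_trans)
      then have "b \<in> N'" using C False by (auto simp: N'_def Z_def)
      then show False using \<open>b \<in> {1..n} - C\<close> C(1) by (auto simp: Z_def)
    qed
  qed
  then obtain S' where "S' \<subseteq> N'" "card S' = 2 * a" using finN obtain_subset_with_card_n by metis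
  then show ?thesis unfolding N'_def a_def by (intro exI[of _ S']) blast
qed

text \<open>The trees grow in alternation, each layer avoiding everything built so far. With trees
  of size at most \<open>2 * a\<close>, the second one must also avoid the new layer of the first,
  \<open>6 * a\<close> vertices in total, which is the bound in \<open>grow_step\<close>. Only the
  edges at \<open>u\<close> and \<open>v\<close> are taken from \<open>G\<close>, as they may have
  arrived late; all others come from \<open>H\<close>.\<close>

lemma grow:
  assumes u: "({u, wu}, \<alpha> 0) \<in> G" "good n r d H wu" and v: "({v, wv}, \<beta> 0) \<in> G" "good n r d H wv"
    and ne: "distinct [u, v, wu, wv]" and col: "\<And>i. \<alpha> i \<in> {1..r}" "\<And>i. \<beta> i \<in> {1..r}"
    and k: "8 * 2 ^ k \<le> n"
  shows "\<exists>S X S' X'. reaches n G u \<alpha> (Suc k) S X \<and> reaches n G v \<beta> (Suc k) S' X' \<and> X \<inter> X' = {} \<and>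
     card S = 2 ^ k \<and> card S' = 2 ^ k \<and> card X \<le> 2 * 2 ^ k \<and> card X' \<le> 2 * 2 ^ k \<and>
     (8 * 2 ^ k \<le> T \<longrightarrow> (\<forall>s\<in>S \<union> S'. good n r d H s))"
  using k
proof (induction k)
  case 0
  have "reaches n G x col (Suc 0) {w} {x, w}" if "({x, w}, col 0) \<in> G" for x w col
    unfolding reaches_def
  proof (intro conjI ballI)
    fix s assume "s \<in> {w}"
    then show "\<exists>p. length p = Suc (Suc 0) \<and> hd p = x \<and> last p = s \<and> distinct p \<and> set p \<subseteq> {x, w} \<and>
        (\<forall>i<Suc 0. ({p ! i, p ! Suc i}, col i) \<in> G)"
      using that G_edge[OF that] by (intro exI[of _ "[x, w]"]) auto
  qed (use G_edge[OF that] in auto)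
  then have "reaches n G u \<alpha> (Suc 0) {wu} {u, wu}" "reaches n G v \<beta> (Suc 0) {wv} {v, wv}"
    using u v by auto
  then show ?case using u v ne
    by - (rule exI[of _ "{wu}"], rule exI[of _ "{u, wu}"], rule exI[of _ "{wv}"], rule exI[of _ "{v, wv}"], auto simp: card_insert_if)
next
  case (Suc k)
  define a where "a = (2::nat) ^ k"
  have a: "a \<ge> 1" by (simp add: a_def)
  obtain S X S' X' where IH: "reaches n G u \<alpha> (Suc k) S X" "reaches n G v \<beta> (Suc k) S' X'" "X \<inter> X' = {}"
     "card S = a" "card S' = a" "card X \<le> 2 * a" "card X' \<le> 2 * a"
     "8 * a \<le> T \<Longrightarrow> \<forall>s\<in>S \<union> S'. good n r d H s"
    using Suc unfolding a_def by auto
  have n: "16 * a \<le> n" using Suc.prems by (simp add: a_def)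
  have sub: "S \<subseteq> X" "S' \<subseteq> X'" "X \<subseteq> {1..n}" "X' \<subseteq> {1..n}" using IH by (auto simp: reaches_def)
  have ne: "S \<noteq> {}" "S' \<noteq> {}" using IH(4,5) a by auto
  obtain S1 where S1: "S1 \<subseteq> {1..n} - (X \<union> X')" "card S1 = 2 * a" "\<forall>x\<in>S1. \<exists>s\<in>S. ({s, x}, \<alpha> (Suc k)) \<in> H"
    "8 * a \<le> T \<longrightarrow> (\<forall>x\<in>S1. good n r d H x)"
  proof -
    have "card (X \<union> X') \<le> 6 * card S" using IH card_Un_le[of X X'] by linarith
    moreover have "8 * card S \<le> T \<Longrightarrow> \<forall>s\<in>S. good n r d H s" using IH(4,8) by auto
    moreover have "S \<subseteq> X \<union> X'" "X \<union> X' \<subseteq> {1..n}" "16 * card S \<le> n" using sub n IH by auto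
    ultimately show ?thesis using grow_step[of S "X \<union> X'"] ne col(1) IH(4) that by metis
  qed
  obtain S2 where S2: "S2 \<subseteq> {1..n} - (X \<union> S1 \<union> X')" "card S2 = 2 * a"
    "\<forall>x\<in>S2. \<exists>s\<in>S'. ({s, x}, \<beta> (Suc k)) \<in> H" "8 * a \<le> T \<longrightarrow> (\<forall>x\<in>S2. good n r d H x)"
  proof -
    have "card (X \<union> S1 \<union> X') \<le> 6 * card S'"
      using IH S1 card_Un_le[of X S1] card_Un_le[of "X \<union> S1" X'] by linarith
    moreover have "8 * card S' \<le> T \<Longrightarrow> \<forall>s\<in>S'. good n r d H s" using IH(5,8) by auto
    moreover have "S' \<subseteq> X \<union> S1 \<union> X'" "X \<union> S1 \<union> X' \<subseteq> {1..n}" "16 * card S' \<le> n" using sub n IH S1 by auto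
    ultimately show ?thesis using grow_step[of S' "X \<union> S1 \<union> X'"] ne col(2) IH(5) that by metis
  qed
  have "reaches n G u \<alpha> (Suc (Suc k)) S1 (X \<union> S1)"
    by (rule reaches_extend[OF IH(1)]) (use S1(1,3) H_G in blast)+
  moreover have "reaches n G v \<beta> (Suc (Suc k)) S2 (X' \<union> S2)"
    by (rule reaches_extend[OF IH(2)]) (use S2(1,3) H_G in blast)+
  moreover have "(X \<union> S1) \<inter> (X' \<union> S2) = {}" using IH(3) S1(1) S2(1) by auto
  moreover have "card (X \<union> S1) \<le> 4 * a" "card (X' \<union> S2) \<le> 4 * a"
    using IH S1 S2 card_Un_le[of X S1] card_Un_le[of X' S2] by linarith+
  ultimately show ?case using S1 S2 unfolding a_def
    by - (rule exI[of _ S1], rule exI[of _ "X \<union> S1"], rule exI[of _ S2], rule exI[of _ "X' \<union> S2"], auto)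
qed

lemma extra_layers:
  assumes "reaches n G u \<alpha> k S X" "X \<inter> Y = {}" "Y \<subseteq> {1..n}" "g \<le> card S"
    and "card X + card Y + (j + 1) * g \<le> n" and col: "\<And>i. \<alpha> i \<in> {1..r}"
  shows "\<exists>S' X'. reaches n G u \<alpha> (k + j) S' X' \<and> X' \<inter> Y = {} \<and> g \<le> card S' \<and> card X' \<le> card X + j * g"
  using assms(5)
proof (induction j)
  case 0
  then show ?case using assms by - (rule exI[of _ S], rule exI[of _ X], auto)
next
  case (Suc j)
  then obtain S' X' where IH: "reaches n G u \<alpha> (k + j) S' X'" "X' \<inter> Y = {}" "g \<le> card S'"
    "card X' \<le> card X + j * g" by auto
  obtain A where A: "A \<subseteq> S'" "card A = g" using IH(3) obtain_subset_with_card_n by metis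
  have sub: "S' \<subseteq> X'" "X' \<subseteq> {1..n}" using IH by (auto simp: reaches_def)
  define N' where "N' = {x \<in> {1..n} - (X' \<union> Y). \<exists>s\<in>A. ({s, x}, \<alpha> (k + j)) \<in> H}"
  define B where "B = {1..n} - (X' \<union> Y) - N'"
  have "card B < g"
  proof (rule ccontr)
    assume "\<not> card B < g"
    then obtain B' where B': "B' \<subseteq> B" "card B' = g" using obtain_subset_with_card_n by (metis not_less)
    have "A \<inter> B' = {}" using A(1) B'(1) sub by (auto simp: B_def)
    then obtain s b where "s \<in> A" "b \<in> B'" "({s, b}, \<alpha> (k + j)) \<in> H"
      using mixing[OF col, of A B' "k + j"] A B' sub unfolding B_def by blast
    then show False using B'(1) by (auto simp: B_def N'_def)
  qed
  moreover have "n \<le> card (X' \<union> Y) + card N' + card B"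
  proof -
    have "card {1..n} \<le> card (X' \<union> Y \<union> N' \<union> B)"
      using finite_subset[OF sub(2)] finite_subset[OF assms(3)] by (intro card_mono) (auto simp: B_def N'_def)
    then show ?thesis using card_Un_le[of "X' \<union> Y \<union> N'" B] card_Un_le[of "X' \<union> Y" N'] by simp
  qed
  moreover have "card (X' \<union> Y) \<le> card X' + card Y" by (rule card_Un_le)
  ultimately have "g \<le> card N'" using IH(4) Suc.prems by (simp add: algebra_simps)
  then obtain S1 where S1: "S1 \<subseteq> N'" "card S1 = g" using obtain_subset_with_card_n by metis
  have "reaches n G u \<alpha> (Suc (k + j)) S1 (X' \<union> S1)"
    by (rule reaches_extend[OF IH(1)]) (use S1 A H_G in \<open>unfold N'_def, blast\<close>)+
  moreover have "(X' \<union> S1) \<inter> Y = {}" using IH(2) S1 by (auto simp: N'_def)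
  moreover have "card (X' \<union> S1) \<le> card X + Suc j * g" using card_Un_le[of X' S1] IH(4) S1(2) by simp
  ultimately show ?case using S1(2) by - (rule exI[of _ S1], rule exI[of _ "X' \<union> S1"], auto)
qed

text \<open>A vertex that is not low has at least \<open>d\<close> neighbors in \<open>H\<close>,
  fewer than \<open>K\<close> of them bad, so it can even avoid one prescribed vertex
  \<open>x\<close>. A low vertex has to take whatever neighbor \<open>G\<close> offers, which is
  good by \<open>low_good\<close>.\<close>

lemma good_nbr:
  assumes "v \<in> {1..n}"
  shows "\<exists>w c. ({v, w}, c) \<in> G \<and> good n r d H w \<and> (low n r d H v \<or> w \<noteq> x)"
proof (cases "low n r d H v")
  case True
  then show ?thesis using no_isolated[OF assms] low_good by blast
next
  case False
  let ?N = "nbrs n H {1..r} v" and ?B = "{w \<in> nbrs n H {1..r} v. \<not> good n r d H w}"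
  have "\<not> ?N \<subseteq> insert x ?B"
  proof
    assume "?N \<subseteq> insert x ?B"
    then have "card ?N \<le> card (insert x ?B)" by (intro card_mono) auto
    also have "\<dots> \<le> Suc (card ?B)" by (simp add: card_insert_if)
    finally show False using few_bad[OF assms] False dK by (simp add: low_def)
  qed
  then obtain w where "w \<in> ?N" "w \<noteq> x" "good n r d H w" by auto
  then show ?thesis using H_G by (auto simp: nbrs_def)
qed

text \<open>The end with a choice picks last. If \<open>u\<close> is low, its neighbor is fixed and
  \<open>v\<close> avoids it, by choice or, when \<open>v\<close> is low as well, by
  \<open>low_far\<close>; otherwise \<open>u\<close> avoids the neighbor of \<open>v\<close>.
  Nonadjacency of \<open>u\<close> and \<open>v\<close> gives the remaining inequalities.\<close>

lemma distinct_good_nbrs: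
  assumes "u \<in> {1..n}" "v \<in> {1..n}" "u \<noteq> v" "\<And>c. ({u, v}, c) \<notin> G"
  shows "\<exists>wu wv c c'. ({u, wu}, c) \<in> G \<and> ({v, wv}, c') \<in> G \<and> good n r d H wu \<and> good n r d H wv \<and>
     distinct [u, v, wu, wv]"
proof -
  have "\<exists>wu wv c c'. ({u, wu}, c) \<in> G \<and> ({v, wv}, c') \<in> G \<and> good n r d H wu \<and> good n r d H wv \<and> wu \<noteq> wv"
  proof (cases "low n r d H u")
    case True
    obtain wu c where wu: "({u, wu}, c) \<in> G" "good n r d H wu" using good_nbr[OF assms(1)] by blast
    obtain wv c' where wv: "({v, wv}, c') \<in> G" "good n r d H wv" "low n r d H v \<or> wv \<noteq> wu"
      using good_nbr[OF assms(2), of wu] by blast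
    have "wv \<noteq> wu" using wu wv low_far[OF assms(3) True] by blast
    then show ?thesis using wu wv by blast
  next
    case False
    obtain wv c' where wv: "({v, wv}, c') \<in> G" "good n r d H wv" using good_nbr[OF assms(2)] by blast
    then show ?thesis using good_nbr[OF assms(1), of wv] False by blast
  qed
  then obtain wu wv c c' where w: "({u, wu}, c) \<in> G" "({v, wv}, c') \<in> G" "good n r d H wu"
    "good n r d H wv" "wu \<noteq> wv" by blast
  moreover have "wu \<noteq> v" using w(1) assms(4) by blast
  moreover have "wv \<noteq> u" using w(2) assms(4)[of c'] by (auto simp: insert_commute)
  ultimately show ?thesis using G_edge[OF w(1)] G_edge[OF w(2)] assms(3)
    by - (rule exI[of _ wu], rule exI[of _ wv], rule exI[of _ c], rule exI[of _ c'], auto)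
qed

text \<open>The path from \<open>v\<close> is traversed backwards, so its edge number
  \<open>i\<close> has position \<open>k + k' - i\<close> in the joined path. Edges are numbered
  from 0, and position \<open>k\<close> is the connecting edge provided by
  \<open>mixing\<close>.\<close>

lemma join_paths:
  assumes "reaches n G u \<alpha> k S X" "reaches n G v \<beta> k' S' X'" "X \<inter> X' = {}" "g \<le> card S" "g \<le> card S'"
    and col: "\<And>i. i < k \<Longrightarrow> \<alpha> i = \<gamma> i" "\<And>i. i < k' \<Longrightarrow> \<beta> i = \<gamma> (k + k' - i)" "\<gamma> k \<in> {1..r}"
  shows "\<exists>p. length p = k + k' + 2 \<and> hd p = u \<and> last p = v \<and> distinct p \<and> set p \<subseteq> {1..n} \<and>
     (\<forall>i<k + k' + 1. ({p ! i, p ! Suc i}, \<gamma> i) \<in> G)"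
proof -
  obtain A where A: "A \<subseteq> S" "card A = g" using assms(4) obtain_subset_with_card_n by metis
  obtain B where B: "B \<subseteq> S'" "card B = g" using assms(5) obtain_subset_with_card_n by metis
  have sub: "S \<subseteq> X" "S' \<subseteq> X'" "X \<subseteq> {1..n}" "X' \<subseteq> {1..n}" using assms(1,2) by (auto simp: reaches_def)
  have "A \<inter> B = {}" using A B sub assms(3) by blast
  moreover have "A \<subseteq> {1..n}" "B \<subseteq> {1..n}" using A B sub by blast+
  ultimately obtain a b where ab: "a \<in> A" "b \<in> B" "({a, b}, \<gamma> k) \<in> H"
    using mixing[OF col(3)] A(2) B(2) by blast
  obtain p where p: "length p = Suc k" "hd p = u" "last p = a" "distinct p" "set p \<subseteq> X"
    "\<forall>i<k. ({p ! i, p ! Suc i}, \<alpha> i) \<in> G" using assms(1) A(1) ab(1) unfolding reaches_def by blast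
  obtain p' where p': "length p' = Suc k'" "hd p' = v" "last p' = b" "distinct p'" "set p' \<subseteq> X'"
    "\<forall>i<k'. ({p' ! i, p' ! Suc i}, \<beta> i) \<in> G" using assms(2) B(1) ab(2) unfolding reaches_def by blast
  have ne: "p \<noteq> []" "p' \<noteq> []" using p(1) p'(1) by auto
  have pk: "p ! k = a" using p(1,3) ne by (simp add: last_conv_nth)
  have pk': "p' ! k' = b" using p'(1,3) ne by (simp add: last_conv_nth)
  show ?thesis
  proof (intro exI[of _ "p @ rev p'"] conjI allI impI)
    show "length (p @ rev p') = k + k' + 2" using p p' by simp
    show "hd (p @ rev p') = u" using p ne by simp
    show "last (p @ rev p') = v" using p' ne by (simp add: last_rev)
    show "distinct (p @ rev p')" using p p' assms(3) by auto
    show "set (p @ rev p') \<subseteq> {1..n}" using p p' sub by auto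
    fix i assume i: "i < k + k' + 1"
    consider "i < k" | "i = k" | "i > k" by linarith
    then show "({(p @ rev p') ! i, (p @ rev p') ! Suc i}, \<gamma> i) \<in> G"
    proof cases
      case 1
      then show ?thesis using p col(1) by (simp add: nth_append)
    next
      case 2
      have "rev p' ! 0 = b" using p' by (simp add: rev_nth pk')
      then show ?thesis using 2 p pk ab(3) H_G by (auto simp: nth_append)
    next
      case 3
      define j where "j = k' - (i - k)"
      have j: "j < k'" "i - Suc k = k' - Suc j" "Suc i - Suc k = k' - j" "i = k + k' - j"
        using 3 i by (auto simp: j_def)
      have "(p @ rev p') ! i = p' ! Suc j"
        using 3 p(1) p'(1) j i by (simp add: nth_append rev_nth)
      moreover have "(p @ rev p') ! Suc i = p' ! j"
        using 3 p(1) p'(1) j i by (simp add: nth_append rev_nth)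
      moreover have "({p' ! j, p' ! Suc j}, \<gamma> i) \<in> G" using p'(6) j col(2)[OF j(1)] by auto
      ultimately show ?thesis by (simp add: insert_commute)
    qed
  qed
qed

text \<open>The colors of the edges at \<open>u\<close> and \<open>v\<close> cannot be chosen, but
  each occurs in the pattern, at positions \<open>b\<close> and \<open>b'\<close>. When the pattern
  is read from \<open>b\<close> on, the last edge must have position \<open>b'\<close> modulo
  \<open>l\<close>. The depth \<open>k\<close> of the doubling phase is dictated by
  \<open>n\<close>, so that only \<open>j\<close> is free. An edge between \<open>u\<close> and
  \<open>v\<close> is itself a suitable path.\<close>

lemma pattern_connected:
  assumes pat: "set pat \<subseteq> {1..r}" "{1..r} \<subseteq> set pat" "pat \<noteq> []" and size: "32 * length pat * g \<le> n"
  shows "pattern_connected pat n G"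
  unfolding pattern_connected_def
proof (intro ballI impI)
  fix u v assume uv: "u \<in> {1..n}" "v \<in> {1..n}" "u \<noteq> v"
  define l where "l = length pat"
  have l: "l \<ge> 1" using pat(3) by (simp add: l_def Suc_le_eq)
  define col where "col i = pat ! (i mod l)" for i
  have col: "col i \<in> {1..r}" for i using pat l by (auto simp: col_def l_def)
  have idx: "\<exists>b<l. pat ! b = c" if "c \<in> {1..r}" for c
    using that pat(2) by (metis in_set_conv_nth l_def subsetD)
  have fromcol: "\<exists>p. is_path n G p \<and> {hd p, last p} = {u, v} \<and> pattern_colored pat G p"
    if p: "length p = Suc m" "hd p = u" "last p = v" "distinct p" "set p \<subseteq> {1..n}"
      "\<And>i. i < m \<Longrightarrow> ({p ! i, p ! Suc i}, col (b + i)) \<in> G" for p m b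
  proof (intro exI[of _ p] conjI)
    have edge: "(path_edge p j, col (b + (j - 1))) \<in> G" if "j \<in> {1..length p - 1}" for j
      using p(6)[of "j - 1"] that p(1) by (auto simp: path_edge_def)
    show "is_path n G p" using p edge unfolding is_path_def by (auto simp: image_iff) (metis fst_conv)
    show "{hd p, last p} = {u, v}" using p by simp
    show "pattern_colored pat G p" unfolding pattern_colored_def
    proof (intro exI[of _ "b mod l"] conjI ballI)
      show "b mod l < length pat" using pat(3) by (simp add: l_def)
      fix j assume j: "j \<in> {1..length p - 1}"
      have "pattern_at pat (j + b mod l) = col (b + (j - 1))"
      proof -
        have "j + b mod l - 1 = b mod l + (j - 1)" using j by auto
        then show ?thesis by (simp add: pattern_at_def col_def l_def mod_add_left_eq)
      qed
      then show "(path_edge p j, pattern_at pat (j + b mod l)) \<in> G" using edge[OF j] by simp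
    qed
  qed
  show "\<exists>p. is_path n G p \<and> {hd p, last p} = {u, v} \<and> pattern_colored pat G p"
  proof (cases "\<exists>c. ({u, v}, c) \<in> G")
    case True
    then obtain c where c: "({u, v}, c) \<in> G" by blast
    then obtain b where b: "b < l" "pat ! b = c" using idx G_edge[OF c] by blast
    show ?thesis by (rule fromcol[of "[u, v]" 1 b]) (use uv c b in \<open>auto simp: col_def\<close>)
  next
    case False
    then obtain wu wv c c' where w: "({u, wu}, c) \<in> G" "({v, wv}, c') \<in> G" "good n r d H wu"
      "good n r d H wv" "distinct [u, v, wu, wv]" using distinct_good_nbrs[OF uv] by blast
    obtain b where b: "b < l" "pat ! b = c" using idx G_edge[OF w(1)] by blast
    obtain b' where b': "b' < l" "pat ! b' = c'" using idx G_edge[OF w(2)] by blast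
    have n8: "8 * 2 ^ 0 \<le> n"
    proof -
      have "1 * 1 \<le> l * g" using l g_pos by (intro mult_le_mono) auto
      moreover have "32 * (l * g) \<le> n" using size by (simp add: l_def)
      ultimately show ?thesis unfolding power_0 by linarith
    qed
    \<comment> \<open>The maximal depth gives \<open>n < 16 * 2 ^ k\<close>, so the last layers
      exceed \<open>n / 16\<close> and therefore \<open>g\<close>, while the two trees together
      occupy at most \<open>n / 2\<close> vertices.\<close>
    define k where "k = (GREATEST k. 8 * 2 ^ k \<le> n)"
    have bound: "k \<le> n" if "8 * 2 ^ k \<le> n" for k :: nat
    proof -
      have "k < 2 ^ k" by (rule less_exp)
      then show ?thesis using that by linarith
    qed
    have k: "8 * 2 ^ k \<le> n" unfolding k_def
      by (rule GreatestI_nat[where P="\<lambda>k. 8 * 2 ^ k \<le> n" and k=0 and b=n, OF n8]) (rule bound)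
    have k': "n < 16 * 2 ^ k"
    proof (rule ccontr)
      assume "\<not> n < 16 * 2 ^ k"
      then have "8 * 2 ^ Suc k \<le> n" by simp
      then have "Suc k \<le> k" unfolding k_def
        by (rule Greatest_le_nat[where P="\<lambda>k. 8 * 2 ^ k \<le> n" and b=n]) (rule bound)
      then show False by simp
    qed
    \<comment> \<open>The joined path will have \<open>2 * k + 3 + j\<close> edges, so its last edge
      has index \<open>2 * k + 2 + j\<close> counted from 0. The added multiple of \<open>l\<close>
      keeps the subtraction of natural numbers from being truncated.\<close>
    define j where "j = (b' + l * (b + 2 * k + 2) - (b + 2 * k + 2)) mod l"
    have jl: "j < l" using l by (simp add: j_def)
    have jb: "(b + 2 * k + 2 + j) mod l = b'"
    proof -
      have "1 * (b + 2 * k + 2) \<le> l * (b + 2 * k + 2)" using l by (intro mult_le_mono) auto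
      then have "b + 2 * k + 2 + (b' + l * (b + 2 * k + 2) - (b + 2 * k + 2)) = b' + l * (b + 2 * k + 2)" by simp
      then have "(b + 2 * k + 2 + j) mod l = (b' + l * (b + 2 * k + 2)) mod l"
        unfolding j_def by (metis mod_add_right_eq)
      also have "\<dots> = b'" using b' by (simp only: mod_mult_self2 mod_less)
      finally show ?thesis .
    qed
    define \<gamma> where "\<gamma> i = col (b + i)" for i
    \<comment> \<open>Colors along the tree of \<open>v\<close>, read against the direction of the
      pattern. Its paths use the indices up to \<open>k\<close>; beyond them any valid color serves
      as a default.\<close>
    define \<beta> where "\<beta> i = (if i < Suc k then \<gamma> ((Suc k + j) + Suc k - i) else 1)" for i
    have r1: "1 \<in> {1..r}" using col[of 0] by simp
    have g0: "\<gamma> 0 = c" using b by (simp add: \<gamma>_def col_def)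
    have b0: "\<beta> 0 = c'"
    proof -
      have "b + (Suc k + j + Suc k - 0) = b + 2 * k + 2 + j" by simp
      then show ?thesis using b' jb by (simp only: \<beta>_def \<gamma>_def col_def zero_less_Suc if_True)
    qed
    have colg: "\<gamma> i \<in> {1..r}" "\<beta> i \<in> {1..r}" for i
      using col r1 unfolding \<beta>_def \<gamma>_def by (cases "i < Suc k", simp_all)
    obtain S X S' X' where R: "reaches n G u \<gamma> (Suc k) S X" "reaches n G v \<beta> (Suc k) S' X'" "X \<inter> X' = {}"
      "card S = 2 ^ k" "card S' = 2 ^ k" "card X \<le> 2 * 2 ^ k" "card X' \<le> 2 * 2 ^ k"
      using grow[where \<alpha>=\<gamma> and \<beta>=\<beta>, OF w(1)[folded g0] w(3) w(2)[folded b0] w(4,5) colg k] by blast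
    have gn: "32 * (l * g) \<le> n" using size by (simp add: l_def)
    have jg: "(j + 1) * g \<le> l * g" using jl by (intro mult_le_mono) auto
    have "1 * g \<le> l * g" using l by (intro mult_le_mono) auto
    then have gk: "g \<le> 2 ^ k" using gn k' by linarith
    have "card X + card X' + (j + 1) * g \<le> n" using R gn jg k by linarith
    then obtain S1 X1 where R1: "reaches n G u \<gamma> (Suc k + j) S1 X1" "X1 \<inter> X' = {}" "g \<le> card S1"
      using extra_layers[OF R(1,3), of j] R gk col by (auto simp: \<gamma>_def reaches_def)
    obtain p where p: "length p = (Suc k + j) + Suc k + 2" "hd p = u" "last p = v" "distinct p" "set p \<subseteq> {1..n}"
      "\<forall>i<(Suc k + j) + Suc k + 1. ({p ! i, p ! Suc i}, \<gamma> i) \<in> G"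
      using join_paths[OF R1(1) R(2) R1(2) R1(3), of \<gamma>] R gk col by (auto simp: \<beta>_def \<gamma>_def)
    show ?thesis by (rule fromcol[of p "(Suc k + j) + Suc k + 1" b]) (use p in \<open>auto simp: \<gamma>_def\<close>)
  qed
qed

end

section \<open>Bad events\<close>

text \<open>The quotient \<open>k ^ k / fact k\<close> is a single term of the exponential series of
  \<open>exp k\<close>.\<close>

lemma binomial_le_exp_pow:
  assumes "k \<ge> 1"
  shows "real (n choose k) \<le> (exp 1 * n / k) ^ k"
proof -
  have "real k ^ k / fact k \<le> exp (real k)"
  proof -
    have "(\<Sum>j\<in>{k}. real k ^ j / fact j) \<le> (\<Sum>j. real k ^ j / fact j)"
      using summable_exp_generic[of "real k"]
      by (intro sum_le_suminf) (auto simp: field_simps)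
    then show ?thesis by (simp add: exp_def field_simps)
  qed
  then have kf: "real k ^ k \<le> exp 1 ^ k * fact k"
    by (simp add: divide_le_eq exp_of_nat_mult[symmetric])
  have "real (n choose k) * fact k \<le> real n ^ k"
    using binomial_fact_pow[of n k] by (metis of_nat_fact of_nat_le_iff of_nat_mult of_nat_power)
  then have "(real (n choose k) * fact k) * real k ^ k \<le> real n ^ k * (exp 1 ^ k * fact k)"
    using kf by (intro mult_mono) auto
  then have "real (n choose k) * real k ^ k \<le> (exp 1 * real n) ^ k"
    by (simp add: power_mult_distrib mult_ac)
  then show ?thesis using assms by (simp add: power_divide field_simps)
qed

lemma sum_powers_le:
  fixes y :: real
  assumes "0 \<le> y" "y \<le> 1 / 2" "finite S" "0 \<notin> S"
  shows "(\<Sum>t\<in>S. y ^ t) \<le> 2 * y"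
proof -
  have "(\<Sum>t\<in>S. y ^ t) \<le> (\<Sum>t\<in>Suc ` {..Max (insert 0 S)}. y ^ t)"
  proof (rule sum_mono2)
    show "S \<subseteq> Suc ` {..Max (insert 0 S)}"
    proof
      fix t assume t: "t \<in> S"
      then have "t = Suc (t - 1)" using assms(4) by (cases t) auto
      moreover have "t - 1 \<le> Max (insert 0 S)" using t assms(3) by (meson Max_ge finite_insert insertI2 diff_le_self le_trans)
      ultimately show "t \<in> Suc ` {..Max (insert 0 S)}" by blast
    qed
  qed (use assms in auto)
  also have "\<dots> = y * (\<Sum>t\<in>{..<Suc (Max (insert 0 S))}. y ^ t)"
    by (simp add: sum.reindex sum_distrib_left lessThan_Suc_atMost)
  also have "\<dots> \<le> y * (\<Sum>t. y ^ t)"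
    using assms by (intro mult_left_mono sum_le_suminf summable_geometric) auto
  also have "\<dots> = y / (1 - y)" using assms by (simp add: suminf_geometric)
  also have "\<dots> \<le> y / (1 / 2)" using assms by (intro divide_left_mono) auto
  finally show ?thesis by simp
qed

lemma (in prob_space) prob_UN_le:
  assumes "finite I" "\<And>i. i \<in> I \<Longrightarrow> E i \<in> events" "\<And>i. i \<in> I \<Longrightarrow> prob (E i) \<le> b"
  shows "prob (\<Union>i\<in>I. E i) \<le> real (card I) * b"
proof -
  have "prob (\<Union>i\<in>I. E i) \<le> (\<Sum>i\<in>I. prob (E i))"
    using assms by (intro finite_measure_subadditive_finite) auto
  also have "\<dots> \<le> real (card I) * b" using assms(3) by (rule sum_bounded_above)
  finally show ?thesis .
qed

lemma two_mult_choose_two: "2 * (n choose 2) = n * (n - 1)"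
proof -
  have "even (n * (n - 1))" by auto
  then show ?thesis by (simp add: choose_two del: even_mult_iff)
qed

lemma real_choose_two: "real (n choose 2) = real n * (real n - 1) / 2"
proof (cases n)
  case (Suc k)
  have "real (2 * (n choose 2)) = real (n * (n - 1))" by (rule arg_cong[OF two_mult_choose_two])
  then show ?thesis using Suc by (simp add: field_simps)
qed simp

lemma n_sq_le_4_choose_2:
  assumes "n \<ge> 2"
  shows "n * n \<le> 4 * (n choose 2)"
proof -
  have "n * n \<le> 2 * (n * (n - 1))" using assms by (cases n) auto
  also have "n * (n - 1) = 2 * (n choose 2)" by (simp only: two_mult_choose_two)
  finally show ?thesis by simp
qed

section \<open>Configurations of vertices with few edges of some color\<close>

context edge_times
begin

lemma pr_UN_le:
  assumes "finite I" "\<And>i. i \<in> I \<Longrightarrow> pr (E i) \<le> b"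
  shows "pr (\<Union>i\<in>I. E i) \<le> real (card I) * b"
  using assms by (intro measure_pmf.prob_UN_le) auto

text \<open>Neighbors in \<open>X\<close> are ignored, which only weakens the condition. With
  \<open>X\<close> the vertex set of a whole configuration, the stars tested at different vertices
  have no edge in common.\<close>

definition few_nbrs :: "nat \<Rightarrow> nat set \<Rightarrow> nat set \<Rightarrow> nat \<Rightarrow> (edge \<times> nat) list \<Rightarrow> bool" where
  "few_nbrs d X C w \<omega> \<longleftrightarrow> card {x \<in> {1..n} - X. \<exists>c\<in>C. ({w, x}, c) \<in> graph_at \<omega> m0} < d"

lemma few_nbrsI:
  assumes "card (nbrs n (graph_at \<omega> m0) C w) < d"
  shows "few_nbrs d X C w \<omega>"
proof -
  have "card {x \<in> {1..n} - X. \<exists>c\<in>C. ({w, x}, c) \<in> graph_at \<omega> m0} \<le> card (nbrs n (graph_at \<omega> m0) C w)"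
    by (intro card_mono) (auto simp: nbrs_def)
  then show ?thesis using assms by (simp add: few_nbrs_def)
qed

text \<open>The factor that one vertex contributes to \<open>prob_low_stars_le\<close>, for
  \<open>s = card X\<close> and \<open>k\<close> tested colors.\<close>

definition star_bound :: "nat \<Rightarrow> nat \<Rightarrow> nat \<Rightarrow> real" where
  "star_bound d s k = d * (n * p) ^ d * miss k ^ (n - s - d)"

lemma star_bound_nonneg: "k \<le> r \<Longrightarrow> star_bound d s k \<ge> 0"
  using miss_01 p_nonneg by (simp add: star_bound_def)

lemma prob_few_nbrs_le:
  assumes "I \<subseteq> X" "X \<subseteq> {1..n}" "A \<subseteq> all_edges n" "\<And>e. e \<in> A \<Longrightarrow> e \<subseteq> X"
    and "\<And>w. w \<in> I \<Longrightarrow> C w \<subseteq> {1..r}" "2 * (card I * n) \<le> n choose 2" "n * p \<ge> 1"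
  shows "pr {\<omega>. A \<subseteq> fst ` graph_at \<omega> m1 \<and> (\<forall>w\<in>I. few_nbrs d X (C w) w \<omega>)}
     \<le> p ^ card A * (\<Prod>w\<in>I. star_bound d (card X) (card (C w)))"
  unfolding few_nbrs_def star_bound_def by (rule prob_low_stars_le[OF assms])

text \<open>The deficient color of each bad neighbor is fixed in advance by \<open>C\<close>; for
  given \<open>v\<close>, \<open>I\<close> and \<open>C\<close> the event has the product form
  required by \<open>prob_few_nbrs_le\<close>.\<close>

definition many_bad :: "nat \<Rightarrow> nat \<Rightarrow> (edge \<times> nat) list set" where
  "many_bad K d = (\<Union>v\<in>{1..n}. \<Union>I\<in>{I. I \<subseteq> {1..n} - {v} \<and> card I = K}. \<Union>C\<in>PiE I (\<lambda>_. {1..r}).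
     {\<omega>. (\<lambda>w. {v, w}) ` I \<subseteq> fst ` graph_at \<omega> m1 \<and> (\<forall>w\<in>I. few_nbrs d (insert v I) {C w} w \<omega>)})"

text \<open>There are at most \<open>n * n ^ K * r ^ K\<close> choices of \<open>v\<close>,
  \<open>I\<close> and \<open>C\<close>. Since \<open>n * p\<close> will be logarithmic, each bad
  neighbor contributes a negative power of \<open>n\<close>, and \<open>K\<close> of them compensate
  for the \<open>n\<close> choices of \<open>v\<close>.\<close>

lemma prob_many_bad_le:
  assumes K: "2 * (K * n) \<le> n choose 2" and np: "n * p \<ge> 1"
  shows "pr (many_bad K d) \<le> n * (r * (n * p) * star_bound d (Suc K) 1) ^ K"
proof -
  let ?b = "p ^ K * star_bound d (Suc K) 1 ^ K"
  have b0: "?b \<ge> 0" using p_nonneg star_bound_nonneg r by simp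
  have 1: "pr {\<omega>. (\<lambda>w. {v, w}) ` I \<subseteq> fst ` graph_at \<omega> m1 \<and> (\<forall>w\<in>I. few_nbrs d (insert v I) {C w} w \<omega>)} \<le> ?b"
    if v: "v \<in> {1..n}" and I: "I \<subseteq> {1..n} - {v}" "card I = K" and C: "C \<in> PiE I (\<lambda>_. {1..r})" for v I C
  proof -
    have finI: "finite I" using I(1) finite_subset by auto
    have inj: "inj_on (\<lambda>w. {v, w}) I" by (auto simp: inj_on_def doubleton_eq_iff)
    have cX: "card (insert v I) = Suc K" using I finI by (subst card_insert_disjoint) auto
    have "pr {\<omega>. (\<lambda>w. {v, w}) ` I \<subseteq> fst ` graph_at \<omega> m1 \<and> (\<forall>w\<in>I. few_nbrs d (insert v I) {C w} w \<omega>)}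
      \<le> p ^ card ((\<lambda>w. {v, w}) ` I) * (\<Prod>w\<in>I. star_bound d (card (insert v I)) (card {C w}))"
      using v I C K np by (intro prob_few_nbrs_le) (auto intro!: edge_in_all_edges)
    also have "\<dots> = ?b" using I(2) by (simp add: card_image[OF inj] cX)
    finally show ?thesis .
  qed
  have 2: "pr (\<Union>C\<in>PiE I (\<lambda>_. {1..r}).
     {\<omega>. (\<lambda>w. {v, w}) ` I \<subseteq> fst ` graph_at \<omega> m1 \<and> (\<forall>w\<in>I. few_nbrs d (insert v I) {C w} w \<omega>)}) \<le> real r ^ K * ?b"
    if v: "v \<in> {1..n}" and I: "I \<subseteq> {1..n} - {v}" "card I = K" for v I
  proof -
    have finI: "finite I" using I(1) finite_subset by auto
    have "card (PiE I (\<lambda>_. {1..r})) = r ^ K" using finI I(2) by (simp add: card_PiE)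
    then show ?thesis
      using pr_UN_le[OF _ 1[OF v I], of "PiE I (\<lambda>_. {1..r})" "\<lambda>C. C"] finI by (simp add: finite_PiE)
  qed
  have 3: "pr (\<Union>I\<in>{I. I \<subseteq> {1..n} - {v} \<and> card I = K}. \<Union>C\<in>PiE I (\<lambda>_. {1..r}).
     {\<omega>. (\<lambda>w. {v, w}) ` I \<subseteq> fst ` graph_at \<omega> m1 \<and> (\<forall>w\<in>I. few_nbrs d (insert v I) {C w} w \<omega>)})
      \<le> real n ^ K * (real r ^ K * ?b)" if v: "v \<in> {1..n}" for v
  proof -
    have fin: "finite {I. I \<subseteq> {1..n} - {v} \<and> card I = K}" by simp
    have "card {I. I \<subseteq> {1..n} - {v} \<and> card I = K} = card ({1..n} - {v}) choose K" by (rule n_subsets) simp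
    also have "\<dots> \<le> n ^ K"
    proof (cases "K \<le> card ({1..n} - {v})")
      case True
      then have "card ({1..n} - {v}) choose K \<le> card ({1..n} - {v}) ^ K" by (rule binomial_le_pow)
      also have "\<dots> \<le> n ^ K" by (rule power_mono) (use v in \<open>auto simp: card_Diff_singleton\<close>)
      finally show ?thesis .
    next
      case False
      then have "card ({1..n} - {v}) choose K = 0" by simp
      then show ?thesis by linarith
    qed
    finally have c: "real (card {I. I \<subseteq> {1..n} - {v} \<and> card I = K}) \<le> real n ^ K"
      by (metis of_nat_le_iff of_nat_power)
    show ?thesis
      by (rule order_trans[OF pr_UN_le[OF fin 2[OF v]] mult_right_mono[OF c]]) (use b0 in auto)
  qed
  have "pr (many_bad K d) \<le> card {1..n} * (real n ^ K * (real r ^ K * ?b))"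
    unfolding many_bad_def using 3 by (intro pr_UN_le) auto
  then show ?thesis by (simp add: power_mult_distrib mult_ac)
qed

lemma edge_ends:
  assumes "fst ` G \<subseteq> all_edges n" "({v, w}, c) \<in> G"
  shows "v \<in> {1..n}" "w \<in> {1..n}" "v \<noteq> w"
proof -
  have "{v, w} \<in> all_edges n" using assms by (metis fst_conv image_eqI subsetD)
  then show "v \<in> {1..n}" "w \<in> {1..n}" "v \<noteq> w" by (auto simp: all_edges_def)
qed

lemma few_bad_if_not_many_bad:
  assumes "\<omega> \<notin> many_bad K d" "v \<in> {1..n}" and H: "fst ` graph_at \<omega> m0 \<subseteq> all_edges n"
  shows "card {w \<in> nbrs n (graph_at \<omega> m0) {1..r} v. \<not> good n r d (graph_at \<omega> m0) w} < K"
proof (rule ccontr)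
  assume "\<not> ?thesis"
  then obtain I where I: "I \<subseteq> {w \<in> nbrs n (graph_at \<omega> m0) {1..r} v. \<not> good n r d (graph_at \<omega> m0) w}" "card I = K"
    by (meson not_less obtain_subset_with_card_n)
  have vI: "v \<notin> I"
  proof
    assume "v \<in> I"
    then obtain c where "({v, v}, c) \<in> graph_at \<omega> m0" using I(1) by (auto simp: nbrs_def)
    then show False using edge_ends(3)[OF H] by blast
  qed
  have IV: "I \<subseteq> {1..n} - {v}" using I(1) vI by (auto simp: nbrs_def)
  have "\<exists>c\<in>{1..r}. card (nbrs n (graph_at \<omega> m0) {c} w) < d" if "w \<in> I" for w
    using I(1) IV that by (fastforce simp: good_def not_le)
  then obtain C where C: "\<And>w. w \<in> I \<Longrightarrow> C w \<in> {1..r} \<and> card (nbrs n (graph_at \<omega> m0) {C w} w) < d" by metis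
  have "restrict C I \<in> PiE I (\<lambda>_. {1..r})" using C by auto
  moreover have "(\<lambda>w. {v, w}) ` I \<subseteq> fst ` graph_at \<omega> m1"
    using I(1) graph_at_mono[OF m01, of \<omega>] by (force simp: nbrs_def)
  moreover have "\<forall>w\<in>I. few_nbrs d (insert v I) {restrict C I w} w \<omega>"
    using C by (auto intro!: few_nbrsI)
  ultimately have "\<omega> \<in> many_bad K d" using assms(2) IV I(2) unfolding many_bad_def by blast
  then show False using assms(1) by blast
qed

text \<open>At \<open>v\<close> all colors are tested together, at \<open>w\<close> only the color
  \<open>c\<close>. The bounds for both ends are needed, as neither of them alone beats the
  \<open>n\<close> choices of a vertex.\<close>

definition low_beside_bad :: "nat \<Rightarrow> (edge \<times> nat) list set" where
  "low_beside_bad d = (\<Union>(v, w, c)\<in>{(v, w, c). v \<in> {1..n} \<and> w \<in> {1..n} \<and> c \<in> {1..r} \<and> v \<noteq> w}.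
     {\<omega>. {{v, w}} \<subseteq> fst ` graph_at \<omega> m1 \<and>
       (\<forall>x\<in>{v, w}. few_nbrs d {v, w} (if x = v then {1..r} else {c}) x \<omega>)})"

lemma prob_low_beside_bad_le:
  assumes n: "2 * (2 * n) \<le> n choose 2" and np: "n * p \<ge> 1"
  shows "pr (low_beside_bad d) \<le> n * r * (n * p) * star_bound d 2 r * star_bound d 2 1"
proof -
  let ?b = "p * (star_bound d 2 r * star_bound d 2 1)"
  let ?I = "{(v, w, c). v \<in> {1..n} \<and> w \<in> {1..n} \<and> c \<in> {1..r} \<and> v \<noteq> w}"
  have sub: "?I \<subseteq> {1..n} \<times> {1..n} \<times> {1..r}" by auto
  have fin: "finite ?I" using finite_subset[OF sub] by simp
  have b0: "?b \<ge> 0" using p_nonneg star_bound_nonneg r by simp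
  have "card ?I \<le> card ({1..n} \<times> {1..n} \<times> {1..r})" using sub by (intro card_mono) auto
  also have "\<dots> = n * n * r" by (simp add: card_cartesian_product)
  finally have c: "real (card ?I) \<le> real (n * n * r)" by (rule of_nat_mono)
  have "pr (low_beside_bad d) \<le> card ?I * ?b"
    unfolding low_beside_bad_def
  proof (rule pr_UN_le[OF fin])
    fix i assume "i \<in> ?I"
    then obtain v w c where i: "i = (v, w, c)" "v \<in> {1..n}" "w \<in> {1..n}" "c \<in> {1..r}" "v \<noteq> w" by auto
    have "pr {\<omega>. {{v, w}} \<subseteq> fst ` graph_at \<omega> m1 \<and>
       (\<forall>x\<in>{v, w}. few_nbrs d {v, w} (if x = v then {1..r} else {c}) x \<omega>)}
      \<le> p ^ card {{v, w}} * (\<Prod>x\<in>{v, w}. star_bound d (card {v, w}) (card (if x = v then {1..r} else {c})))"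
      using i n np by (intro prob_few_nbrs_le) (auto intro!: edge_in_all_edges)
    also have "\<dots> = ?b" using i(5) by (simp add: numeral_2_eq_2)
    finally show "pr (case i of (v, w, c) \<Rightarrow> {\<omega>. {{v, w}} \<subseteq> fst ` graph_at \<omega> m1 \<and>
       (\<forall>x\<in>{v, w}. few_nbrs d {v, w} (if x = v then {1..r} else {c}) x \<omega>)}) \<le> ?b" by (simp add: i(1))
  qed
  also have "\<dots> \<le> real (n * n * r) * ?b" using c b0 by (intro mult_right_mono) auto
  finally show ?thesis by (simp add: mult_ac)
qed

lemma good_if_not_low_beside_bad:
  assumes "\<omega> \<notin> low_beside_bad d" "low n r d (graph_at \<omega> m0) v" "({v, w}, c) \<in> graph_at \<omega> m1"
    and G: "fst ` graph_at \<omega> m1 \<subseteq> all_edges n"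
  shows "good n r d (graph_at \<omega> m0) w"
proof (rule ccontr)
  assume bad: "\<not> good n r d (graph_at \<omega> m0) w"
  have vw: "v \<in> {1..n}" "w \<in> {1..n}" "v \<noteq> w" using edge_ends[OF G assms(3)] .
  obtain c' where c': "c' \<in> {1..r}" "card (nbrs n (graph_at \<omega> m0) {c'} w) < d"
    using bad vw by (fastforce simp: good_def not_le)
  have "few_nbrs d {v, w} {1..r} v \<omega>" "few_nbrs d {v, w} {c'} w \<omega>"
    using assms(2) c' by (auto simp: low_def intro: few_nbrsI)
  then have "\<omega> \<in> low_beside_bad d" unfolding low_beside_bad_def using assms(3) vw c'(1)
    by (intro UN_I[of "(v, w, c')"]) force+
  then show False using assms(1) by blast
qed

definition low_common_nbr :: "nat \<Rightarrow> (edge \<times> nat) list set" where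
  "low_common_nbr d = (\<Union>(u, v, w)\<in>{(u, v, w). u \<in> {1..n} \<and> v \<in> {1..n} \<and> w \<in> {1..n} \<and> distinct [u, v, w]}.
     {\<omega>. {{u, w}, {v, w}} \<subseteq> fst ` graph_at \<omega> m1 \<and> (\<forall>x\<in>{u, v}. few_nbrs d {u, v, w} {1..r} x \<omega>)})"

lemma prob_low_common_nbr_le:
  assumes n: "2 * (2 * n) \<le> n choose 2" and np: "n * p \<ge> 1"
  shows "pr (low_common_nbr d) \<le> n * (n * p * star_bound d 3 r)\<^sup>2"
proof -
  let ?b = "p\<^sup>2 * (star_bound d 3 r)\<^sup>2"
  let ?I = "{(u, v, w). u \<in> {1..n} \<and> v \<in> {1..n} \<and> w \<in> {1..n} \<and> distinct [u, v, w]}"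
  have sub: "?I \<subseteq> {1..n} \<times> {1..n} \<times> {1..n}" by auto
  have fin: "finite ?I" using finite_subset[OF sub] by simp
  have "card ?I \<le> card ({1..n} \<times> {1..n} \<times> {1..n})" using sub by (intro card_mono) auto
  also have "\<dots> = n * n * n" by (simp add: card_cartesian_product)
  finally have c: "real (card ?I) \<le> real (n * n * n)" by (rule of_nat_mono)
  have "pr (low_common_nbr d) \<le> card ?I * ?b"
    unfolding low_common_nbr_def
  proof (rule pr_UN_le[OF fin])
    fix i assume "i \<in> ?I"
    then obtain u v w where i: "i = (u, v, w)" "u \<in> {1..n}" "v \<in> {1..n}" "w \<in> {1..n}" "distinct [u, v, w]" by auto
    have ne: "{u, w} \<noteq> {v, w}" using i by (auto simp: doubleton_eq_iff)
    have "pr {\<omega>. {{u, w}, {v, w}} \<subseteq> fst ` graph_at \<omega> m1 \<and> (\<forall>x\<in>{u, v}. few_nbrs d {u, v, w} {1..r} x \<omega>)}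
      \<le> p ^ card {{u, w}, {v, w}} * (\<Prod>x\<in>{u, v}. star_bound d (card {u, v, w}) (card {1..r}))"
      using i n np by (intro prob_few_nbrs_le) (auto intro!: edge_in_all_edges)
    also have "\<dots> = ?b" using i(5) ne by (simp add: power2_eq_square numeral_3_eq_3)
    finally show "pr (case i of (u, v, w) \<Rightarrow> {\<omega>. {{u, w}, {v, w}} \<subseteq> fst ` graph_at \<omega> m1 \<and>
       (\<forall>x\<in>{u, v}. few_nbrs d {u, v, w} {1..r} x \<omega>)}) \<le> ?b" by (simp add: i(1))
  qed
  also have "\<dots> \<le> real (n * n * n) * ?b" using c by (intro mult_right_mono) auto
  finally show ?thesis by (simp add: power2_eq_square mult_ac)
qed

lemma low_far_if_not_low_common_nbr:
  assumes "\<omega> \<notin> low_common_nbr d" "u \<noteq> v" "low n r d (graph_at \<omega> m0) u" "low n r d (graph_at \<omega> m0) v"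
    and e: "({u, w}, c) \<in> graph_at \<omega> m1" and G: "fst ` graph_at \<omega> m1 \<subseteq> all_edges n"
  shows "({v, w}, c') \<notin> graph_at \<omega> m1"
proof
  assume e': "({v, w}, c') \<in> graph_at \<omega> m1"
  have vw: "v \<in> {1..n}" "w \<in> {1..n}" "v \<noteq> w" "u \<in> {1..n}" "u \<noteq> w"
    using edge_ends[OF G e] edge_ends[OF G e'] by auto
  have "few_nbrs d {u, v, w} {1..r} x \<omega>" if "x \<in> {u, v}" for x
    using assms(3,4) that by (auto simp: low_def intro: few_nbrsI)
  then have "\<omega> \<in> low_common_nbr d" unfolding low_common_nbr_def using e e' vw assms(2)
    by (intro UN_I[of "(u, v, w)"]) force+
  then show False using assms(1) by blast
qed

end

section \<open>Sparsity, expansion and mixing\<close>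

context edge_times
begin

definition dense_spot :: "nat \<Rightarrow> (edge \<times> nat) list set" where
  "dense_spot T = (\<Union>t\<in>{1..T}. \<Union>Z\<in>{Z. Z \<subseteq> {1..n} \<and> card Z = t}.
     \<Union>Y\<in>{Y. Y \<subseteq> {e. e \<subseteq> Z \<and> card e = 2} \<and> card Y = 2 * t}. {\<omega>. Y \<subseteq> fst ` graph_at \<omega> m1})"

text \<open>The union bound over \<open>t\<close> vertices and \<open>2 * t\<close> edges among them
  is at most \<open>((exp 1 ^ 3 / 16) * (n * t * p\<^sup>2)) ^ t\<close>. As
  \<open>exp 1 ^ 3 / 16 \<le> 2\<close>, this is at most the power \<open>t\<close> of
  \<open>2 * n * T * p\<^sup>2\<close>, and the sum over \<open>t\<close> is geometric.\<close>

lemma prob_dense_spot_le: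
  assumes small: "2 * n * T * p\<^sup>2 \<le> 1 / 2"
  shows "pr (dense_spot T) \<le> 4 * n * T * p\<^sup>2"
proof -
  define y where "y = 2 * real n * T * p\<^sup>2"
  have y: "0 \<le> y" "y \<le> 1 / 2" using small by (auto simp: y_def)
  have term_le: "pr (\<Union>Z\<in>{Z. Z \<subseteq> {1..n} \<and> card Z = t}.
     \<Union>Y\<in>{Y. Y \<subseteq> {e. e \<subseteq> Z \<and> card e = 2} \<and> card Y = 2 * t}. {\<omega>. Y \<subseteq> fst ` graph_at \<omega> m1}) \<le> y ^ t"
    if t: "t \<in> {1..T}" for t
  proof -
    let ?M = "t choose 2"
    have one: "pr (\<Union>Y\<in>{Y. Y \<subseteq> {e. e \<subseteq> Z \<and> card e = 2} \<and> card Y = 2 * t}. {\<omega>. Y \<subseteq> fst ` graph_at \<omega> m1})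
        \<le> real (?M choose (2 * t)) * p ^ (2 * t)" if Z: "Z \<in> {Z. Z \<subseteq> {1..n} \<and> card Z = t}" for Z
    proof -
      have finZ: "finite Z" using Z finite_subset by auto
      have finE: "finite {e. e \<subseteq> Z \<and> card e = 2}" using finZ by simp
      have finY: "finite {Y. Y \<subseteq> {e. e \<subseteq> Z \<and> card e = 2} \<and> card Y = 2 * t}" using finE by simp
      have cY: "card {Y. Y \<subseteq> {e. e \<subseteq> Z \<and> card e = 2} \<and> card Y = 2 * t} = ?M choose (2 * t)"
        using n_subsets[OF finE, of "2 * t"] n_subsets[OF finZ, of 2] Z by simp
      have "pr {\<omega>. Y \<subseteq> fst ` graph_at \<omega> m1} \<le> p ^ (2 * t)"
        if "Y \<in> {Y. Y \<subseteq> {e. e \<subseteq> Z \<and> card e = 2} \<and> card Y = 2 * t}" for Y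
        using prob_present_le[of Y] that Z by (auto simp: all_edges_def)
      then show ?thesis using pr_UN_le[OF finY, of "\<lambda>Y. {\<omega>. Y \<subseteq> fst ` graph_at \<omega> m1}"] unfolding cY by blast
    qed
    have finZ: "finite {Z. Z \<subseteq> {1..n} \<and> card Z = t}" by simp
    have cZ: "card {Z. Z \<subseteq> {1..n} \<and> card Z = t} = n choose t" using n_subsets[of "{1..n}" t] by simp
    have t1: "t \<ge> 1" and tT: "real t \<le> T" using t by auto
    have M: "real ?M \<le> real t * real t / 2"
    proof -
      have "2 * ?M \<le> t * (t - 1)" unfolding choose_two by simp
      also have "\<dots> \<le> t * t" by simp
      finally have "2 * ?M \<le> t * t" .
      then have "real (2 * ?M) \<le> real (t * t)" by (rule of_nat_mono)
      then show ?thesis by simp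
    qed
    have e3: "(exp 1 :: real) ^ 3 \<le> 32"
      using power_mono[OF exp_le, of 3] by simp
    have "pr (\<Union>Z\<in>{Z. Z \<subseteq> {1..n} \<and> card Z = t}.
     \<Union>Y\<in>{Y. Y \<subseteq> {e. e \<subseteq> Z \<and> card e = 2} \<and> card Y = 2 * t}. {\<omega>. Y \<subseteq> fst ` graph_at \<omega> m1})
       \<le> real (n choose t) * (real (?M choose (2 * t)) * p ^ (2 * t))"
      using pr_UN_le[OF finZ one] cZ by simp
    also have "\<dots> \<le> (exp 1 * n / t) ^ t * ((exp 1 * ?M / real (2 * t)) ^ (2 * t) * p ^ (2 * t))"
      using t1 p_nonneg binomial_le_exp_pow[of t n] binomial_le_exp_pow[of "2 * t" ?M]
      by (intro mult_mono) auto
    also have "\<dots> \<le> (exp 1 * n / t) ^ t * ((exp 1 * t / 4) ^ (2 * t) * p ^ (2 * t))"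
    proof (intro mult_left_mono mult_right_mono power_mono)
      have "exp 1 * ?M / real (2 * t) \<le> exp 1 * (real t * real t / 2) / real (2 * t)"
        using M by (intro divide_right_mono mult_left_mono) auto
      also have "\<dots> = exp 1 * t / 4" using t1 by (simp add: field_simps)
      finally show "exp 1 * ?M / real (2 * t) \<le> exp 1 * t / 4" .
    qed (use p_nonneg in auto)
    also have "\<dots> = ((exp 1 * n / t) * (exp 1 * t / 4 * p)\<^sup>2) ^ t"
      by (simp only: power_mult_distrib power_mult mult.assoc)
    also have "(exp 1 * n / t) * (exp 1 * t / 4 * p)\<^sup>2 = (exp 1 ^ 3 / 16) * (n * t * p\<^sup>2)"
      using t1 by (simp add: power2_eq_square power3_eq_cube field_simps)
    also have "((exp 1 ^ 3 / 16) * (n * t * p\<^sup>2)) ^ t \<le> y ^ t"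
    proof (rule power_mono)
      have "(exp 1 ^ 3 / 16) * (n * t * p\<^sup>2) \<le> 2 * (n * t * p\<^sup>2)"
        using e3 by (intro mult_right_mono) auto
      also have "\<dots> \<le> 2 * (n * T * p\<^sup>2)" using t by (intro mult_left_mono mult_right_mono of_nat_mono) auto
      finally show "(exp 1 ^ 3 / 16) * (n * t * p\<^sup>2) \<le> y" by (simp add: y_def)
    qed auto
    finally show ?thesis .
  qed
  have "pr (dense_spot T) \<le> (\<Sum>t\<in>{1..T}. y ^ t)"
    unfolding dense_spot_def
    by (rule order_trans[OF measure_pmf.finite_measure_subadditive_finite sum_mono[OF term_le]]) auto
  also have "\<dots> \<le> 2 * y" using y by (intro sum_powers_le) auto
  finally show ?thesis by (simp add: y_def)
qed

lemma sparse_if_not_dense_spot: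
  assumes "\<omega> \<notin> dense_spot T" "Z \<subseteq> {1..n}" "Z \<noteq> {}" "card Z \<le> T"
    and H: "fst ` graph_at \<omega> m0 \<subseteq> all_edges n"
  shows "card {e \<in> fst ` graph_at \<omega> m0. e \<subseteq> Z} < 2 * card Z"
proof (rule ccontr)
  assume "\<not> ?thesis"
  then obtain Y where Y: "Y \<subseteq> {e \<in> fst ` graph_at \<omega> m0. e \<subseteq> Z}" "card Y = 2 * card Z"
    by (meson not_less obtain_subset_with_card_n)
  have "finite Z" using assms(2) finite_subset by auto
  then have "card Z \<in> {1..T}" using assms(3,4) by (simp add: Suc_le_eq card_gt_0_iff)
  moreover have "Y \<subseteq> {e. e \<subseteq> Z \<and> card e = 2}" using Y(1) H by (auto simp: all_edges_def)
  moreover have "Y \<subseteq> fst ` graph_at \<omega> m1" using Y(1) graph_at_mono[OF m01, of \<omega>] by blast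
  ultimately have "\<omega> \<in> dense_spot T" using assms(2) Y(2) unfolding dense_spot_def by blast
  then show False using assms(1) by blast
qed

definition no_edge :: "nat \<Rightarrow> nat set \<Rightarrow> nat set \<Rightarrow> (edge \<times> nat) list set" where
  "no_edge c A B = {\<omega>. \<forall>a\<in>A. \<forall>b\<in>B. ({a, b}, c) \<notin> graph_at \<omega> m0}"

definition trapped :: "nat \<Rightarrow> (edge \<times> nat) list set" where
  "trapped T = (\<Union>c\<in>{1..r}. \<Union>a\<in>{a. T < 8 * a \<and> 16 * a \<le> n}. \<Union>C\<in>{C. C \<subseteq> {1..n} \<and> card C = 8 * a}.
     \<Union>A\<in>{A. A \<subseteq> C \<and> card A = a}. no_edge c A ({1..n} - C))"

text \<open>For given \<open>a\<close> there are at most \<open>(3 * n / T) ^ (8 * a)\<close> sets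
  \<open>C\<close>, because \<open>8 * a\<close> exceeds \<open>T\<close>, and each has at most
  \<open>2 ^ (8 * a)\<close> subsets \<open>A\<close>. At least \<open>a * (n div 2)\<close> edges
  must avoid the color, because \<open>16 * a \<le> n\<close>. All three exponents are multiples of
  \<open>a\<close>, so the sum over \<open>a\<close> is geometric.\<close>

lemma prob_trapped_le:
  assumes T: "T \<ge> 1" and n2: "n \<ge> 2" and small: "(6 * n / T) ^ 8 * miss 1 ^ (n div 2) \<le> 1 / 2"
  shows "pr (trapped T) \<le> r * (2 * ((6 * n / T) ^ 8 * miss 1 ^ (n div 2)))"
proof -
  define y where "y = (6 * n / T) ^ 8 * miss 1 ^ (n div 2)"
  have m01: "0 \<le> miss 1" "miss 1 \<le> 1" using miss_01[of 1] r by auto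
  have y: "0 \<le> y" "y \<le> 1 / 2" using small m01 by (auto simp: y_def)
  have fina: "finite {a. T < 8 * a \<and> 16 * a \<le> n}" by (rule finite_subset[of _ "{..n}"]) auto
  have "pr (\<Union>C\<in>{C. C \<subseteq> {1..n} \<and> card C = 8 * a}. \<Union>A\<in>{A. A \<subseteq> C \<and> card A = a}. no_edge c A ({1..n} - C)) \<le> y ^ a"
    if c: "c \<in> {1..r}" and a: "a \<in> {a. T < 8 * a \<and> 16 * a \<le> n}" for c a
  proof -
    have a1: "a \<ge> 1" using a by (cases a) auto
    let ?b = "miss 1 ^ (a * (n div 2))"
    have one: "pr (\<Union>A\<in>{A. A \<subseteq> C \<and> card A = a}. no_edge c A ({1..n} - C)) \<le> 2 ^ (8 * a) * ?b"
      if C: "C \<in> {C. C \<subseteq> {1..n} \<and> card C = 8 * a}" for C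
    proof -
      have finC: "finite C" using C finite_subset by auto
      have fin: "finite {A. A \<subseteq> C \<and> card A = a}" using finC by simp
      have "card {A. A \<subseteq> C \<and> card A = a} \<le> card (Pow C)" using finC by (intro card_mono) auto
      also have "\<dots> = 2 ^ (8 * a)" using finC C by (simp add: card_Pow)
      finally have cA: "real (card {A. A \<subseteq> C \<and> card A = a}) \<le> real (2 ^ (8 * a))" by (rule of_nat_mono)
      have "pr (no_edge c A ({1..n} - C)) \<le> ?b" if A: "A \<in> {A. A \<subseteq> C \<and> card A = a}" for A
      proof -
        have cB: "card ({1..n} - C) = n - 8 * a" using C finC by (simp add: card_Diff_subset)
        have "2 * (a * (n - 8 * a)) \<le> 2 * (a * n)" by simp
        moreover have "16 * a * n \<le> n * n" using a by (intro mult_le_mono) auto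
        ultimately have "2 * (a * (n - 8 * a)) \<le> n choose 2" using n_sq_le_4_choose_2[OF n2] by linarith
        then have "pr (no_edge c A ({1..n} - C)) \<le> miss 1 ^ (card A * card ({1..n} - C))"
          unfolding no_edge_def using A C c cB by (intro prob_no_colored_edge_between_le) auto
        also have "\<dots> \<le> ?b"
          using A a m01 unfolding cB by (intro power_decreasing mult_le_mono) auto
        finally show ?thesis .
      qed
      then have "pr (\<Union>A\<in>{A. A \<subseteq> C \<and> card A = a}. no_edge c A ({1..n} - C)) \<le>
          real (card {A. A \<subseteq> C \<and> card A = a}) * ?b" by (rule pr_UN_le[OF fin])
      also have "\<dots> \<le> real (2 ^ (8 * a)) * ?b" using cA m01 by (intro mult_right_mono) auto
      finally show ?thesis by simp
    qed
    have finC: "finite {C. C \<subseteq> {1..n} \<and> card C = 8 * a}" by simp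
    have cC: "card {C. C \<subseteq> {1..n} \<and> card C = 8 * a} = n choose (8 * a)" using n_subsets[of "{1..n}" "8 * a"] by simp
    have "pr (\<Union>C\<in>{C. C \<subseteq> {1..n} \<and> card C = 8 * a}. \<Union>A\<in>{A. A \<subseteq> C \<and> card A = a}. no_edge c A ({1..n} - C))
      \<le> real (n choose (8 * a)) * (2 ^ (8 * a) * ?b)"
      using pr_UN_le[OF finC one] cC by simp
    also have "\<dots> \<le> (3 * n / T) ^ (8 * a) * (2 ^ (8 * a) * ?b)"
    proof (rule mult_right_mono)
      have "real (n choose (8 * a)) \<le> (exp 1 * n / real (8 * a)) ^ (8 * a)"
        using a1 by (intro binomial_le_exp_pow) auto
      also have "\<dots> \<le> (3 * n / T) ^ (8 * a)"
      proof (rule power_mono)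
        have "real T \<le> real (8 * a)" using a by (intro of_nat_mono) simp
        moreover have "exp 1 * real n \<le> 3 * real n" by (rule mult_right_mono[OF exp_le]) simp
        ultimately show "exp 1 * n / real (8 * a) \<le> 3 * n / T" using T by (intro frac_le) auto
      qed simp
      finally show "real (n choose (8 * a)) \<le> (3 * n / T) ^ (8 * a)" .
    qed (use m01 in auto)
    also have "\<dots> = ((3 * n / T) ^ 8 * (2 ^ 8 * miss 1 ^ (n div 2))) ^ a"
      unfolding power_mult[of _ 8 a] mult.commute[of a "n div 2"] power_mult[of _ "n div 2" a]
      by (simp only: power_mult_distrib)
    also have "(3 * n / T) ^ 8 * (2 ^ 8 * miss 1 ^ (n div 2)) = y"
      by (simp add: y_def power_divide power_mult_distrib)
    finally show ?thesis .
  qed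
  then have "pr (\<Union>a\<in>{a. T < 8 * a \<and> 16 * a \<le> n}. \<Union>C\<in>{C. C \<subseteq> {1..n} \<and> card C = 8 * a}.
     \<Union>A\<in>{A. A \<subseteq> C \<and> card A = a}. no_edge c A ({1..n} - C)) \<le> 2 * y" if c: "c \<in> {1..r}" for c
    by (intro order_trans[OF measure_pmf.finite_measure_subadditive_finite[OF fina]]
          order_trans[OF sum_mono sum_powers_le[OF y fina]]) (use c in auto)
  then have "pr (trapped T) \<le> real (card {1..r}) * (2 * y)"
    unfolding trapped_def by (intro pr_UN_le) auto
  then show ?thesis by (simp add: y_def)
qed

lemma expand_if_not_trapped:
  assumes "\<omega> \<notin> trapped T" "c \<in> {1..r}" "A \<subseteq> C" "C \<subseteq> {1..n}" "card C = 8 * card A"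
    "T < 8 * card A" "16 * card A \<le> n"
  shows "\<exists>a\<in>A. \<exists>b\<in>{1..n} - C. ({a, b}, c) \<in> graph_at \<omega> m0"
  using assms unfolding trapped_def no_edge_def by auto

definition unmixed :: "nat \<Rightarrow> (edge \<times> nat) list set" where
  "unmixed g = (\<Union>c\<in>{1..r}. \<Union>A\<in>{A. A \<subseteq> {1..n} \<and> card A = g}.
     \<Union>B\<in>{B. B \<subseteq> {1..n} \<and> card B = g \<and> A \<inter> B = {}}. no_edge c A B)"

text \<open>Counting pairs of sets by \<open>4 ^ n\<close> is enough: for \<open>g\<close> linear in
  \<open>n\<close> and \<open>m0\<close> of order \<open>n * ln n\<close>, the factor
  \<open>miss 1 ^ (g * g)\<close> is smaller than any exponential in \<open>n\<close>.\<close>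

lemma prob_unmixed_le:
  assumes g: "2 * (g * g) \<le> n choose 2"
  shows "pr (unmixed g) \<le> r * (4 ^ n * miss 1 ^ (g * g))"
proof -
  let ?b = "miss 1 ^ (g * g)"
  have m01: "0 \<le> miss 1" using miss_01[of 1] r by auto
  have one: "pr (no_edge c A B) \<le> ?b"
    if "c \<in> {1..r}" "A \<in> {A. A \<subseteq> {1..n} \<and> card A = g}" "B \<in> {B. B \<subseteq> {1..n} \<and> card B = g \<and> A \<inter> B = {}}" for c A B
    using prob_no_colored_edge_between_le[of A B c] that g unfolding no_edge_def by auto
  have pow: "finite S \<and> real (card S) \<le> 2 ^ n" if "S \<subseteq> Pow {1..n}" for S
  proof -
    have "card S \<le> card (Pow {1..n})" using that by (intro card_mono) auto
    then have "card S \<le> 2 ^ n" by (simp add: card_Pow)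
    then have "real (card S) \<le> real (2 ^ n)" by (rule of_nat_mono)
    then show ?thesis using that finite_subset by auto
  qed
  have two: "pr (\<Union>B\<in>{B. B \<subseteq> {1..n} \<and> card B = g \<and> A \<inter> B = {}}. no_edge c A B) \<le> 2 ^ n * ?b"
    if "c \<in> {1..r}" "A \<in> {A. A \<subseteq> {1..n} \<and> card A = g}" for c A
  proof -
    have S: "{B. B \<subseteq> {1..n} \<and> card B = g \<and> A \<inter> B = {}} \<subseteq> Pow {1..n}" by auto
    show ?thesis
      by (rule order_trans[OF pr_UN_le[OF conjunct1[OF pow[OF S]] one[OF that]]
            mult_right_mono[OF conjunct2[OF pow[OF S]]]]) (use m01 in auto)
  qed
  have three: "pr (\<Union>A\<in>{A. A \<subseteq> {1..n} \<and> card A = g}.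
     \<Union>B\<in>{B. B \<subseteq> {1..n} \<and> card B = g \<and> A \<inter> B = {}}. no_edge c A B) \<le> 2 ^ n * (2 ^ n * ?b)"
    if "c \<in> {1..r}" for c
  proof -
    have S: "{A. A \<subseteq> {1..n} \<and> card A = g} \<subseteq> Pow {1..n}" by auto
    show ?thesis
      by (rule order_trans[OF pr_UN_le[OF conjunct1[OF pow[OF S]] two[OF that]]
            mult_right_mono[OF conjunct2[OF pow[OF S]]]]) (use m01 in auto)
  qed
  have "pr (unmixed g) \<le> real (card {1..r}) * (2 ^ n * (2 ^ n * ?b))"
    unfolding unmixed_def by (rule pr_UN_le[OF _ three]) auto
  also have "\<dots> = r * (4 ^ n * ?b)" by (simp add: power_mult_distrib[symmetric] mult.assoc[symmetric])
  finally show ?thesis .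
qed

lemma mixing_if_not_unmixed:
  assumes "\<omega> \<notin> unmixed g" "c \<in> {1..r}" "A \<subseteq> {1..n}" "B \<subseteq> {1..n}" "A \<inter> B = {}" "card A = g" "card B = g"
  shows "\<exists>a\<in>A. \<exists>b\<in>B. ({a, b}, c) \<in> graph_at \<omega> m0"
  using assms unfolding unmixed_def no_edge_def by auto

end

section \<open>Isolated vertices\<close>

text \<open>This is Chebyshev's inequality, centered at the lower bound \<open>card S * a\<close> of
  the mean rather than at the mean: when no event occurs, the count deviates from the center by
  exactly \<open>card S * a\<close>. The bound vanishes in the limit if \<open>card S * a\<close>
  tends to infinity and \<open>b / a\<^sup>2\<close> to 1.\<close>

lemma prob_no_event_le:
  fixes M :: "'a pmf" and E :: "'b \<Rightarrow> 'a set" and a b :: real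
  assumes S: "finite S" and a: "a > 0" "card S * a \<ge> 1" and b: "b \<ge> 0"
    and single: "\<And>u. u \<in> S \<Longrightarrow> a \<le> measure_pmf.prob M (E u)"
    and pair: "\<And>u v. u \<in> S \<Longrightarrow> v \<in> S \<Longrightarrow> u \<noteq> v \<Longrightarrow> measure_pmf.prob M (E u \<inter> E v) \<le> b"
  shows "measure_pmf.prob M {x. \<forall>u\<in>S. x \<notin> E u} \<le> 1 / (card S * a) + b / a\<^sup>2 - 1"
proof -
  define s where "s = real (card S)"
  define P where "P = (\<Sum>u\<in>S. measure_pmf.prob M (E u))"
  define Z where "Z = {x. \<forall>u\<in>S. x \<notin> E u}"
  have int [simp]: "integrable (measure_pmf M) (indicator A :: 'a \<Rightarrow> real)" for A
    by (rule measure_pmf.integrable_const_bound[where B=1]) auto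
  have sq: "((\<Sum>u\<in>S. indicator (E u) x) - s * a)\<^sup>2 =
     (\<Sum>u\<in>S. \<Sum>v\<in>S. indicator (E u \<inter> E v) x) - 2 * s * a * (\<Sum>u\<in>S. indicator (E u) x) + (s * a)\<^sup>2" for x
    by (simp add: power2_diff power2_eq_square[of "\<Sum>u\<in>S. _ u"] sum_product indicator_inter_arith algebra_simps)
  have "(s * a)\<^sup>2 * measure_pmf.prob M Z = measure_pmf.expectation M (\<lambda>x. (s * a)\<^sup>2 * indicator Z x)" by simp
  also have "\<dots> \<le> measure_pmf.expectation M (\<lambda>x. ((\<Sum>u\<in>S. indicator (E u) x) - s * a)\<^sup>2)"
  proof (rule integral_mono)
    show "integrable (measure_pmf M) (\<lambda>x. ((\<Sum>u\<in>S. indicator (E u) x) - s * a)\<^sup>2)"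
      unfolding sq using int by (intro Bochner_Integration.integrable_add Bochner_Integration.integrable_diff
        Bochner_Integration.integrable_sum integrable_mult_right) auto
    fix x
    show "(s * a)\<^sup>2 * indicator Z x \<le> ((\<Sum>u\<in>S. indicator (E u) x) - s * a)\<^sup>2"
      by (cases "x \<in> Z") (auto simp: Z_def)
  qed simp
  also have "\<dots> = (\<Sum>u\<in>S. \<Sum>v\<in>S. measure_pmf.prob M (E u \<inter> E v)) - 2 * s * a * P + (s * a)\<^sup>2"
    unfolding sq P_def
    by (simp add: Bochner_Integration.integral_diff Bochner_Integration.integral_sum
      Bochner_Integration.integrable_sum Bochner_Integration.integrable_diff)
  also have "(\<Sum>u\<in>S. \<Sum>v\<in>S. measure_pmf.prob M (E u \<inter> E v)) \<le> (\<Sum>u\<in>S. measure_pmf.prob M (E u) + s * b)"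
  proof (rule sum_mono)
    fix u assume u: "u \<in> S"
    have "(\<Sum>v\<in>S. measure_pmf.prob M (E u \<inter> E v)) = measure_pmf.prob M (E u) + (\<Sum>v\<in>S - {u}. measure_pmf.prob M (E u \<inter> E v))"
      using S u by (subst sum.remove[of S u]) auto
    also have "(\<Sum>v\<in>S - {u}. measure_pmf.prob M (E u \<inter> E v)) \<le> real (card (S - {u})) * b"
      using pair u by (intro sum_bounded_above) auto
    also have "\<dots> \<le> s * b" unfolding s_def using S b by (intro mult_right_mono of_nat_mono card_mono) auto
    finally show "(\<Sum>v\<in>S. measure_pmf.prob M (E u \<inter> E v)) \<le> measure_pmf.prob M (E u) + s * b" by simp
  qed
  also have "\<dots> = P + s * (s * b)" by (simp add: sum.distrib P_def s_def)
  finally have 1: "(s * a)\<^sup>2 * measure_pmf.prob M Z \<le> P * (1 - 2 * (s * a)) + s * (s * b) + (s * a)\<^sup>2"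
    by (simp add: algebra_simps)
  have sa: "s * a \<ge> 1" using a by (simp add: s_def)
  have "s * a \<le> P" unfolding s_def P_def using single by (intro sum_bounded_below)
  \<comment> \<open>The coefficient of \<open>P\<close> is negative since
    \<open>s * a \<ge> 1\<close>, so the unknown sum \<open>P\<close> may be replaced by its lower
    bound.\<close>
  then have "P * (1 - 2 * (s * a)) \<le> (s * a) * (1 - 2 * (s * a))"
    using sa by (intro mult_right_mono_neg) auto
  then have "(s * a)\<^sup>2 * measure_pmf.prob M Z \<le> (s * a) * (1 - 2 * (s * a)) + s * (s * b) + (s * a)\<^sup>2" using 1 by linarith
  then have "measure_pmf.prob M Z \<le> ((s * a) * (1 - 2 * (s * a)) + s * (s * b) + (s * a)\<^sup>2) / (s * a)\<^sup>2"
    using sa by (subst pos_le_divide_eq) (auto simp: mult.commute)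
  also have "\<dots> = 1 / (s * a) + b / a\<^sup>2 - 1"
  proof -
    have "s \<noteq> 0" using sa by auto
    then show ?thesis using a by (simp add: field_simps power2_eq_square)
  qed
  finally show ?thesis by (simp add: Z_def s_def)
qed

section \<open>Avoiding a given set of edges\<close>

definition star :: "nat \<Rightarrow> nat \<Rightarrow> edge set" where
  "star n v = {e \<in> all_edges n. v \<in> e}"

lemma star_eq:
  assumes "v \<in> {1..n}"
  shows "star n v = (\<lambda>x. {v, x}) ` ({1..n} - {v})"
proof (intro equalityI subsetI)
  fix e assume "e \<in> star n v"
  then have e: "e \<subseteq> {1..n}" "card e = 2" "v \<in> e" by (auto simp: star_def all_edges_def)
  then obtain x y where "e = {x, y}" "x \<noteq> y" by (auto simp: card_2_iff)
  then show "e \<in> (\<lambda>x. {v, x}) ` ({1..n} - {v})" using e by auto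
qed (use assms in \<open>auto simp: star_def intro: edge_in_all_edges\<close>)

lemma card_star:
  assumes "v \<in> {1..n}"
  shows "card (star n v) = n - 1"
proof -
  have "inj_on (\<lambda>x. {v, x}) ({1..n} - {v})" by (auto simp: inj_on_def doubleton_eq_iff)
  then show ?thesis using assms by (simp add: star_eq card_image)
qed

lemma card_star_Un:
  assumes "u \<in> {1..n}" "v \<in> {1..n}" "u \<noteq> v"
  shows "card (star n u \<union> star n v) = 2 * n - 3"
proof -
  have fin: "finite (star n x)" for x by (simp add: star_def)
  have "star n u \<inter> star n v = {{u, v}}"
    using assms by (auto simp: star_eq doubleton_eq_iff)
  then have "card (star n u \<union> star n v) + 1 = (n - 1) + (n - 1)"
    using card_Un_Int[OF fin[of u] fin[of v]] assms by (simp add: card_star)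
  then show ?thesis by simp
qed

definition isolated :: "nat \<Rightarrow> nat \<Rightarrow> nat \<Rightarrow> (edge \<times> nat) list set" where
  "isolated n i v = {\<omega>. fst ` graph_at \<omega> i \<inter> star n v = {}}"

lemma prob_avoid_le:
  assumes "r \<ge> 1" "Q \<subseteq> all_edges n" "2 * m \<le> n choose 2" "2 * card Q \<le> n choose 2" "n choose 2 \<ge> 2"
  shows "measure_pmf.prob (full_process n r) {\<omega>. fst ` graph_at \<omega> m \<inter> Q = {}} \<le> (1 - 1 / (n choose 2)) ^ (m * card Q)"
proof -
  have "measure_pmf.prob (full_process n r) {\<omega>. fst ` graph_at \<omega> m \<inter> Q = {}} \<le>
    measure_pmf.prob (full_process n r) {\<omega>. {} \<subseteq> fst ` graph_at \<omega> m \<and> (\<forall>e\<in>Q. \<forall>c\<in>{1..r}. (e, c) \<notin> graph_at \<omega> m)}"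
  proof (rule measure_pmf.finite_measure_mono)
    show "{\<omega>. fst ` graph_at \<omega> m \<inter> Q = {}} \<subseteq>
      {\<omega>. {} \<subseteq> fst ` graph_at \<omega> m \<and> (\<forall>e\<in>Q. \<forall>c\<in>{1..r}. (e, c) \<notin> graph_at \<omega> m)}" by force
  qed simp
  also have "\<dots> \<le> (4 * real m / (n choose 2)) ^ card ({} :: edge set) *
       (\<Prod>e\<in>Q. 1 - card {1..r} / r * (1 - (1 - 1 / (n choose 2)) ^ m))"
    using prob_present_absent_le[OF assms(1) _ assms(2) _ _ _ assms(3-5), of "{}" "\<lambda>_. {1..r}" m] by simp
  also have "\<dots> = (1 - 1 / (n choose 2)) ^ (m * card Q)" using assms(1) by (simp add: power_mult)
  finally show ?thesis .
qed

text \<open>While no edge of \<open>Q\<close> has arrived, the next arrival avoids \<open>Q\<close>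
  with probability \<open>1 - card Q / (N - i)\<close>, which decreases in \<open>i\<close> and
  hence is at least \<open>x\<close>. The potential carries a minus sign so that
  \<open>expectation_process_le\<close> yields a lower bound.\<close>

lemma prob_avoid_ge:
  assumes r: "r \<ge> 1" and Q: "Q \<subseteq> all_edges n" and m: "m + card Q < n choose 2"
  shows "(1 - card Q / (real (n choose 2) - real m)) ^ m \<le> measure_pmf.prob (full_process n r) {\<omega>. fst ` graph_at \<omega> m \<inter> Q = {}}"
proof -
  define N where "N = real (n choose 2)"
  define x where "x = 1 - card Q / (N - m)"
  define V where "V i \<omega> = - (if fst ` set \<omega> \<inter> Q = {} then x ^ (m - i) else 0)" for i and \<omega> :: "(edge \<times> nat) list"
  have mN: "m \<le> n choose 2" and mN': "real m + card Q < N" using m by (auto simp: N_def)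
  have x0: "0 \<le> x" using mN' by (simp add: x_def)
  have finQ: "finite Q" using Q finite_subset[OF _ finite_all_edges] by auto
  have step: "step_mean n r (V (Suc i)) \<omega> \<le> V i \<omega>" if i: "i < m" and w: "\<omega> \<in> set_pmf (process n r i)" for i \<omega>
  proof -
    have sup: "length \<omega> = i" "distinct (map fst \<omega>)" "set \<omega> \<subseteq> all_edges n \<times> {1..r}"
      using process_support[OF r _ w] i mN by auto
    define R where "R = all_edges n - fst ` set \<omega>"
    have finR: "finite R" by (simp add: R_def)
    have cR: "real (card R) = N - i" using card_unused_edges[OF sup] i mN by (simp add: R_def N_def of_nat_diff)
    show ?thesis
    proof (cases "fst ` set \<omega> \<inter> Q = {}")
      case False
      then have "V (Suc i) (\<omega> @ [z]) = 0" for z by (auto simp: V_def)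
      moreover have "V i \<omega> = 0" using False by (simp add: V_def)
      ultimately show ?thesis by (simp add: step_mean_def)
    next
      case True
      then have QR: "Q \<subseteq> R" using Q by (auto simp: R_def)
      have "(\<Sum>e\<in>R. (\<Sum>c\<in>{1..r}. V (Suc i) (\<omega> @ [(e, c)])) / r) = (\<Sum>e\<in>R. if e \<in> Q then 0 else - (x ^ (m - Suc i)))"
        using True r by (intro sum.cong) (auto simp: V_def Int_insert_left)
      also have "\<dots> = - (real (card (R - Q)) * x ^ (m - Suc i))"
        using finR by (simp add: sum.If_cases Diff_eq)
      also have "real (card (R - Q)) = real (card R) - card Q"
        using QR finR finQ card_mono[OF finR QR] by (simp add: card_Diff_subset of_nat_diff)
      finally have "step_mean n r (V (Suc i)) \<omega> = - ((real (card R) - card Q) * x ^ (m - Suc i)) / card R"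
        by (simp only: step_mean_def R_def[symmetric])
      also have "\<dots> = - ((1 - card Q / (N - i)) * x ^ (m - Suc i))"
      proof -
        have "(real (card R) - card Q) / card R = 1 - card Q / (N - i)"
          using cR mN' i by (simp add: diff_divide_distrib)
        then show ?thesis by (metis times_divide_eq_left minus_divide_left)
      qed
      also have "\<dots> \<le> - (x * x ^ (m - Suc i))"
      proof -
        have "card Q / (N - i) \<le> card Q / (N - m)" using mN' i by (intro divide_left_mono) auto
        then have "x * x ^ (m - Suc i) \<le> (1 - card Q / (N - i)) * x ^ (m - Suc i)"
          using x0 by (intro mult_right_mono) (auto simp: x_def)
        then show ?thesis by simp
      qed
      also have "x * x ^ (m - Suc i) = x ^ (m - i)" using i by (simp flip: power_Suc add: Suc_diff_Suc)
      also have "- (x ^ (m - i)) = V i \<omega>" using True by (simp add: V_def)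
      finally show ?thesis .
    qed
  qed
  have "measure_pmf.expectation (process n r m) (V m) \<le> V 0 []"
    using step by (rule expectation_process_le[OF r mN])
  moreover have "V m = (\<lambda>\<omega>. - indicator {\<omega>. fst ` set \<omega> \<inter> Q = {}} \<omega>)"
    by (auto simp: V_def fun_eq_iff)
  ultimately have "x ^ m \<le> measure_pmf.prob (process n r m) {\<omega>. fst ` set \<omega> \<inter> Q = {}}"
    by (simp add: V_def)
  also have "\<dots> = measure_pmf.prob (full_process n r) {\<omega>. fst ` graph_at \<omega> m \<inter> Q = {}}"
    unfolding map_take_process[OF r mN order_refl, symmetric] by (simp add: vimage_def graph_at_def)
  finally show ?thesis by (simp add: x_def N_def)
qed

context edge_times
begin

lemma prob_isolated_late_le:
  assumes "2 * n \<le> n choose 2"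
  shows "pr (\<Union>v\<in>{1..n}. isolated n m1 v) \<le> n * (1 - 1 / (n choose 2)) ^ (m1 * (n - 1))"
proof -
  have "pr (isolated n m1 v) \<le> (1 - 1 / (n choose 2)) ^ (m1 * (n - 1))" if "v \<in> {1..n}" for v
    using prob_avoid_le[OF r _ m1_le _ N2, of "star n v"] assms card_star[OF that]
    by (auto simp: isolated_def star_def)
  then show ?thesis using pr_UN_le[of "{1..n}"] by simp
qed

lemma prob_none_isolated_early_le:
  fixes a b :: real
  assumes n: "4 * n \<le> n choose 2"
    and a: "a = (1 - real (n - 1) / (real (n choose 2) - real m0)) ^ m0" "n * a \<ge> 1"
    and b: "b = q ^ (2 * n - 3)"
  shows "pr {\<omega>. \<forall>v\<in>{1..n}. \<omega> \<notin> isolated n m0 v} \<le> 1 / (n * a) + b / a\<^sup>2 - 1"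
proof -
  have n1: "n \<ge> 1" using N2 by (cases n) (auto simp: numeral_2_eq_2)
  have m0N: "2 * m0 \<le> n choose 2" using m01 m1_le by simp
  have lt: "m0 + (n - 1) < n choose 2" using n n1 m0N by linarith
  have apos: "a > 0" using a(2) n1 by (metis le_less_trans less_le_trans mult_nonneg_nonpos not_le of_nat_0_le_iff zero_less_one)
  have star_sub: "star n v \<subseteq> all_edges n" for v by (auto simp: star_def)
  have "pr {\<omega>. \<forall>v\<in>{1..n}. \<omega> \<notin> isolated n m0 v} \<le> 1 / (card {1..n} * a) + b / a\<^sup>2 - 1"
  proof (rule prob_no_event_le)
    fix v assume v: "v \<in> {1..n}"
    show "a \<le> pr (isolated n m0 v)"
      using prob_avoid_ge[OF r star_sub[of v], of m0] card_star[OF v] lt n1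
      by (simp add: isolated_def a of_nat_diff)
  next
    fix u v assume uv: "u \<in> {1..n}" "v \<in> {1..n}" "u \<noteq> v"
    have "pr (isolated n m0 u \<inter> isolated n m0 v) = pr {\<omega>. fst ` graph_at \<omega> m0 \<inter> (star n u \<union> star n v) = {}}"
      by (rule arg_cong[where f=pr]) (auto simp: isolated_def)
    also have "\<dots> \<le> (1 - 1 / (n choose 2)) ^ (m0 * card (star n u \<union> star n v))"
      using star_sub n card_star_Un[OF uv] by (intro prob_avoid_le[OF r _ m0N _ N2]) auto
    also have "\<dots> = b" by (simp add: card_star_Un[OF uv] b q_def power_mult)
    finally show "pr (isolated n m0 u \<inter> isolated n m0 v) \<le> b" .
  qed (use apos a(2) q_01 b in auto)
  then show ?thesis by simp
qed

end

section \<open>The hitting times outside the bad events\<close>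

lemma min_degree_ge_1_iff:
  assumes "n \<ge> 1" "finite G" "fst ` G \<subseteq> all_edges n"
  shows "min_degree n G \<ge> 1 \<longleftrightarrow> (\<forall>v\<in>{1..n}. \<exists>w c. ({v, w}, c) \<in> G)"
proof -
  have "min_degree n G \<ge> 1 \<longleftrightarrow> (\<forall>v\<in>{1..n}. degree G v \<ge> 1)"
    using assms(1) unfolding min_degree_def by (subst Min_ge_iff) auto
  also have "\<dots> \<longleftrightarrow> (\<forall>v\<in>{1..n}. \<exists>w c. ({v, w}, c) \<in> G)"
  proof (intro ball_cong refl)
    fix v assume v: "v \<in> {1..n}"
    have "degree G v \<ge> 1 \<longleftrightarrow> {e \<in> fst ` G. v \<in> e} \<noteq> {}"
      unfolding degree_def using assms(2) by (simp add: Suc_le_eq card_gt_0_iff)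
    also have "\<dots> \<longleftrightarrow> (\<exists>w c. ({v, w}, c) \<in> G)"
    proof
      assume "{e \<in> fst ` G. v \<in> e} \<noteq> {}"
      then obtain e c where e: "(e, c) \<in> G" "v \<in> e" by auto
      then have "e \<in> star n v" using assms(3) by (force simp: star_def)
      then show "\<exists>w c. ({v, w}, c) \<in> G" using e(1) star_eq[OF v] by auto
    qed force
    finally show "degree G v \<ge> 1 \<longleftrightarrow> (\<exists>w c. ({v, w}, c) \<in> G)" .
  qed
  finally show ?thesis .
qed

text \<open>A path between \<open>v\<close> and another vertex has an edge at \<open>v\<close>, its
  first or its last depending on the direction. Hence \<open>tau_connected\<close> is never smaller
  than \<open>tau_1\<close>.\<close>

lemma pattern_connected_no_isolated:
  assumes "pattern_connected pat n G" "n \<ge> 2" "v \<in> {1..n}"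
  shows "\<exists>w c. ({v, w}, c) \<in> G"
proof -
  obtain u where u: "u \<in> {1..n}" "u \<noteq> v"
    using assms(2) by (metis atLeastAtMost_iff le_refl one_le_numeral order_trans numeral_eq_one_iff semiring_norm(85))
  obtain p where p: "is_path n G p" "{hd p, last p} = {u, v}"
    using assms u unfolding pattern_connected_def by metis
  have ne: "p \<noteq> []" using p(1) by (simp add: is_path_def)
  have "hd p \<noteq> last p" using p(2) u(2) by (metis doubleton_eq_iff)
  then have len: "length p \<ge> 2" using ne by (cases p; cases "tl p") auto
  have edge: "\<exists>c. ({p ! (j - 1), p ! j}, c) \<in> G" if "j \<in> {1..length p - 1}" for j
    using p(1) that by (force simp: is_path_def path_edge_def)
  consider "v = hd p" | "v = last p" using p(2) by (metis doubleton_eq_iff)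
  then show ?thesis
  proof cases
    case 1
    then have "v = p ! 0" using ne by (simp add: hd_conv_nth)
    moreover have "1 \<in> {1..length p - 1}" using len by simp
    ultimately show ?thesis using edge[of 1] by auto
  next
    case 2
    then have "v = p ! (length p - 1)" using ne by (simp add: last_conv_nth)
    moreover have "length p - 1 \<in> {1..length p - 1}" using len by simp
    ultimately show ?thesis using edge[of "length p - 1"] by (metis insert_commute)
  qed
qed

context edge_times
begin

lemma isolated_iff:
  assumes "fst ` graph_at \<omega> i \<subseteq> all_edges n" "v \<in> {1..n}"
  shows "\<omega> \<in> isolated n i v \<longleftrightarrow> \<not> (\<exists>w c. ({v, w}, c) \<in> graph_at \<omega> i)"
proof
  assume iso: "\<omega> \<in> isolated n i v"
  show "\<not> (\<exists>w c. ({v, w}, c) \<in> graph_at \<omega> i)"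
  proof
    assume "\<exists>w c. ({v, w}, c) \<in> graph_at \<omega> i"
    then obtain w c where "({v, w}, c) \<in> graph_at \<omega> i" by blast
    moreover from this have "{v, w} \<in> star n v" using assms(1) by (force simp: star_def)
    ultimately show False using iso by (force simp: isolated_def)
  qed
next
  assume "\<not> (\<exists>w c. ({v, w}, c) \<in> graph_at \<omega> i)"
  then show "\<omega> \<in> isolated n i v" unfolding isolated_def star_eq[OF assms(2)] by force
qed

text \<open>As \<open>S2\<close> is contained in \<open>S1\<close>, it suffices that the least index
  \<open>i\<close> of \<open>S1\<close> lies in \<open>S2\<close>. The assumptions
  \<open>late\<close> and \<open>early\<close> place \<open>i\<close> between \<open>m0\<close> and
  \<open>m1\<close>, and the events in \<open>ev\<close>, being stated at these two times, make the
  graph at time \<open>i\<close> robust relative to the one at time \<open>m0\<close>.\<close>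

lemma tau_eq:
  assumes w: "\<omega> \<in> set_pmf (full_process n r)" and n: "n \<ge> 2" and d: "K + 32 \<le> d"
    and pat: "set pat \<subseteq> {1..r}" "{1..r} \<subseteq> set pat" "pat \<noteq> []" and g: "g \<ge> 1" "32 * length pat * g \<le> n"
    and ev: "\<omega> \<notin> many_bad K d" "\<omega> \<notin> low_beside_bad d" "\<omega> \<notin> low_common_nbr d" "\<omega> \<notin> dense_spot T"
      "\<omega> \<notin> trapped T" "\<omega> \<notin> unmixed g"
    and late: "\<omega> \<notin> (\<Union>v\<in>{1..n}. isolated n m1 v)" and early: "\<omega> \<notin> {\<omega>. \<forall>v\<in>{1..n}. \<omega> \<notin> isolated n m0 v}"
  shows "tau_connected pat n \<omega> = tau_1 n \<omega>"
proof -
  have "set \<omega> \<subseteq> all_edges n \<times> {1..r}" using process_support[OF r order_refl w] by auto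
  then have G: "graph_at \<omega> i \<subseteq> all_edges n \<times> {1..r}" for i
    by (metis graph_at_def order_trans set_take_subset)
  have Gf: "fst ` graph_at \<omega> i \<subseteq> all_edges n" for i using G[of i] by auto
  have fin: "finite (graph_at \<omega> i)" for i by (simp add: graph_at_def)
  define S1 where "S1 = {i. i \<le> n choose 2 \<and> min_degree n (graph_at \<omega> i) \<ge> 1}"
  define S2 where "S2 = {i. i \<le> n choose 2 \<and> pattern_connected pat n (graph_at \<omega> i)}"
  have S1: "i \<in> S1 \<longleftrightarrow> i \<le> n choose 2 \<and> (\<forall>v\<in>{1..n}. \<exists>w c. ({v, w}, c) \<in> graph_at \<omega> i)" for i
    unfolding S1_def using min_degree_ge_1_iff[OF _ fin Gf] n by simp
  have sub: "S2 \<subseteq> S1" using pattern_connected_no_isolated n by (auto simp: S1 S2_def)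
  have m1S: "m1 \<in> S1" using late isolated_iff[OF Gf] m1_le unfolding S1 by auto
  define i where "i = (LEAST i. i \<in> S1)"
  have iS: "i \<in> S1" unfolding i_def using m1S by (rule LeastI)
  have i_le: "i \<le> j" if "j \<in> S1" for j unfolding i_def using that by (rule Least_le)
  have im1: "i \<le> m1" using i_le m1S by blast
  have im0: "m0 \<le> i"
  proof (rule ccontr)
    assume "\<not> m0 \<le> i"
    then have "graph_at \<omega> i \<subseteq> graph_at \<omega> m0" by (intro graph_at_mono) simp
    then have "\<forall>v\<in>{1..n}. \<exists>w c. ({v, w}, c) \<in> graph_at \<omega> m0" using iS unfolding S1 by blast
    then show False using early isolated_iff[OF Gf] by blast
  qed
  have Gm1: "graph_at \<omega> i \<subseteq> graph_at \<omega> m1" using graph_at_mono[OF im1] .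
  have "robust_graph n r K d T g (graph_at \<omega> m0) (graph_at \<omega> i)"
  proof
    show "graph_at \<omega> m0 \<subseteq> graph_at \<omega> i" using graph_at_mono[OF im0] .
    show "graph_at \<omega> i \<subseteq> all_edges n \<times> {1..r}" by (rule G)
    show "card {w \<in> nbrs n (graph_at \<omega> m0) {1..r} v. \<not> good n r d (graph_at \<omega> m0) w} < K" if "v \<in> {1..n}" for v
      using few_bad_if_not_many_bad[OF ev(1) that Gf] .
    show "good n r d (graph_at \<omega> m0) w" if "low n r d (graph_at \<omega> m0) v" "({v, w}, c) \<in> graph_at \<omega> i" for v w c
      using good_if_not_low_beside_bad[OF ev(2) that(1) _ Gf] that(2) Gm1 by blast
    show "({v, w}, c') \<notin> graph_at \<omega> i" if "u \<noteq> v" "low n r d (graph_at \<omega> m0) u"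
      "low n r d (graph_at \<omega> m0) v" "({u, w}, c) \<in> graph_at \<omega> i" for u v w c c'
      using low_far_if_not_low_common_nbr[OF ev(3) that(1-3) _ Gf] that(4) Gm1 by blast
    show "\<exists>w c. ({v, w}, c) \<in> graph_at \<omega> i" if "v \<in> {1..n}" for v using iS that unfolding S1 by blast
    show "card {e \<in> fst ` graph_at \<omega> m0. e \<subseteq> Z} < 2 * card Z"
      if "Z \<subseteq> {1..n}" "Z \<noteq> {}" "card Z \<le> T" for Z
      using sparse_if_not_dense_spot[OF ev(4) that Gf] .
    show "\<exists>a\<in>A. \<exists>b\<in>{1..n} - C. ({a, b}, c) \<in> graph_at \<omega> m0"
      if "c \<in> {1..r}" "A \<subseteq> C" "C \<subseteq> {1..n}" "card C = 8 * card A" "T < 8 * card A" "16 * card A \<le> n" for c A C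
      using expand_if_not_trapped[OF ev(5) that] .
    show "\<exists>a\<in>A. \<exists>b\<in>B. ({a, b}, c) \<in> graph_at \<omega> m0"
      if "c \<in> {1..r}" "A \<subseteq> {1..n}" "B \<subseteq> {1..n}" "A \<inter> B = {}" "card A = g" "card B = g" for c A B
      using mixing_if_not_unmixed[OF ev(6) that] .
  qed (use d g in auto)
  then have "pattern_connected pat n (graph_at \<omega> i)" using robust_graph.pattern_connected pat g(2) by blast
  then have iS2: "i \<in> S2" using iS by (simp add: S1 S2_def)
  have "Inf (enat ` S2) = Inf (enat ` S1)"
  proof (rule antisym)
    show "Inf (enat ` S1) \<le> Inf (enat ` S2)" using sub by (intro Inf_superset_mono image_mono)
    have "Inf (enat ` S2) \<le> enat i" using iS2 by (intro Inf_lower) auto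
    also have "enat i \<le> Inf (enat ` S1)" using i_le by (intro Inf_greatest) auto
    finally show "Inf (enat ` S2) \<le> Inf (enat ` S1)" .
  qed
  then show ?thesis unfolding tau_connected_def tau_1_def hitting_time_def S1_def S2_def .
qed

lemma prob_tau_eq_ge:
  assumes "n \<ge> 2" "K + 32 \<le> d" "set pat \<subseteq> {1..r}" "{1..r} \<subseteq> set pat" "pat \<noteq> []" "g \<ge> 1" "32 * length pat * g \<le> n"
  shows "1 - (pr (many_bad K d) + pr (low_beside_bad d) + pr (low_common_nbr d) + pr (dense_spot T) +
      pr (trapped T) + pr (unmixed g) + pr (\<Union>v\<in>{1..n}. isolated n m1 v) +
      pr {\<omega>. \<forall>v\<in>{1..n}. \<omega> \<notin> isolated n m0 v}) \<le> pr {\<omega>. tau_connected pat n \<omega> = tau_1 n \<omega>}"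
proof -
  define L where "L = [many_bad K d, low_beside_bad d, low_common_nbr d, dense_spot T, trapped T, unmixed g,
     \<Union>v\<in>{1..n}. isolated n m1 v, {\<omega>. \<forall>v\<in>{1..n}. \<omega> \<notin> isolated n m0 v}]"
  have union: "pr (\<Union>(set L)) \<le> sum_list (map pr L)" for L
  proof (induction L)
    case (Cons A L)
    have "pr (A \<union> \<Union>(set L)) \<le> pr A + pr (\<Union>(set L))"
      by (intro measure_Un_le) auto
    then show ?case using Cons by simp
  qed simp
  have "1 = pr UNIV" by simp
  also have "\<dots> \<le> pr ({\<omega>. tau_connected pat n \<omega> = tau_1 n \<omega>} \<union> \<Union>(set L))"
  \<comment> \<open>The covering is available only for outcomes in the support of the process, hence
    almost surely.\<close>
  proof (rule measure_pmf.finite_measure_mono_AE)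
    show "AE \<omega> in measure_pmf (full_process n r). \<omega> \<in> UNIV \<longrightarrow>
        \<omega> \<in> {\<omega>. tau_connected pat n \<omega> = tau_1 n \<omega>} \<union> \<Union>(set L)"
      unfolding AE_measure_pmf_iff
    proof (intro ballI impI)
      fix \<omega> assume "\<omega> \<in> set_pmf (full_process n r)"
      then show "\<omega> \<in> {\<omega>. tau_connected pat n \<omega> = tau_1 n \<omega>} \<union> \<Union>(set L)"
        using tau_eq[OF _ assms, of \<omega> T] unfolding L_def by (simp only: set_simps Union_insert Un_iff mem_Collect_eq) blast
    qed
  qed simp
  also have "\<dots> \<le> pr {\<omega>. tau_connected pat n \<omega> = tau_1 n \<omega>} + pr (\<Union>(set L))"
    by (intro measure_Un_le) auto
  also have "\<dots> \<le> pr {\<omega>. tau_connected pat n \<omega> = tau_1 n \<omega>} + sum_list (map pr L)"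
    using union by simp
  finally show ?thesis by (simp add: L_def)
qed

end

section \<open>The critical window\<close>

lemma one_minus_inverse_power_le:
  assumes "N \<ge> (1::real)"
  shows "(1 - 1 / N) ^ m \<le> exp (- (real m / N))"
proof -
  have "(1 - 1 / N) ^ m \<le> exp (- (1 / N)) ^ m"
    using assms exp_ge_add_one_self[of "- (1 / N)"] by (intro power_mono) auto
  then show ?thesis by (simp add: exp_of_nat_mult[symmetric])
qed

lemma one_minus_exp_ge_half:
  assumes "0 \<le> x" "x \<le> (1::real)"
  shows "x / 2 \<le> 1 - exp (- x)"
proof -
  have "(1 - x / 2) * (1 + x) \<ge> 1" using mult_left_mono[of x 1 x] assms by (simp add: algebra_simps)
  moreover have "1 + x \<le> exp x" by (rule exp_ge_add_one_self)
  ultimately have "1 \<le> (1 - x / 2) * exp x"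
    using assms by (meson diff_ge_0_iff_ge divide_le_eq_1_pos mult_left_mono order_trans zero_less_numeral one_le_numeral)
  then show ?thesis by (simp add: exp_minus field_simps)
qed

text \<open>The asymptotic input is reduced to inequalities for one fixed \<open>n\<close>:
  \<open>large1\<close> gives \<open>n * p \<le> 20 * ln n\<close>, \<open>large2\<close> keeps
  \<open>m0 / (n choose 2)\<close> above \<open>ln n / (2 * n)\<close>, \<open>large3\<close>
  permits discarding \<open>2 * d\<close> vertices from a star at the price of a factor
  \<open>exp 1\<close>, and \<open>large4\<close> keeps the tested edges below half of all
  edges.\<close>

locale critical_window = edge_times +
  fixes d :: nat
  assumes n2: "n \<ge> 2"
    and m0_ge: "(1 - 1 / (8 * r)) * (n * ln n / 2) - 1 \<le> m0"
    and m0_le: "m0 \<le> (1 - 1 / (8 * r)) * (n * ln n / 2)"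
    and m1_ge: "n * ln n \<le> m1" and m1_le': "m1 \<le> n * ln n + 1"
    and ln_ge: "ln n \<ge> 1"
    and large1: "8 * (n * ln n + 1) \<le> 20 * ln n * (real n - 1)"
    and large2: "ln n / (2 * n) \<le> (1 - 1 / (8 * r)) * (ln n / n) - 2 / (real n)\<^sup>2"
    and large3: "2 * d * ln n / n + 2 / n \<le> 1"
    and large4: "2 * (d * n) \<le> n choose 2" and d2: "d \<ge> 3"
begin

definition \<epsilon> :: real where "\<epsilon> = 1 / (8 * r)"

lemma eps: "0 < \<epsilon>" "\<epsilon> \<le> 1 / 8"
  using r by (auto simp: \<epsilon>_def field_simps)

lemma np_ge: "n * p \<ge> 1" and np_le: "n * p \<le> 20 * ln n"
proof -
  have np: "n * p = 8 * m1 / (real n - 1)"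
    using n2 by (simp add: p_def real_choose_two field_simps)
  have "8 * m1 / (real n - 1) \<le> 8 * (n * ln n + 1) / (real n - 1)"
    using n2 m1_le' by (intro divide_right_mono) auto
  also have "\<dots> \<le> 20 * ln n" using large1 n2 by (simp add: pos_divide_le_eq)
  finally show "n * p \<le> 20 * ln n" by (simp add: np)
  have "real n * 1 \<le> real n * ln n" using ln_ge by (intro mult_left_mono) auto
  then have "real n - 1 \<le> 8 * m1" using m1_ge n2 by linarith
  then show "n * p \<ge> 1" using n2 by (simp add: np field_simps)
qed

lemma pos_window: "0 \<le> (1 - \<epsilon>) * (ln n / n) - 2 / (real n)\<^sup>2"
proof -
  have "0 \<le> ln n / (2 * n)" using ln_ge by simp
  then show ?thesis using large2 unfolding \<epsilon>_def by (rule order_trans)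
qed

lemma m0_N_ge: "(1 - \<epsilon>) * (ln n / n) - 2 / (real n)\<^sup>2 \<le> m0 / (n choose 2)"
proof -
  have npos: "real n > 0" using n2 by simp
  have "(1 - \<epsilon>) * (ln n / n) - 2 / (real n)\<^sup>2 = ((1 - \<epsilon>) * (n * ln n / 2) - 1) / ((real n)\<^sup>2 / 2)"
    using npos by (simp add: diff_divide_distrib power2_eq_square)
  also have "\<dots> \<le> m0 / ((real n)\<^sup>2 / 2)" using m0_ge unfolding \<epsilon>_def by (intro divide_right_mono) auto
  also have "\<dots> \<le> m0 / (n choose 2)"
    using n2 unfolding real_choose_two by (intro divide_left_mono) (auto simp: power2_eq_square)
  finally show ?thesis .
qed

lemma q_le: "q \<le> exp (- (m0 / (n choose 2)))"
  unfolding q_def using N2 by (intro one_minus_inverse_power_le) linarith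

text \<open>The up to \<open>2 * d\<close> missing factors belong to the vertices of a configuration
  and to the fewer than \<open>d\<close> actual neighbors. By \<open>large3\<close>, they and the
  rounding of \<open>m0\<close> change the exponent by at most 1, whence the factor
  \<open>exp 1\<close>.\<close>

lemma q_power_le:
  assumes "real n - 2 * d \<le> k"
  shows "q ^ k \<le> exp 1 * n powr - (1 - \<epsilon>)"
proof -
  have npos: "real n > 0" using n2 by simp
  define x where "x = (1 - \<epsilon>) * (ln n / n) - 2 / (real n)\<^sup>2"
  have x0: "0 \<le> x" using pos_window by (simp add: x_def)
  have "q ^ k \<le> exp (- x) ^ k"
    using q_01 q_le m0_N_ge by (intro power_mono) (auto simp: x_def intro: order_trans)
  also have "\<dots> = exp (- (k * x))" by (simp add: exp_of_nat_mult[symmetric])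
  also have "\<dots> \<le> exp (1 - (1 - \<epsilon>) * ln n)"
  proof -
    have "(real n - 2 * d) * x \<le> k * x" using assms x0 by (intro mult_right_mono)
    moreover have "2 * d * x \<le> 2 * d * (ln n / n)"
    proof (intro mult_left_mono)
      have "(1 - \<epsilon>) * (ln n / n) \<le> 1 * (ln n / n)" using eps ln_ge by (intro mult_right_mono) auto
      then show "x \<le> ln n / n" unfolding x_def using npos by (simp add: add_increasing2 diff_le_eq)
    qed auto
    moreover have "real n * x = (1 - \<epsilon>) * ln n - 2 / n"
      using npos by (simp add: x_def field_simps power2_eq_square)
    ultimately have "(1 - \<epsilon>) * ln n - 1 \<le> k * x" using large3 by (simp add: algebra_simps)
    then show ?thesis by simp
  qed
  also have "\<dots> = exp 1 * n powr - (1 - \<epsilon>)" using npos by (simp add: powr_def algebra_simps flip: exp_add)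
  finally show ?thesis .
qed

lemma div_4r_le_1:
  assumes "x \<le> (1::real)"
  shows "x / (4 * r) \<le> 1"
proof -
  have "x \<le> 4 * real r" using assms r by linarith
  then show ?thesis using r by (simp add: divide_le_eq_1_pos)
qed

text \<open>With \<open>y = ln n / (2 * n)\<close> one has \<open>1 - q \<ge> y / 2\<close>, and one
  color has the share \<open>1 / r\<close> of this. The two halvings are generous; they lead to the
  exponent \<open>1 / (4 * r)\<close> instead of nearly \<open>1 / r\<close>.\<close>

lemma miss_1_power_le: "miss 1 ^ k \<le> exp (- (ln n / (4 * r * n) * k))"
proof -
  have npos: "real n > 0" using n2 by simp
  define y where "y = ln n / (2 * n)"
  have "ln n \<le> real n" using ln_le_minus_one[OF npos] by simp
  then have y: "0 \<le> y" "y \<le> 1" using ln_ge npos by (auto simp: y_def field_simps)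
  have "q \<le> exp (- y)" using q_le m0_N_ge large2[folded \<epsilon>_def] by (auto simp: y_def intro: order_trans)
  then have "y / 2 \<le> 1 - q" using one_minus_exp_ge_half[OF y] by linarith
  then have "y / 2 / r \<le> (1 - q) / r" by (intro divide_right_mono) auto
  then have "miss 1 \<le> 1 - y / 2 / r" by (simp add: miss_def)
  also have "\<dots> \<le> exp (- (y / 2 / r))" using exp_ge_add_one_self[of "- (y / 2 / r)"] by simp
  finally have "miss 1 ^ k \<le> exp (- (y / 2 / r)) ^ k" using miss_01(1)[of 1] r by (intro power_mono) auto
  also have "\<dots> = exp (- (y / 2 / r * k))" by (simp add: exp_of_nat_mult[symmetric] mult.commute)
  also have "y / 2 / r = ln n / (4 * r * n)" by (simp add: y_def field_simps)
  finally show ?thesis .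
qed

lemma miss_1_power_le':
  assumes "real n - 2 * d \<le> k"
  shows "miss 1 ^ k \<le> exp 1 * n powr - (1 / (4 * r))"
proof -
  have npos: "real n > 0" using n2 by simp
  have l0: "0 \<le> ln n / (4 * r * n)" using ln_ge by simp
  have "ln n / (4 * r * n) * (real n - 2 * d) \<le> ln n / (4 * r * n) * k"
    using assms l0 by (intro mult_left_mono)
  moreover have "ln n / (4 * r * n) * (real n - 2 * d) = ln n / (4 * r) - (2 * d * ln n / n) / (4 * r)"
    using npos r by (simp add: field_simps)
  moreover have "(2 * d * ln n / n) / (4 * r) \<le> 1"
  proof (rule div_4r_le_1)
    have "0 \<le> 2 / real n" by simp
    then show "2 * d * ln n / n \<le> 1" using large3 by linarith
  qed
  ultimately have "ln n / (4 * r) - 1 \<le> ln n / (4 * r * n) * k" by linarith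
  then have "miss 1 ^ k \<le> exp (1 - ln n / (4 * r))"
    by (intro order_trans[OF miss_1_power_le]) simp
  also have "\<dots> = exp 1 * n powr - (1 / (4 * r))" using npos by (simp add: powr_def flip: exp_add)
  finally show ?thesis .
qed

text \<open>Everything in the estimate of \<open>star_bound\<close> that is not a power of
  \<open>n\<close>; the factor \<open>exp 1\<close> is the one from \<open>q_power_le\<close> and
  \<open>miss_1_power_le'\<close>.\<close>

definition polylog :: real where "polylog = d * (20 * ln n) ^ d * exp 1"

lemma polylog_ge_0: "polylog \<ge> 0" using ln_ge by (simp add: polylog_def)

lemma star_bound_le:
  assumes "s \<le> d"
  shows "star_bound d s 1 \<le> polylog * n powr - (1 / (4 * r))"
    and "star_bound d s r \<le> polylog * n powr - (1 - \<epsilon>)"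
proof -
  have k: "real n - 2 * d \<le> real (n - s - d)" using assms by linarith
  have pow: "d * (n * p) ^ d \<le> d * (20 * ln n) ^ d"
    using np_le p_nonneg by (intro mult_left_mono power_mono) auto
  have "star_bound d s 1 \<le> (d * (20 * ln n) ^ d) * (exp 1 * n powr - (1 / (4 * r)))"
    unfolding star_bound_def
    by (rule mult_mono[OF pow miss_1_power_le'[OF k]]) (use miss_01(1)[of 1] r ln_ge in auto)
  then show "star_bound d s 1 \<le> polylog * n powr - (1 / (4 * r))" by (simp add: polylog_def mult_ac)
  have "star_bound d s r \<le> (d * (20 * ln n) ^ d) * (exp 1 * n powr - (1 - \<epsilon>))"
    unfolding star_bound_def miss_r
    by (rule mult_mono[OF pow q_power_le[OF k]]) (use q_01 ln_ge in auto)
  then show "star_bound d s r \<le> polylog * n powr - (1 - \<epsilon>)" by (simp add: polylog_def mult_ac)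
qed

lemma np_mult_star_bound_le:
  assumes "s \<le> d"
  shows "0 \<le> n * p * star_bound d s 1" "0 \<le> n * p * star_bound d s r"
    and "n * p * star_bound d s 1 \<le> 20 * ln n * (polylog * n powr - (1 / (4 * r)))"
    and "n * p * star_bound d s r \<le> 20 * ln n * (polylog * n powr - (1 - \<epsilon>))"
proof -
  have np0: "0 \<le> 20 * ln (real n)" using ln_ge by simp
  have sb: "0 \<le> star_bound d s 1" "0 \<le> star_bound d s r" using star_bound_nonneg r by auto
  then show "0 \<le> n * p * star_bound d s 1" "0 \<le> n * p * star_bound d s r"
    using p_nonneg by auto
  show "n * p * star_bound d s 1 \<le> 20 * ln n * (polylog * n powr - (1 / (4 * r)))"
    by (rule mult_mono[OF np_le star_bound_le(1)[OF assms] np0 sb(1)])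
  show "n * p * star_bound d s r \<le> 20 * ln n * (polylog * n powr - (1 - \<epsilon>))"
    by (rule mult_mono[OF np_le star_bound_le(2)[OF assms] np0 sb(2)])
qed

section \<open>Explicit bounds for the bad events\<close>

lemma prob_many_bad_le':
  assumes "K < d"
  shows "pr (many_bad K d) \<le> n * (r * (20 * ln n * (polylog * n powr - (1 / (4 * r))))) ^ K"
proof -
  have "K * n \<le> d * n" using assms by simp
  then have "pr (many_bad K d) \<le> n * (r * (n * p) * star_bound d (Suc K) 1) ^ K"
    using large4 by (intro prob_many_bad_le np_ge) linarith
  also have "\<dots> \<le> n * (r * (20 * ln n * (polylog * n powr - (1 / (4 * r))))) ^ K"
    unfolding mult.assoc[of "real r"] using np_mult_star_bound_le(1,3)[of "Suc K"] assms
    by (intro mult_left_mono[OF power_mono[OF mult_left_mono]] mult_nonneg_nonneg[of "real r"]) auto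
  finally show ?thesis .
qed

lemma two_n_le: "2 * (2 * n) \<le> n choose 2"
proof -
  have "2 * n \<le> d * n" using d2 by (intro mult_le_mono) auto
  then show ?thesis using large4 by linarith
qed

text \<open>The power of \<open>n\<close> is
  \<open>1 - (1 - \<epsilon>) - 1 / (4 * r) = - 1 / (8 * r)\<close>; this is where
  \<open>\<epsilon>\<close> has to be smaller than \<open>1 / (4 * r)\<close>.\<close>

lemma prob_low_beside_bad_le':
  "pr (low_beside_bad d) \<le> n * r * (20 * ln n * (polylog * n powr - (1 - \<epsilon>)) * (polylog * n powr - (1 / (4 * r))))"
proof -
  have "pr (low_beside_bad d) \<le> n * r * (n * p) * star_bound d 2 r * star_bound d 2 1"
    using two_n_le np_ge by (rule prob_low_beside_bad_le)
  also have "\<dots> = n * r * (n * p * star_bound d 2 r * star_bound d 2 1)" by simp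
  also have "\<dots> \<le> n * r * (20 * ln n * (polylog * n powr - (1 - \<epsilon>)) * (polylog * n powr - (1 / (4 * r))))"
    by (rule mult_left_mono[OF mult_mono[OF np_mult_star_bound_le(4) star_bound_le(1)]])
      (use d2 ln_ge polylog_ge_0 star_bound_nonneg[of 1] r in auto)
  finally show ?thesis .
qed

lemma prob_low_common_nbr_le':
  "pr (low_common_nbr d) \<le> n * (20 * ln n * (polylog * n powr - (1 - \<epsilon>)))\<^sup>2"
proof -
  have "pr (low_common_nbr d) \<le> n * (n * p * star_bound d 3 r)\<^sup>2"
    using two_n_le np_ge by (rule prob_low_common_nbr_le)
  also have "\<dots> \<le> n * (20 * ln n * (polylog * n powr - (1 - \<epsilon>)))\<^sup>2"
    using np_mult_star_bound_le(2,4)[of 3] d2 by (intro mult_left_mono power_mono) auto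
  finally show ?thesis .
qed

lemma prob_dense_spot_le':
  assumes T: "real T \<le> n powr (1 - \<eta>)" and small: "2 * (400 * (ln n)\<^sup>2 * n powr - \<eta>) \<le> 1 / 2"
  shows "pr (dense_spot T) \<le> 4 * (400 * (ln n)\<^sup>2 * n powr - \<eta>)"
proof -
  have npos: "real n > 0" using n2 by simp
  have p: "p \<le> 20 * ln n / n" using np_le npos by (simp add: field_simps)
  have "real n * T * p\<^sup>2 \<le> real n * (n powr (1 - \<eta>)) * (20 * ln n / n)\<^sup>2"
    using T p p_nonneg by (intro mult_mono[OF mult_left_mono power_mono]) auto
  also have "n powr (1 - \<eta>) = n * n powr - \<eta>" using npos by (simp add: powr_diff powr_minus field_simps)
  also have "n * (n * n powr - \<eta>) * (20 * ln n / n)\<^sup>2 = 400 * (ln n)\<^sup>2 * n powr - \<eta>"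
    using npos by (simp add: field_simps power2_eq_square)
  finally have *: "real n * T * p\<^sup>2 \<le> 400 * (ln n)\<^sup>2 * n powr - \<eta>" .
  then have "pr (dense_spot T) \<le> 4 * n * T * p\<^sup>2" using small by (intro prob_dense_spot_le) (simp add: mult.assoc)
  then show ?thesis using * by (simp add: mult.assoc)
qed

text \<open>Rounding leaves \<open>T\<close> within a factor 2 of
  \<open>n powr (1 - \<eta>)\<close>, hence 12 in place of 6. The eighth power stems from the ratio
  8 between the sizes of \<open>C\<close> and \<open>A\<close>.\<close>

lemma prob_trapped_le':
  assumes T: "n powr (1 - \<eta>) \<le> 2 * T" "T \<ge> 1"
    and small: "(12 * n powr \<eta>) ^ 8 * (exp 1 * n powr - (1 / (8 * r))) \<le> 1 / 2"
  shows "pr (trapped T) \<le> r * (2 * ((12 * n powr \<eta>) ^ 8 * (exp 1 * n powr - (1 / (8 * r)))))"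
proof -
  have npos: "real n > 0" using n2 by simp
  have "6 * n / T \<le> 6 * n / (n powr (1 - \<eta>) / 2)"
    using T npos by (intro divide_left_mono) auto
  also have "\<dots> = 12 * n powr \<eta>" using npos by (simp add: powr_diff field_simps)
  finally have 1: "(6 * n / T) ^ 8 \<le> (12 * n powr \<eta>) ^ 8" by (intro power_mono) auto
  have "miss 1 ^ (n div 2) \<le> exp (- (ln n / (4 * r * n) * (n div 2)))" by (rule miss_1_power_le)
  also have "\<dots> \<le> exp (1 - ln n / (8 * r))"
  proof -
    have "real n / 2 - 1 \<le> real (n div 2)" by linarith
    then have "ln n / (4 * r * n) * (real n / 2 - 1) \<le> ln n / (4 * r * n) * real (n div 2)"
      using ln_ge by (intro mult_left_mono) auto
    moreover have "ln n / (4 * r * n) * (real n / 2 - 1) = ln n / (8 * r) - ln n / n / (4 * r)"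
      using npos r by (simp add: field_simps)
    moreover have "ln n / n / (4 * r) \<le> 1"
      using ln_le_minus_one[OF npos] npos by (intro div_4r_le_1) (simp add: field_simps)
    ultimately show ?thesis by simp
  qed
  also have "\<dots> = exp 1 * n powr - (1 / (8 * r))" using npos by (simp add: powr_def flip: exp_add)
  finally have 2: "miss 1 ^ (n div 2) \<le> exp 1 * n powr - (1 / (8 * r))" .
  have 3: "(6 * n / T) ^ 8 * miss 1 ^ (n div 2) \<le> (12 * n powr \<eta>) ^ 8 * (exp 1 * n powr - (1 / (8 * r)))"
    using 1 2 miss_01(1)[of 1] r by (intro mult_mono) auto
  have "pr (trapped T) \<le> r * (2 * ((6 * n / T) ^ 8 * miss 1 ^ (n div 2)))"
    using 3 small by (intro prob_trapped_le T n2) linarith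
  also have "\<dots> \<le> r * (2 * ((12 * n powr \<eta>) ^ 8 * (exp 1 * n powr - (1 / (8 * r)))))"
    using 3 by (intro mult_left_mono) auto
  finally show ?thesis .
qed

lemma prob_unmixed_le':
  fixes \<gamma> :: real
  assumes g: "\<gamma> * n \<le> g" "g * 4 \<le> n" "\<gamma> > 0"
  shows "pr (unmixed g) \<le> r * exp (n * (ln 4 - \<gamma>\<^sup>2 / (4 * r) * ln n))"
proof -
  have npos: "real n > 0" using n2 by simp
  have "(g * 4) * (g * 4) \<le> n * n" using g(2) by (intro mult_le_mono)
  then have "2 * (g * g) \<le> n choose 2" using n_sq_le_4_choose_2[OF n2] by linarith
  then have "pr (unmixed g) \<le> r * (4 ^ n * miss 1 ^ (g * g))" by (rule prob_unmixed_le)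
  also have "\<dots> \<le> r * (exp (n * ln 4) * exp (- (ln n / (4 * r * n) * (g * g))))"
  proof (intro mult_left_mono mult_mono)
    show "(4::real) ^ n \<le> exp (n * ln 4)" by (simp add: exp_of_nat_mult)
    show "miss 1 ^ (g * g) \<le> exp (- (ln n / (4 * r * n) * (g * g)))"
      using miss_1_power_le[of "g * g"] by simp
  qed (use miss_01(1)[of 1] r in auto)
  also have "\<dots> = r * exp (n * ln 4 - ln n / (4 * r * n) * (g * g))" by (simp flip: exp_add)
  also have "\<dots> \<le> r * exp (n * (ln 4 - \<gamma>\<^sup>2 / (4 * r) * ln n))"
  proof -
    have "(\<gamma> * n) * (\<gamma> * n) \<le> real g * real g" using g by (intro mult_mono) auto
    then have "ln n / (4 * r * n) * ((\<gamma> * n) * (\<gamma> * n)) \<le> ln n / (4 * r * n) * (g * g)"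
      using ln_ge by (intro mult_left_mono) auto
    moreover have "ln n / (4 * r * n) * ((\<gamma> * n) * (\<gamma> * n)) = n * (\<gamma>\<^sup>2 / (4 * r) * ln n)"
      using npos r by (simp add: field_simps power2_eq_square)
    ultimately have "n * (\<gamma>\<^sup>2 / (4 * r) * ln n) \<le> ln n / (4 * r * n) * (g * g)" by simp
    then show ?thesis by (intro mult_left_mono) (simp_all add: right_diff_distrib)
  qed
  finally show ?thesis .
qed

lemma prob_isolated_late_le': "pr (\<Union>v\<in>{1..n}. isolated n m1 v) \<le> 1 / n"
proof -
  have npos: "real n > 0" using n2 by simp
  have "pr (\<Union>v\<in>{1..n}. isolated n m1 v) \<le> n * (1 - 1 / (n choose 2)) ^ (m1 * (n - 1))"
    using two_n_le by (intro prob_isolated_late_le) simp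
  also have "\<dots> \<le> n * exp (- (real (m1 * (n - 1)) / (n choose 2)))"
    using N2 by (intro mult_left_mono one_minus_inverse_power_le) (linarith, simp)
  also have "real (m1 * (n - 1)) / (n choose 2) = 2 * m1 / n"
    using n2 by (simp add: real_choose_two of_nat_diff field_simps)
  also have "n * exp (- (2 * m1 / n)) \<le> n * exp (- (2 * ln n))"
    using m1_ge npos by (intro mult_left_mono) (auto simp: field_simps)
  also have "\<dots> = 1 / n" using npos by (simp add: exp_minus exp_double field_simps power2_eq_square)
  finally show ?thesis .
qed

text \<open>The expected number of isolated vertices is at least
  \<open>n powr (\<epsilon>\<^sup>2)\<close>: \<open>m0\<close> is short by the factor
  \<open>1 - \<epsilon>\<close>, the condition on \<open>y\<close> loses at most
  \<open>1 + \<epsilon>\<close>, and the product is \<open>1 - \<epsilon>\<^sup>2\<close>. Replacing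
  \<open>m0\<close> by its upper bound \<open>M\<close> makes the result an explicit function of
  \<open>n\<close>.\<close>

lemma prob_none_isolated_early_le':
  fixes M N y :: real
  defines "M \<equiv> n * ln n / 2" and "N \<equiv> n choose 2"
  defines "y \<equiv> (real n - 1) / (N - M)"
  assumes MN: "M < N" and y: "y \<le> 1 / 2" and y': "y + 2 * y\<^sup>2 \<le> (1 + \<epsilon>) * (2 / n)"
  shows "pr {\<omega>. \<forall>v\<in>{1..n}. \<omega> \<notin> isolated n m0 v}
    \<le> n powr - (\<epsilon>\<^sup>2) + exp (M * (N + (2 * real n - 3) * M) / (N * (N - M)) + 4 * M * y\<^sup>2) - 1"
proof -
  have npos: "real n > 0" using n2 by simp
  have M0: "0 \<le> M" using ln_ge by (simp add: M_def)
  then have NM: "0 \<le> M" "N > 0" using MN by auto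
  have m0M: "real m0 \<le> (1 - \<epsilon>) * M" "real m0 \<le> M"
  proof -
    show 1: "real m0 \<le> (1 - \<epsilon>) * M" using m0_le by (simp add: M_def \<epsilon>_def)
    have "(1 - \<epsilon>) * M \<le> 1 * M" using eps NM by (intro mult_right_mono) auto
    then show "real m0 \<le> M" using 1 by simp
  qed
  define z where "z = (real n - 1) / (N - m0)"
  have z: "0 \<le> z" "z \<le> y" using m0M MN n2 unfolding z_def y_def by (auto intro!: divide_left_mono)
  define a where "a = (1 - z) ^ m0"
  define b where "b = q ^ (2 * n - 3)"
  have a_eq: "a = (1 - real (n - 1) / (real (n choose 2) - real m0)) ^ m0"
    using n2 by (simp add: a_def z_def N_def of_nat_diff)
  have zz: "z + 2 * z\<^sup>2 \<le> y + 2 * y\<^sup>2" using z by (intro add_mono mult_left_mono power_mono) auto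
  have a_ge: "exp (- (m0 * (z + 2 * z\<^sup>2))) \<le> a"
  proof -
    have "- z - 2 * z\<^sup>2 \<le> ln (1 - z)" using z y by (intro ln_one_minus_pos_lower_bound) auto
    moreover have "1 - z > 0" using z y by linarith
    ultimately have "exp (- z - 2 * z\<^sup>2) \<le> 1 - z" by (simp only: ln_ge_iff)
    moreover have "- z - 2 * z\<^sup>2 = - (z + 2 * z\<^sup>2)" by simp
    ultimately have "exp (- (z + 2 * z\<^sup>2)) \<le> 1 - z" by metis
    then have "exp (- (z + 2 * z\<^sup>2)) ^ m0 \<le> a" unfolding a_def by (intro power_mono) auto
    then show ?thesis by (metis exp_of_nat_mult mult_minus_right)
  qed
  have apos: "a > 0" using a_ge by (smt (verit) exp_gt_zero)
  have na: "n powr (\<epsilon>\<^sup>2) \<le> n * a"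
  proof -
    have "m0 * (z + 2 * z\<^sup>2) \<le> ((1 - \<epsilon>) * M) * ((1 + \<epsilon>) * (2 / n))"
      using m0M zz y' z eps NM by (intro mult_mono) auto
    also have "\<dots> = (1 - \<epsilon>\<^sup>2) * ln n" using npos by (simp add: M_def field_simps power2_eq_square)
    finally have "exp (- ((1 - \<epsilon>\<^sup>2) * ln n)) \<le> a" using a_ge by (smt (verit) exp_le_cancel_iff)
    then have "n * exp (- ((1 - \<epsilon>\<^sup>2) * ln n)) \<le> n * a" by (intro mult_left_mono) auto
    moreover have "n * exp (- ((1 - \<epsilon>\<^sup>2) * ln n)) = n powr (\<epsilon>\<^sup>2)"
    proof -
      have "n powr (\<epsilon>\<^sup>2) = exp (ln n + - ((1 - \<epsilon>\<^sup>2) * ln n))" using npos by (simp add: powr_def algebra_simps)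
      then show ?thesis using npos by (simp only: exp_add exp_ln)
    qed
    ultimately show ?thesis by simp
  qed
  have na1: "n * a \<ge> 1"
  proof -
    have "1 \<le> n powr (\<epsilon>\<^sup>2)" using n2 by (intro ge_one_powr_ge_zero) auto
    then show ?thesis using na by linarith
  qed
  have ba: "b / a\<^sup>2 \<le> exp (M * (N + (2 * real n - 3) * M) / (N * (N - M)) + 4 * M * y\<^sup>2)"
  proof -
    have "b = (1 - 1 / N) ^ (m0 * (2 * n - 3))" by (simp add: b_def q_def N_def power_mult)
    also have "\<dots> \<le> exp (- (real (m0 * (2 * n - 3)) / N))"
      using N2 unfolding N_def by (intro one_minus_inverse_power_le) linarith
    finally have b_le: "b \<le> exp (- (real m0 * (2 * real n - 3) / N))" using n2 by (simp add: of_nat_diff)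
    have a2: "exp (- (2 * (m0 * (z + 2 * z\<^sup>2)))) \<le> a\<^sup>2"
    proof -
      have "exp (- (m0 * (z + 2 * z\<^sup>2))) ^ 2 \<le> a\<^sup>2" using a_ge by (intro power_mono) auto
      then show ?thesis by (simp add: exp_double[symmetric])
    qed
    have "b / a\<^sup>2 \<le> exp (- (real m0 * (2 * real n - 3) / N)) / exp (- (2 * (m0 * (z + 2 * z\<^sup>2))))"
      using b_le a2 by (intro frac_le) auto
    also have "\<dots> = exp (2 * m0 * z - real m0 * (2 * real n - 3) / N + 4 * m0 * z\<^sup>2)"
      by (simp add: exp_diff[symmetric] algebra_simps)
    also have "\<dots> \<le> exp (M * (N + (2 * real n - 3) * M) / (N * (N - M)) + 4 * M * y\<^sup>2)"
    proof -
      \<comment> \<open>Both terms have order \<open>ln n\<close>. Over the common denominator their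
        leading parts cancel, and the remainder has order at most \<open>(ln n)\<^sup>2 / n\<close>;
        this is what makes \<open>b / a\<^sup>2\<close> close to 1.\<close>
      have "2 * m0 * z - real m0 * (2 * real n - 3) / N = m0 * (N + (2 * real n - 3) * m0) / (N * (N - m0))"
      proof -
        have A: "N - m0 > 0" using m0M MN by simp
        have "2 * m0 * z = (2 * m0 * (real n - 1) * N) / (N * (N - m0))" using A NM by (simp add: z_def)
        moreover have "real m0 * (2 * real n - 3) / N = (real m0 * (2 * real n - 3) * (N - m0)) / (N * (N - m0))" using A by simp
        ultimately show ?thesis by (simp add: diff_divide_distrib[symmetric] algebra_simps)
      qed
      also have "\<dots> \<le> M * (N + (2 * real n - 3) * M) / (N * (N - M))"
        using NM m0M MN n2 by (intro frac_le mult_mono add_mono mult_left_mono mult_pos_pos mult_nonneg_nonneg) auto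
      finally have 1: "2 * m0 * z - real m0 * (2 * real n - 3) / N \<le> M * (N + (2 * real n - 3) * M) / (N * (N - M))" .
      have "4 * m0 * z\<^sup>2 \<le> 4 * M * y\<^sup>2" using m0M z by (intro mult_mono power_mono) auto
      then show ?thesis using 1 by simp
    qed
    finally show ?thesis .
  qed
  have "pr {\<omega>. \<forall>v\<in>{1..n}. \<omega> \<notin> isolated n m0 v} \<le> 1 / (n * a) + b / a\<^sup>2 - 1"
    using two_n_le na1 by (intro prob_none_isolated_early_le a_eq b_def) auto
  also have "1 / (n * a) \<le> 1 / n powr (\<epsilon>\<^sup>2)" using na npos by (intro divide_left_mono) (auto simp: apos)
  also have "1 / n powr (\<epsilon>\<^sup>2) = n powr - (\<epsilon>\<^sup>2)" by (simp add: powr_minus_divide)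
  finally show ?thesis using ba by linarith
qed

end

section \<open>Asymptotics\<close>

lemma ln_power_powr_tendsto_0:
  assumes "\<delta> > 0"
  shows "(\<lambda>n. ln (real n) ^ k * real n powr - \<delta>) \<longlonglongrightarrow> 0"
  using assms by real_asymp

lemma exp_n_ln_tendsto_0:
  assumes "c > 0"
  shows "(\<lambda>n. exp (real n * (b - c * ln (real n)))) \<longlonglongrightarrow> 0"
  using assms by real_asymp

lemma second_moment_exponent_tendsto_0:
  defines "M \<equiv> \<lambda>n::nat. real n * ln (real n) / 2"
  defines "N \<equiv> \<lambda>n::nat. real n * (real n - 1) / 2"
  defines "y \<equiv> \<lambda>n::nat. (real n - 1) / (N n - M n)"
  shows "(\<lambda>n. M n * (N n + (2 * real n - 3) * M n) / (N n * (N n - M n)) + 4 * M n * (y n)\<^sup>2) \<longlonglongrightarrow> 0"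
    and "(\<lambda>n. (y n + 2 * (y n)\<^sup>2) * (real n / 2)) \<longlonglongrightarrow> 1"
    and "\<forall>\<^sub>F n in sequentially. M n < N n" and "\<forall>\<^sub>F n in sequentially. y n \<le> 1 / 2"
  unfolding y_def N_def M_def by real_asymp+

text \<open>In the third condition \<open>7 / 8\<close> is the least value of
  \<open>1 - 1 / (8 * r)\<close>, so that the limit is free of \<open>r\<close>.\<close>

lemma large_facts:
  shows "\<forall>\<^sub>F n::nat in sequentially. ln (real n) \<ge> 1"
    and "\<forall>\<^sub>F n::nat in sequentially. 8 * (n * ln n + 1) \<le> 20 * ln n * (real n - 1)"
    and "\<forall>\<^sub>F n::nat in sequentially. ln n / (2 * n) \<le> 7 / 8 * (ln n / n) - 2 / (real n)\<^sup>2"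
    and "\<forall>\<^sub>F n::nat in sequentially. 2 * real d * ln n / n + 2 / n \<le> 1"
    and "\<forall>\<^sub>F n::nat in sequentially. 2 * (n * ln n + 1) \<le> real n * (real n - 1) / 2"
  by real_asymp+


definition early_time :: "nat \<Rightarrow> nat \<Rightarrow> nat" where
  "early_time r n = nat \<lfloor>(1 - 1 / (8 * r)) * (n * ln n / 2)\<rfloor>"

definition late_time :: "nat \<Rightarrow> nat" where
  "late_time n = nat \<lceil>n * ln n\<rceil>"

lemma eventually_critical_window:
  assumes r: "r \<ge> 1" and d: "d \<ge> 3"
  shows "\<forall>\<^sub>F n in sequentially. critical_window n r (early_time r n) (late_time n) d"
  using large_facts(1) large_facts(2) large_facts(3) large_facts(4)[of d] large_facts(5)
    eventually_ge_at_top[of "4 * d + 1"]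
proof eventually_elim
  case (elim n)
  define x where "x = real n * ln n"
  define e where "e = 1 / real (8 * r)"
  have e: "0 < e" "e \<le> 1 / 8" using r by (auto simp: e_def field_simps)
  have n: "n \<ge> 13" using elim(6) d by simp
  have "real n * 1 \<le> x" unfolding x_def using elim(1) by (intro mult_left_mono) auto
  then have x: "x \<ge> 13" using n by simp
  note N2 = two_mult_choose_two[of n] and N = real_choose_two[of n]
  have ex: "0 \<le> (1 - e) * (x / 2)" "(1 - e) * (x / 2) \<le> x"
    using e x mult_right_mono[of "1 - e" 1 "x / 2"] by auto
  have m0: "(1 - e) * (x / 2) - 1 \<le> early_time r n" "early_time r n \<le> (1 - e) * (x / 2)"
    unfolding early_time_def x_def[symmetric] e_def[symmetric] using ex by linarith+
  have m1: "x \<le> late_time n" "late_time n \<le> x + 1"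
    unfolding late_time_def x_def[symmetric] using x by linarith+
  show ?case
  proof
    show "early_time r n \<le> late_time n" using m0 m1 ex by linarith
    have "2 * (x + 1) \<le> real (n choose 2)" using elim(5) by (simp add: x_def N)
    moreover have "2 * real (late_time n) \<le> 2 * (x + 1)" using m1 by (intro mult_left_mono) auto
    ultimately have "2 * real (late_time n) \<le> real (n choose 2)" by (rule order_trans[rotated])
    then show "2 * late_time n \<le> n choose 2" by linarith
    then show "2 \<le> n choose 2" using m1 x by linarith
    show "(1 - 1 / real (8 * r)) * (real n * ln n / 2) - 1 \<le> early_time r n"
      "early_time r n \<le> (1 - 1 / real (8 * r)) * (real n * ln n / 2)"
      using m0 by (simp_all add: x_def e_def)
    show "n * ln n \<le> late_time n" "late_time n \<le> n * ln n + 1" using m1 by (simp_all add: x_def)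
    have "7 / 8 * (ln n / n) \<le> (1 - e) * (ln n / n)" using e elim(1) by (intro mult_right_mono) auto
    then show "ln n / real (2 * n) \<le> (1 - 1 / real (8 * r)) * (ln n / n) - 2 / (real n)\<^sup>2"
      using elim(3) by (simp add: e_def)
    have "(4 * d) * n \<le> (n - 1) * n" using elim(6) by (intro mult_le_mono) auto
    then have "4 * (d * n) \<le> 2 * (n choose 2)" using N2 by (simp add: mult.commute)
    then show "2 * (d * n) \<le> n choose 2" by simp
  qed (use r d n elim in auto)
qed

text \<open>The eight terms bound the probabilities of the bad events of \<open>prob_tau_eq_ge\<close>, in that order,
  when \<open>K = 8 r\<close>.\<close>

definition error_bound :: "nat \<Rightarrow> nat \<Rightarrow> nat \<Rightarrow> nat \<Rightarrow> real" where
  "error_bound r d l n = (let L = ln n; P = d * (20 * L) ^ d * exp 1; \<epsilon> = 1 / (8 * real r);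
       \<eta> = 1 / (128 * real r); \<gamma> = 1 / (64 * real l); M = n * L / 2; N = n * (real n - 1) / 2;
       y = (real n - 1) / (N - M)
     in n * (r * (20 * L * (P * n powr - (1 / (4 * r))))) ^ (8 * r)
      + n * r * (20 * L * (P * n powr - (1 - \<epsilon>)) * (P * n powr - (1 / (4 * r))))
      + n * (20 * L * (P * n powr - (1 - \<epsilon>)))\<^sup>2
      + 4 * (400 * L\<^sup>2 * n powr - \<eta>)
      + r * (2 * ((12 * n powr \<eta>) ^ 8 * (exp 1 * n powr - (1 / (8 * r)))))
      + r * exp (n * (ln 4 - \<gamma>\<^sup>2 / (4 * r) * L))
      + 1 / n
      + (n powr - (\<epsilon>\<^sup>2) + exp (M * (N + (2 * real n - 3) * M) / (N * (N - M)) + 4 * M * y\<^sup>2) - 1))"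

text \<open>Up to logarithms, the five exponents of \<open>n\<close> are
  \<open>1 - 8 * r / (4 * r) = - 1\<close>, \<open>- 1 / (8 * r)\<close>,
  \<open>- (1 - 1 / (4 * r))\<close>, \<open>- 1 / (128 * r)\<close> and
  \<open>8 / (128 * r) - 1 / (8 * r) = - 1 / (16 * r)\<close>. The values \<open>K = 8 * r\<close>
  and \<open>\<eta> = 1 / (128 * r)\<close> are chosen to make the first and the last
  negative.\<close>

lemma polylog_terms_tendsto_0:
  fixes r d :: nat
  assumes r: "r \<ge> 1"
  defines "P \<equiv> \<lambda>n::nat. d * (20 * ln n) ^ d * exp 1"
  shows "(\<lambda>n. n * (r * (20 * ln n * (P n * n powr - (1 / (4 * r))))) ^ (8 * r)) \<longlonglongrightarrow> 0"
    and "(\<lambda>n. n * r * (20 * ln n * (P n * n powr - (1 - 1 / (8 * real r))) * (P n * n powr - (1 / (4 * r))))) \<longlonglongrightarrow> 0"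
    and "(\<lambda>n. n * (20 * ln n * (P n * n powr - (1 - 1 / (8 * real r))))\<^sup>2) \<longlonglongrightarrow> 0"
    and "(\<lambda>n. 4 * (400 * (ln n)\<^sup>2 * n powr - (1 / (128 * real r)))) \<longlonglongrightarrow> 0"
    and "(\<lambda>n. r * (2 * ((12 * n powr (1 / (128 * real r))) ^ 8 * (exp 1 * n powr - (1 / (8 * r)))))) \<longlonglongrightarrow> 0"
proof -
  have scaled: "f \<longlonglongrightarrow> 0" if "\<delta> > 0" "\<And>n::nat. n > 0 \<Longrightarrow> f n = C * (ln n ^ k * n powr - \<delta>)" for f :: "nat \<Rightarrow> real" and C k \<delta>
  proof -
    have "(\<lambda>n. C * (ln (real n) ^ k * n powr - \<delta>)) \<longlonglongrightarrow> C * 0"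
      by (intro tendsto_mult_left ln_power_powr_tendsto_0 that)
    moreover have "\<forall>\<^sub>F n in sequentially. C * (ln (real n) ^ k * n powr - \<delta>) = f n"
      using eventually_gt_at_top[of 0] by eventually_elim (simp add: that(2))
    ultimately show ?thesis by (auto intro: Lim_transform_eventually)
  qed
  have r0: "real r > 0" using r by simp
  have pow: "(real n powr a) ^ k = n powr (a * k)" if "n > 0" for n k :: nat and a :: real
    using that by (simp add: powr_powr flip: powr_realpow)
  have e1: "real n * n powr (- (1 / (4 * r)) * (8 * r)) = n powr - 1" if "n > 0" for n :: nat
  proof -
    have "- (1 / (4 * real r)) * (8 * r) = - 2" using r0 by simp
    then show ?thesis using that by (simp add: powr_minus powr_numeral field_simps power2_eq_square)
  qed
  show "(\<lambda>n. n * (r * (20 * ln n * (P n * n powr - (1 / (4 * r))))) ^ (8 * r)) \<longlonglongrightarrow> 0"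
  proof (rule scaled[where \<delta>=1 and k="(d + 1) * (8 * r)" and C="(r * 20 * d * 20 ^ d * exp 1) ^ (8 * r)"])
    fix n :: nat assume n: "n > 0"
    have "n * (r * (20 * ln n * (P n * n powr - (1 / (4 * r))))) ^ (8 * r) =
       n * ((r * 20 * d * 20 ^ d * exp 1) * ln n ^ (d + 1) * n powr - (1 / (4 * r))) ^ (8 * r)"
      by (simp add: P_def power_mult_distrib mult_ac)
    also have "\<dots> = (r * 20 * d * 20 ^ d * exp 1) ^ (8 * r) * (ln n ^ (d + 1)) ^ (8 * r) *
       (n * (n powr - (1 / (4 * r))) ^ (8 * r))"
      by (simp only: power_mult_distrib mult_ac)
    also have "n * (n powr - (1 / (4 * r))) ^ (8 * r) = n powr - 1"
      unfolding pow[OF n] using e1[OF n] by simp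
    also have "(ln n ^ (d + 1)) ^ (8 * r) = ln n ^ ((d + 1) * (8 * r))" by (simp only: power_mult)
    finally show "n * (r * (20 * ln n * (P n * n powr - (1 / (4 * r))))) ^ (8 * r) =
      (r * 20 * d * 20 ^ d * exp 1) ^ (8 * r) * (ln n ^ ((d + 1) * (8 * r)) * n powr - 1)" by simp
  qed simp
  show "(\<lambda>n. n * r * (20 * ln n * (P n * n powr - (1 - 1 / (8 * real r))) * (P n * n powr - (1 / (4 * r))))) \<longlonglongrightarrow> 0"
  proof (rule scaled[where \<delta>="1 / (8 * r)" and k="2 * d + 1" and C="r * 20 * (d * 20 ^ d * exp 1)\<^sup>2"])
    fix n :: nat assume n: "n > 0"
    have "n * r * (20 * ln n * (P n * n powr - (1 - 1 / (8 * real r))) * (P n * n powr - (1 / (4 * r)))) =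
      r * 20 * (d * 20 ^ d * exp 1)\<^sup>2 * (ln n ^ (2 * d + 1) * (n powr 1 * n powr - (1 - 1 / (8 * real r)) * n powr - (1 / (4 * r))))"
      using n by (simp add: P_def power_mult_distrib power_add power_mult power2_eq_square mult_ac)
    also have "n powr 1 * n powr - (1 - 1 / (8 * real r)) * n powr - (1 / (4 * r)) = n powr - (1 / (8 * r))"
    proof -
      have "1 + - (1 - 1 / (8 * real r)) + - (1 / real (4 * r)) = - (1 / real (8 * r))" using r0 by (simp add: field_simps)
      then show ?thesis by (simp only: powr_add[symmetric])
    qed
    finally show "n * r * (20 * ln n * (P n * n powr - (1 - 1 / (8 * real r))) * (P n * n powr - (1 / (4 * r)))) =
      r * 20 * (d * 20 ^ d * exp 1)\<^sup>2 * (ln n ^ (2 * d + 1) * n powr - (1 / (8 * r)))" .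
  qed (use r in simp)
  show "(\<lambda>n. n * (20 * ln n * (P n * n powr - (1 - 1 / (8 * real r))))\<^sup>2) \<longlonglongrightarrow> 0"
  proof (rule scaled[where \<delta>="1 - 1 / (4 * r)" and k="2 * d + 2" and C="(20 * d * 20 ^ d * exp 1)\<^sup>2"])
    fix n :: nat assume n: "n > 0"
    have "n * (20 * ln n * (P n * n powr - (1 - 1 / (8 * real r))))\<^sup>2 =
      (20 * d * 20 ^ d * exp 1)\<^sup>2 * (ln n ^ (2 * d + 2) * (n powr 1 * n powr - (1 - 1 / (8 * real r)) * n powr - (1 - 1 / (8 * real r))))"
      using n by (simp add: P_def power_mult_distrib power_add power_mult power2_eq_square mult_ac)
    also have "n powr 1 * n powr - (1 - 1 / (8 * real r)) * n powr - (1 - 1 / (8 * real r)) = n powr - (1 - 1 / (4 * r))"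
    proof -
      have "1 + - (1 - 1 / (8 * real r)) + - (1 - 1 / (8 * real r)) = - (1 - 1 / real (4 * r))" using r0 by (simp add: field_simps)
      then show ?thesis by (simp only: powr_add[symmetric])
    qed
    finally show "n * (20 * ln n * (P n * n powr - (1 - 1 / (8 * real r))))\<^sup>2 =
      (20 * d * 20 ^ d * exp 1)\<^sup>2 * (ln n ^ (2 * d + 2) * n powr - (1 - 1 / (4 * r)))" .
  qed (use r in \<open>simp add: field_simps\<close>)
  show "(\<lambda>n. 4 * (400 * (ln n)\<^sup>2 * n powr - (1 / (128 * real r)))) \<longlonglongrightarrow> 0"
    by (rule scaled[where \<delta>="1 / (128 * r)" and k=2 and C=1600]) (use r in auto)
  show "(\<lambda>n. r * (2 * ((12 * n powr (1 / (128 * real r))) ^ 8 * (exp 1 * n powr - (1 / (8 * r)))))) \<longlonglongrightarrow> 0"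
  proof (rule scaled[where \<delta>="1 / (16 * r)" and k=0 and C="r * 2 * 12 ^ 8 * exp 1"])
    fix n :: nat assume n: "n > 0"
    have "r * (2 * ((12 * n powr (1 / (128 * real r))) ^ 8 * (exp 1 * n powr - (1 / (8 * r))))) =
      r * 2 * 12 ^ 8 * exp 1 * ((n powr (1 / (128 * real r))) ^ 8 * n powr - (1 / (8 * r)))"
      by (simp add: power_mult_distrib)
    also have "(n powr (1 / (128 * real r))) ^ 8 * n powr - (1 / (8 * r)) = n powr - (1 / (16 * r))"
      unfolding pow[OF n] using r0 by (simp add: powr_add[symmetric] field_simps)
    finally show "r * (2 * ((12 * n powr (1 / (128 * real r))) ^ 8 * (exp 1 * n powr - (1 / (8 * r))))) =
      r * 2 * 12 ^ 8 * exp 1 * (ln n ^ 0 * n powr - (1 / (16 * r)))" by simp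
  qed (use r in simp)
qed

section \<open>The limit of the total error and the choice of the parameters\<close>

lemma error_bound_tendsto_0:
  assumes r: "r \<ge> 1" and l: "l \<ge> 1"
  shows "error_bound r d l \<longlonglongrightarrow> 0"
proof -
  define E where "E = (\<lambda>n::nat. let M = n * ln n / 2; N = n * (real n - 1) / 2; y = (real n - 1) / (N - M)
     in M * (N + (2 * real n - 3) * M) / (N * (N - M)) + 4 * M * y\<^sup>2)"
  have "E \<longlonglongrightarrow> 0" using second_moment_exponent_tendsto_0(1) by (simp only: E_def Let_def)
  then have "(\<lambda>n. exp (E n)) \<longlonglongrightarrow> exp 0" by (rule tendsto_exp)
  moreover have "(\<lambda>n::nat. n powr - ((1 / (8 * real r))\<^sup>2)) \<longlonglongrightarrow> 0"
    using ln_power_powr_tendsto_0[of "(1 / (8 * real r))\<^sup>2" 0] r by simp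
  ultimately have t8: "(\<lambda>n::nat. n powr - ((1 / (8 * real r))\<^sup>2) + exp (E n) - 1) \<longlonglongrightarrow> 0 + exp 0 - 1"
    by (intro tendsto_diff tendsto_add tendsto_const)
  have t6: "(\<lambda>n::nat. r * exp (n * (ln 4 - (1 / (64 * real l))\<^sup>2 / (4 * r) * ln n))) \<longlonglongrightarrow> real r * 0"
    using r l by (intro tendsto_mult_left exp_n_ln_tendsto_0) auto
  note t = polylog_terms_tendsto_0(1-3)[OF r, of d] polylog_terms_tendsto_0(4,5)[OF r]
  show ?thesis
    using tendsto_add[OF tendsto_add[OF tendsto_add[OF tendsto_add[OF tendsto_add[OF tendsto_add[OF
        tendsto_add[OF t(1,2)] t(3)] t(4)] t(5)] t6] lim_1_over_n] t8]
    unfolding error_bound_def Let_def E_def by simp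
qed

lemma eventually_prob_tau_eq_ge:
  assumes r: "r \<ge> 1" and pat: "set pat \<subseteq> {1..r}" "{1..r} \<subseteq> set pat" "pat \<noteq> []" and d: "d = 8 * r + 32"
  shows "\<forall>\<^sub>F n in sequentially. 1 - error_bound r d (length pat) n \<le>
     measure_pmf.prob (full_process n r) {\<omega>. tau_connected pat n \<omega> = tau_1 n \<omega>}"
proof -
  define l where "l = length pat"
  have l: "l \<ge> 1" using pat(3) by (simp add: l_def Suc_le_eq)
  have d3: "d \<ge> 3" using d by simp
  define \<eta> where "\<eta> = 1 / (128 * real r)"
  have \<eta>: "0 < \<eta>" "\<eta> < 1" using r by (auto simp: \<eta>_def field_simps)
  define y where "y n = (real n - 1) / (n * (real n - 1) / 2 - n * ln n / 2)" for n :: nat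
  have small4: "\<forall>\<^sub>F n::nat in sequentially. 4 * (400 * (ln n)\<^sup>2 * n powr - \<eta>) < 1"
    unfolding \<eta>_def using polylog_terms_tendsto_0(4)[OF r] by (rule order_tendstoD) simp
  have small5: "\<forall>\<^sub>F n::nat in sequentially. r * (2 * ((12 * n powr \<eta>) ^ 8 * (exp 1 * n powr - (1 / (8 * r))))) < 1"
    unfolding \<eta>_def using polylog_terms_tendsto_0(5)[OF r] by (rule order_tendstoD) simp
  have small8: "\<forall>\<^sub>F n::nat in sequentially. (y n + 2 * (y n)\<^sup>2) * (real n / 2) < 1 + 1 / (8 * real r)"
    unfolding y_def using second_moment_exponent_tendsto_0(2) by (rule order_tendstoD) (use r in simp)
  show ?thesis
    using eventually_critical_window[OF r d3] small4 small5 small8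
      second_moment_exponent_tendsto_0(3) second_moment_exponent_tendsto_0(4) eventually_ge_at_top[of "64 * l"]
  proof eventually_elim
    case (elim n)
    interpret critical_window n r "early_time r n" "late_time n" d by (rule elim(1))
    have npos: "real n > 0" "n \<ge> 1" using n2 by auto
    \<comment> \<open>The largest size with \<open>32 * l * g \<le> n\<close>. As
      \<open>g \<ge> 1\<close>, rounding loses at most a factor 2, which explains
      \<open>\<gamma> = 1 / (64 * l)\<close> in \<open>error_bound\<close>.\<close>
    define g where "g = n div (32 * l)"
    have g1: "g \<ge> 1" unfolding g_def using elim(7) l by (simp add: Suc_le_eq div_greater_zero_iff)
    have gn: "32 * l * g \<le> n" unfolding g_def by (rule times_div_less_eq_dividend)
    have lg: "1 * g \<le> l * g" "l * 1 \<le> l * g" using l g1 by (intro mult_le_mono; simp)+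
    have "32 * (l * g) \<le> n" using gn by (simp add: mult.assoc)
    then have g4: "g * 4 \<le> n" using lg by linarith
    have "n < 32 * l + 32 * l * g" unfolding g_def using l by (intro dividend_less_times_div) simp
    then have "n < 32 * l + 32 * (l * g)" by (simp add: mult.assoc)
    then have "n \<le> 64 * (l * g)" using lg by linarith
    then have "real n \<le> real (64 * (l * g))" by (rule of_nat_mono)
    then have g\<gamma>: "1 / (64 * real l) * n \<le> g" using l by (simp add: field_simps)
    define x where "x = n powr (1 - \<eta>)"
    have x1: "1 \<le> x" unfolding x_def using npos \<eta> by (intro ge_one_powr_ge_zero) auto
    \<comment> \<open>As \<open>x \<ge> 1\<close>, rounding down still gives
      \<open>T \<ge> 1\<close> and \<open>x \<le> 2 * T\<close>. The same \<open>T\<close> thus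
      serves \<open>dense_spot\<close>, which needs it small, and \<open>trapped\<close>, which
      needs it large.\<close>
    define T where "T = nat \<lfloor>x\<rfloor>"
    have "1 \<le> \<lfloor>x\<rfloor>" using x1 by (simp add: le_floor_iff)
    then have "real T = \<lfloor>x\<rfloor>" "T \<ge> 1" by (auto simp: T_def le_nat_iff)
    then have T: "real T \<le> x" "x \<le> 2 * T" "T \<ge> 1" by linarith+
    have b4: "pr (dense_spot T) \<le> 4 * (400 * (ln n)\<^sup>2 * n powr - \<eta>)"
      using T(1) elim(2) unfolding x_def by (intro prob_dense_spot_le') auto
    have b5: "pr (trapped T) \<le> r * (2 * ((12 * n powr \<eta>) ^ 8 * (exp 1 * n powr - (1 / (8 * r)))))"
    proof -
      let ?z = "(12 * n powr \<eta>) ^ 8 * (exp 1 * n powr - (1 / (8 * r)))"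
      have "1 * (2 * ?z) \<le> r * (2 * ?z)" using r by (intro mult_right_mono) auto
      then have "?z \<le> 1 / 2" using elim(3) by linarith
      then show ?thesis using T(2,3) by (intro prob_trapped_le') (auto simp: x_def)
    qed
    have b6: "pr (unmixed g) \<le> r * exp (n * (ln 4 - (1 / (64 * real l))\<^sup>2 / (4 * r) * ln n))"
      using g\<gamma> g4 l by (intro prob_unmixed_le') auto
    have yle: "y n + 2 * (y n)\<^sup>2 \<le> (1 + \<epsilon>) * (2 / n)"
      using elim(4) npos by (simp add: \<epsilon>_def field_simps)
    have b8: "pr {\<omega>. \<forall>v\<in>{1..n}. \<omega> \<notin> isolated n (early_time r n) v} \<le> n powr - (\<epsilon>\<^sup>2) +
        exp (n * ln n / 2 * (n * (real n - 1) / 2 + (2 * real n - 3) * (n * ln n / 2)) /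
           (n * (real n - 1) / 2 * (n * (real n - 1) / 2 - n * ln n / 2)) + 4 * (n * ln n / 2) * (y n)\<^sup>2) - 1"
      using prob_none_isolated_early_le' elim(5,6) yle unfolding real_choose_two y_def by simp
    have "1 - (pr (many_bad (8 * r) d) + pr (low_beside_bad d) + pr (low_common_nbr d) + pr (dense_spot T) +
      pr (trapped T) + pr (unmixed g) + pr (\<Union>v\<in>{1..n}. isolated n (late_time n) v) +
      pr {\<omega>. \<forall>v\<in>{1..n}. \<omega> \<notin> isolated n (early_time r n) v}) \<le> pr {\<omega>. tau_connected pat n \<omega> = tau_1 n \<omega>}"
      using n2 d pat g1 gn by (intro prob_tau_eq_ge) (auto simp: l_def)
    moreover have "pr (many_bad (8 * r) d) + pr (low_beside_bad d) + pr (low_common_nbr d) + pr (dense_spot T) +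
      pr (trapped T) + pr (unmixed g) + pr (\<Union>v\<in>{1..n}. isolated n (late_time n) v) +
      pr {\<omega>. \<forall>v\<in>{1..n}. \<omega> \<notin> isolated n (early_time r n) v} \<le> error_bound r d l n"
    proof -
      have "8 * r < d" using d by simp
      then have "pr (many_bad (8 * r) d) + pr (low_beside_bad d) + pr (low_common_nbr d) + pr (dense_spot T) +
          pr (trapped T) + pr (unmixed g) + pr (\<Union>v\<in>{1..n}. isolated n (late_time n) v) +
          pr {\<omega>. \<forall>v\<in>{1..n}. \<omega> \<notin> isolated n (early_time r n) v} \<le>
        n * (r * (20 * ln n * (polylog * n powr - (1 / (4 * r))))) ^ (8 * r)
        + n * r * (20 * ln n * (polylog * n powr - (1 - \<epsilon>)) * (polylog * n powr - (1 / (4 * r))))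
        + n * (20 * ln n * (polylog * n powr - (1 - \<epsilon>)))\<^sup>2
        + 4 * (400 * (ln n)\<^sup>2 * n powr - \<eta>)
        + r * (2 * ((12 * n powr \<eta>) ^ 8 * (exp 1 * n powr - (1 / (8 * r)))))
        + r * exp (n * (ln 4 - (1 / (64 * real l))\<^sup>2 / (4 * r) * ln n))
        + 1 / n
        + (n powr - (\<epsilon>\<^sup>2) +
        exp (n * ln n / 2 * (n * (real n - 1) / 2 + (2 * real n - 3) * (n * ln n / 2)) /
           (n * (real n - 1) / 2 * (n * (real n - 1) / 2 - n * ln n / 2)) + 4 * (n * ln n / 2) * (y n)\<^sup>2) - 1)"
        by (intro add_mono b4 b5 b6 b8 prob_many_bad_le' prob_low_beside_bad_le' prob_low_common_nbr_le'
            prob_isolated_late_le')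
      also have "\<dots> = error_bound r d l n"
        unfolding error_bound_def Let_def polylog_def \<epsilon>_def \<eta>_def y_def by simp
      finally show ?thesis .
    qed
    ultimately show ?case unfolding l_def by linarith
  qed
qed

lemma prob_tau_eq_tendsto_1:
  assumes r: "r \<ge> 1" and pat: "set pat \<subseteq> {1..r}" "{1..r} \<subseteq> set pat" "pat \<noteq> []"
  shows "(\<lambda>n. measure_pmf.prob (full_process n r) {\<omega>. tau_connected pat n \<omega> = tau_1 n \<omega>}) \<longlonglongrightarrow> 1"
proof (rule tendsto_sandwich)
  have "(\<lambda>n. 1 - error_bound r (8 * r + 32) (length pat) n) \<longlonglongrightarrow> 1 - 0"
    using r pat(3) by (intro tendsto_diff tendsto_const error_bound_tendsto_0) (auto simp: Suc_le_eq)
  then show "(\<lambda>n. 1 - error_bound r (8 * r + 32) (length pat) n) \<longlonglongrightarrow> 1" by simp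
qed (use eventually_prob_tau_eq_ge[OF assms refl] in auto)

theorem theorem2:
  fixes r :: nat and pat :: "nat list"
  assumes "r \<ge> 1"
    and "is_pattern r pat"
    and "length pat \<ge> 2"
    and "\<forall>c\<in>{1..r}. c \<in> set pat"
  shows "((\<lambda>n. measure_pmf.prob (full_process n r) {\<omega>. tau_connected pat n \<omega> = tau_1 n \<omega>})
           \<longlongrightarrow> 1) (inf sequentially (principal {n. length pat dvd n}))"
proof (rule tendsto_mono[OF inf_le1])
  have "set pat \<subseteq> {1..r}" using assms(2) by (simp add: is_pattern_def)
  moreover have "{1..r} \<subseteq> set pat" using assms(4) by blast
  moreover have "pat \<noteq> []" using assms(3) by auto
  ultimately show "(\<lambda>n. measure_pmf.prob (full_process n r) {\<omega>. tau_connected pat n \<omega> = tau_1 n \<omega>})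
      \<longlonglongrightarrow> 1"
    by (rule prob_tau_eq_tendsto_1[OF assms(1)])
qed

end
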